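(* Let $\Gamma$ be a torsionless grading monoid, let $R$ be a $\Gamma$-graded integral domain, and let $R'$ be the integral closure of $R$. Then $R$ is a gr-$i$-domain if and only if $R\subseteq R'$ is a gr-$i$-extension and $R'$ is a gr-Prüfer domain.
   Context: A torsionless grading monoid is a torsion-free commutative cancellative monoid (written additively). For such a monoid $\Gamma$, an integral domain $R$ is a $\Gamma$-graded integral domain if $R=\bigoplus_{\alpha\in\Gamma}R_\alpha$ with each $R_\alpha$ an additive subgroup of $R$ and $R_\beta R_\gamma\subseteq R_{\beta+\gamma}$ for all $\beta,\gamma\in\Gamma$. Nonzero elements of some $R_\alpha$ are called homogeneous (of degree $\alpha$); an ideal is homogeneous (graded) if it is generated by homogeneous elements. Let $H$ be the set of nonzero homogeneous elements of $R$. The graded quotient field of $R$ is $R_H$, the localization of $R$ at $H$. It is graded by the group $\langle\Gamma\rangle=\{a-b : a,b\in\Gamma\}$, with $(R_H)_\alpha=\{f/g : f,g \text{ homogeneous},\ g\neq 0,\ \deg f-\deg g=\alpha\}$ (together with $0$). A graded overring of $R$ is a ring $T$ with $R\subseteq T\subseteq R_H$ that is a graded subring of $R_H$, i.e. $T=\bigoplus_{\alpha\in\langle\Gamma\rangle}(T\cap (R_H)_\alpha)$. $R'$ denotes the integral closure of $R$ in its (ordinary) field of fractions; it is known that $R'$ is a graded overring of $R$, and it is regarded as a graded domain with this grading. An extension $R\subseteq T$ of graded integral domains (with $R$ a graded subring of $T$) is a graded $i$-extension (gr-$i$-extension) if for every pair of homogeneous prime ideals $Q_1,Q_2$ of $T$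 such that $Q_1\cap R=Q_2\cap R$, we have $Q_1=Q_2$. A graded integral domain $R$ is a gr-$i$-domain (graded injective domain) if $R\subseteq T$ is a gr-$i$-extension for every graded overring $T$ of $R$. A graded integral domain is gr-Prüfer if every nonzero finitely generated homogeneous ideal of it is invertible. *)

theory Defs
  imports
    "HOL-Computational_Algebra.Polynomial_Factorial"
    "HOL-Algebra.Algebraic_Closure_Type"
    "HOL-Algebra.Subrings"
    "HOL-Algebra.Ideal_Product"
begin

section \<open>Torsionless grading monoids and their groups of differences\<close>

text \<open>The sum over \<open>i < n\<close> of the constant \<open>a\<close> is the multiple \<open>n a\<close>.\<close>

class torsionless_grading_monoid = cancel_comm_monoid_add +
  assumes torsion_free: "0 < n \<Longrightarrow> (\<Sum>i<(n::nat). a) = (\<Sum>i<n. b) \<Longrightarrow> a = b"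

definition diff_rel :: "'g::cancel_comm_monoid_add \<times> 'g \<Rightarrow> 'g \<times> 'g \<Rightarrow> bool"
  where "diff_rel p q \<longleftrightarrow> fst p + snd q = fst q + snd p"

lemma equivp_diff_rel: "equivp (diff_rel :: 'g::cancel_comm_monoid_add \<times> 'g \<Rightarrow> _)"
proof (rule equivpI)
  show "reflp (diff_rel :: 'g \<times> 'g \<Rightarrow> _)" by (simp add: reflp_def diff_rel_def)
  show "symp (diff_rel :: 'g \<times> 'g \<Rightarrow> _)" by (simp add: symp_def diff_rel_def)
  show "transp (diff_rel :: 'g \<times> 'g \<Rightarrow> _)"
  proof (rule transpI)
    fix p q r :: "'g \<times> 'g"
    assume pq: "diff_rel p q" and qr: "diff_rel q r"
    have "(fst p + snd r) + snd q = (fst p + snd q) + snd r" by (simp add: ac_simps)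
    also have "\<dots> = (fst q + snd r) + snd p" using pq by (simp add: diff_rel_def ac_simps)
    also have "\<dots> = (fst r + snd p) + snd q" using qr by (simp add: diff_rel_def ac_simps)
    finally show "diff_rel p r" by (simp add: diff_rel_def)
  qed
qed

text \<open>The group \<open>\<langle>\<Gamma>\<rangle>\<close>; the pair \<open>(a, b)\<close> represents the formal difference \<open>a - b\<close>.\<close>

quotient_type (overloaded) 'g diff_group = "'g::cancel_comm_monoid_add \<times> 'g" / diff_rel
  by (rule equivp_diff_rel)

instantiation diff_group :: (cancel_comm_monoid_add) ab_group_add
begin

lift_definition zero_diff_group :: "'a diff_group" is "(0, 0)" .

lift_definition plus_diff_group :: "'a diff_group \<Rightarrow> 'a diff_group \<Rightarrow> 'a diff_group"
  is "\<lambda>p q. (fst p + fst q, snd p + snd q)"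
proof -
  fix p p' q q' :: "'a \<times> 'a"
  assume h: "diff_rel p p'" "diff_rel q q'"
  have "(fst p + fst q) + (snd p' + snd q') = (fst p + snd p') + (fst q + snd q')"
    by (simp add: ac_simps)
  also have "\<dots> = (fst p' + snd p) + (fst q' + snd q)" using h by (simp add: diff_rel_def)
  also have "\<dots> = (fst p' + fst q') + (snd p + snd q)" by (simp add: ac_simps)
  finally show "diff_rel (fst p + fst q, snd p + snd q) (fst p' + fst q', snd p' + snd q')"
    by (simp add: diff_rel_def)
qed

lift_definition uminus_diff_group :: "'a diff_group \<Rightarrow> 'a diff_group"
  is "\<lambda>p. (snd p, fst p)"
  by (simp add: diff_rel_def add.commute)

definition minus_diff_group :: "'a diff_group \<Rightarrow> 'a diff_group \<Rightarrow> 'a diff_group"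
  where "minus_diff_group x y = x + - y"

instance
proof
  fix x y z :: "'a diff_group"
  show "x + y + z = x + (y + z)" by transfer (simp add: diff_rel_def ac_simps)
  show "x + y = y + x" by transfer (simp add: diff_rel_def ac_simps)
  show "0 + x = x" by transfer (simp add: diff_rel_def)
  show "- x + x = 0" by transfer (simp add: diff_rel_def ac_simps)
  show "x - y = x + - y" by (rule minus_diff_group_def)
qed

end

lift_definition to_diff_group :: "'g::cancel_comm_monoid_add \<Rightarrow> 'g diff_group"
  is "\<lambda>a. (a, 0)" .

lemma to_diff_group_eq_iff: "to_diff_group a = to_diff_group b \<longleftrightarrow> a = b"
  by transfer (simp add: diff_rel_def)

lemma to_diff_group_add: "to_diff_group (a + b) = to_diff_group a + to_diff_group b"
  by transfer (simp add: diff_rel_def)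

lemma diff_group_is_difference: "\<exists>a b. x = to_diff_group a - to_diff_group b"
  unfolding minus_diff_group_def by transfer (auto simp: diff_rel_def)


section \<open>Graded rings, homogeneous ideals\<close>

text \<open>A subset \<open>T\<close> of a ring type, viewed as a ring with the ambient operations.\<close>

abbreviation ring_on :: "'k::comm_ring_1 set \<Rightarrow> 'k ring"
  where "ring_on T \<equiv> ring_of_type_algebra\<lparr>carrier := T\<rparr>"

text \<open>\<open>S\<close> is the internal direct sum of the additive subgroups \<open>\<A> i\<close>: every element of \<open>S\<close> is a
  sum of components for exactly one finitely supported family, and all such sums lie in \<open>S\<close>.\<close>

definition internal_direct_sum :: "('i \<Rightarrow> 'k::comm_ring_1 set) \<Rightarrow> 'k set \<Rightarrow> bool"
  where "internal_direct_sum \<A> S \<longleftrightarrow>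
    (\<forall>i. additive_subgroup (\<A> i) ring_of_type_algebra) \<and>
    bij_betw (\<lambda>c. \<Sum>i | c i \<noteq> 0. c i) {c. (\<forall>i. c i \<in> \<A> i) \<and> finite {i. c i \<noteq> 0}} S"

definition graded_integral_domain ::
    "('g::torsionless_grading_monoid \<Rightarrow> 'a::idom set) \<Rightarrow> bool"
  where "graded_integral_domain \<A> \<longleftrightarrow>
    internal_direct_sum \<A> UNIV \<and>
    (\<forall>\<beta> \<gamma>. \<forall>x\<in>\<A> \<beta>. \<forall>y\<in>\<A> \<gamma>. x * y \<in> \<A> (\<beta> + \<gamma>))"

definition homogeneous_elements :: "('i \<Rightarrow> 'k::comm_ring_1 set) \<Rightarrow> 'k set"
  where "homogeneous_elements \<A> = (\<Union>i. \<A> i) - {0}"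

definition homogeneous_ideal :: "('i \<Rightarrow> 'k::comm_ring_1 set) \<Rightarrow> 'k set \<Rightarrow> 'k set \<Rightarrow> bool"
  where "homogeneous_ideal \<A> T I \<longleftrightarrow>
    (\<exists>S. S \<subseteq> homogeneous_elements \<A> \<and> I = Idl\<^bsub>ring_on T\<^esub> S)"

definition finitely_generated_ideal :: "'k::comm_ring_1 set \<Rightarrow> 'k set \<Rightarrow> bool"
  where "finitely_generated_ideal T I \<longleftrightarrow>
    (\<exists>S. finite S \<and> S \<subseteq> T \<and> I = Idl\<^bsub>ring_on T\<^esub> S)"

text \<open>For a nonzero ideal \<open>I\<close> of a subring \<open>T\<close> of a field, the elements \<open>x\<close> of that field with
  \<open>x I \<subseteq> T\<close> automatically lie in the fraction field of \<open>T\<close>, so this is \<open>I\<inverse> = (T : I)\<close>.\<close>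

definition ideal_inverse :: "'k::field set \<Rightarrow> 'k set \<Rightarrow> 'k set"
  where "ideal_inverse T I = {x. \<forall>y\<in>I. x * y \<in> T}"

text \<open>\<open>ideal_prod\<close> only uses the operations of its ring argument: it is the set of finite
  sums of products, also for the fractional ideal \<open>I\<inverse>\<close>.\<close>

definition invertible_ideal :: "'k::field set \<Rightarrow> 'k set \<Rightarrow> bool"
  where "invertible_ideal T I \<longleftrightarrow>
    ideal_prod ring_of_type_algebra I (ideal_inverse T I) = T"

definition gr_Prufer_domain :: "('i \<Rightarrow> 'k::field set) \<Rightarrow> 'k set \<Rightarrow> bool"
  where "gr_Prufer_domain \<A> T \<longleftrightarrow>
    (\<forall>I. homogeneous_ideal \<A> T I \<and> finitely_generated_ideal T I \<and> I \<noteq> {0}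
         \<longrightarrow> invertible_ideal T I)"

text \<open>\<open>\<A>\<close> is the grading of the larger ring \<open>T\<close>.\<close>

definition gr_i_extension :: "'k::field set \<Rightarrow> ('i \<Rightarrow> 'k set) \<Rightarrow> 'k set \<Rightarrow> bool"
  where "gr_i_extension R \<A> T \<longleftrightarrow>
    (\<forall>Q1 Q2. primeideal Q1 (ring_on T) \<and> homogeneous_ideal \<A> T Q1 \<and>
             primeideal Q2 (ring_on T) \<and> homogeneous_ideal \<A> T Q2 \<and>
             Q1 \<inter> R = Q2 \<inter> R \<longrightarrow> Q1 = Q2)"


section \<open>Graded overrings inside the fraction field\<close>

text \<open>The graded domain \<open>R\<close> is a whole type \<open>'a\<close>; inside its fraction field \<open>'a fract\<close> it is
  the set \<open>range to_fract\<close>.\<close>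

definition graded_quotient_field ::
    "('g::torsionless_grading_monoid \<Rightarrow> 'a::idom set) \<Rightarrow> 'a fract set"
  where "graded_quotient_field \<A> = {Fract r h | r h. h \<in> homogeneous_elements \<A>}"

definition quotient_component ::
    "('g::torsionless_grading_monoid \<Rightarrow> 'a::idom set) \<Rightarrow> 'g diff_group \<Rightarrow> 'a fract set"
  where "quotient_component \<A> \<alpha> =
    {Fract f g | f g \<beta> \<gamma>. f \<in> \<A> \<beta> \<and> f \<noteq> 0 \<and> g \<in> \<A> \<gamma> \<and> g \<noteq> 0 \<and>
                         to_diff_group \<beta> - to_diff_group \<gamma> = \<alpha>} \<union> {0}"

definition overring_grading ::
    "('g::torsionless_grading_monoid \<Rightarrow> 'a::idom set) \<Rightarrow> 'a fract set
      \<Rightarrow> 'g diff_group \<Rightarrow> 'a fract set"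
  where "overring_grading \<A> T \<alpha> = T \<inter> quotient_component \<A> \<alpha>"

definition graded_overring ::
    "('g::torsionless_grading_monoid \<Rightarrow> 'a::idom set) \<Rightarrow> 'a fract set \<Rightarrow> bool"
  where "graded_overring \<A> T \<longleftrightarrow>
    subring T ring_of_type_algebra \<and>
    range to_fract \<subseteq> T \<and> T \<subseteq> graded_quotient_field \<A> \<and>
    internal_direct_sum (overring_grading \<A> T) T"

definition gr_i_domain :: "('g::torsionless_grading_monoid \<Rightarrow> 'a::idom set) \<Rightarrow> bool"
  where "gr_i_domain \<A> \<longleftrightarrow>
    (\<forall>T. graded_overring \<A> T \<longrightarrow> gr_i_extension (range to_fract) (overring_grading \<A> T) T)"

definition integral_closure_in_field :: "'k::field set \<Rightarrow> 'k set"
  where "integral_closure_in_field R =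
    {x. \<exists>p. lead_coeff p = 1 \<and> (\<forall>i. Polynomial.coeff p i \<in> R) \<and> poly p x = 0}"

end

theory Submission
  imports Defs "Jordan_Normal_Form.Char_Poly"
begin

text \<open>Let \<open>K\<close> be the fraction field of \<open>R\<close>, let \<open>G\<close> be the group of differences of the grading monoid, and let
\<open>C \<alpha>\<close> be the degree \<open>\<alpha>\<close> part of the graded quotient field. Everything takes place inside \<open>K\<close>: a graded
overring is a subring between \<open>R\<close> and the sum \<open>D\<close> of the \<open>C \<alpha>\<close> that contains the homogeneous components
of its elements, and homogeneous ideals are the ideals with this closure property.

\<^emph>\<open>Torsion-freeness\<close> enters through weights (\<open>injective_integral_weight\<close>): for finitely many degrees there
is an additive map from \<open>G\<close> to the rationals that is injective on them. Comparing the components of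
largest weight shows that a homogeneous ideal is prime as soon as it is prime for homogeneous elements
(\<open>prime_of_homogeneous_test\<close>). Hence the homogeneous elements of any prime generate a prime, its graded
core (\<open>prime_graded_core\<close>).

\<^emph>\<open>The integral closure \<open>R'\<close> is a graded overring\<close> (\<open>integral_in_D\<close>, \<open>graded_integral_closure\<close>). A weight
turns \<open>f = \<Sum> f\<^sub>\<alpha>\<close> into the polynomial \<open>\<Sum> f\<^sub>\<alpha> t ^ w \<alpha>\<close>, up to a shift of the exponents. If \<open>f / g\<close> is integral
over \<open>R\<close>, then the quotient of the polynomials of \<open>f\<close> and \<open>g\<close> is integral over \<open>R[t, 1 / t]\<close>. Since \<open>K[t]\<close>
is integrally closed, that quotient is a polynomial \<open>h\<close> up to a power of \<open>t\<close>, and its coefficients are integral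
over \<open>R\<close> (\<open>integral_weight_quotient\<close>). The leading coefficient of the polynomial of \<open>g\<close> is homogeneous, so
it is a unit of \<open>D\<close>, and long division gives \<open>f / g = h(1) \<in> D\<close>. For homogeneous \<open>g\<close> the coefficients
of \<open>h\<close> are the components of \<open>f / g\<close>, which are therefore integral.

\<^emph>\<open>From the graded injective property to the gr-Pruefer property\<close> (\<open>gr_Prufer_of_gr_injective\<close>). Let \<open>P\<close> be a
homogeneous prime of \<open>R'\<close> and \<open>u\<close> a nonzero homogeneous element. If neither \<open>u\<close> nor \<open>1 / u\<close> is a fraction
over \<open>R'\<close> with denominator outside \<open>P\<close>, then every polynomial over \<open>R'\<close> that vanishes at \<open>u\<close> has all its
coefficients in \<open>P\<close> (\<open>comparable_of_relation\<close>). So \<open>R'[u] / P R'[u]\<close> is a polynomial ring over \<open>R' / P\<close>, and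
\<open>P R'[u]\<close> and \<open>P + u R'[u]\<close> are two homogeneous primes of the graded overring \<open>R'[u]\<close> with the same
contraction (\<open>two_primes_over\<close>). Thus homogeneous elements are comparable at every prime, one of
finitely many homogeneous generators of an ideal divides the others locally, and the ideal is invertible.

\<^emph>\<open>Back\<close> (\<open>gr_injective_of_gr_Prufer\<close>). Two homogeneous primes of a graded overring \<open>T\<close> with the same
contraction to \<open>R\<close> are lifted to the integral closure of \<open>T\<close>, which contains \<open>R'\<close>. The graded cores of
their contractions to \<open>R'\<close> have the same contraction to \<open>R\<close>, so they agree. Invertibility of \<open>(a, b)\<close> makes
every homogeneous element \<open>a / b\<close> of \<open>T\<close> comparable with \<open>1\<close> at this common prime, and this decides in the
same way for both primes of \<open>T\<close> whether \<open>a / b\<close> belongs to them.\<close>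

section \<open>Weights on torsion-free groups\<close>

class torsion_free_ab_group = ab_group_add +
  assumes multiple_eq_0D: "0 < n \<Longrightarrow> (\<Sum>i<(n::nat). a) = 0 \<Longrightarrow> a = 0"

lemma sum_to_diff_group: "(\<Sum>i<(n::nat). to_diff_group a) = to_diff_group (\<Sum>i<n. a)"
proof (induction n)
  case 0
  show ?case by simp (transfer, simp add: diff_rel_def)
next
  case (Suc n)
  then show ?case by (simp add: to_diff_group_add)
qed

instance diff_group :: (torsionless_grading_monoid) torsion_free_ab_group
proof
  fix n :: nat and x :: "'a diff_group"
  assume n: "0 < n" and x: "(\<Sum>i<n. x) = 0"
  obtain a b where ab: "x = to_diff_group a - to_diff_group b"
    using diff_group_is_difference by blast
  have "(\<Sum>i<n. x) = to_diff_group (\<Sum>i<n. a) - to_diff_group (\<Sum>i<n. b)"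
    by (simp only: ab sum_subtractf sum_to_diff_group)
  with x have "(\<Sum>i<n. a) = (\<Sum>i<n. b)"
    by (simp add: to_diff_group_eq_iff)
  then have "a = b" by (rule torsion_free[OF n])
  then show "x = 0" using ab by simp
qed

definition int_multiple :: "int \<Rightarrow> 'g::ab_group_add \<Rightarrow> 'g"
  where "int_multiple k x = (if 0 \<le> k then \<Sum>i<nat k. x else - (\<Sum>i<nat (-k). x))"

lemma int_multiple_0 [simp]: "int_multiple 0 x = 0"
  by (simp add: int_multiple_def)

lemma int_multiple_Suc: "int_multiple (k + 1) x = int_multiple k x + x"
proof (cases "0 \<le> k")
  case True
  then have "nat (k + 1) = Suc (nat k)" by simp
  with True show ?thesis by (simp add: int_multiple_def)
next
  case False
  then have "nat (- k) = Suc (nat (- (k + 1)))" by simp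
  with False show ?thesis by (cases "k = -1") (simp_all add: int_multiple_def)
qed

lemma int_multiple_pred: "int_multiple (k - 1) x = int_multiple k x - x"
  using int_multiple_Suc[of "k - 1" x] by simp

lemma int_multiple_1 [simp]: "int_multiple 1 x = x"
  using int_multiple_Suc[of 0 x] by simp

lemma int_multiple_add: "int_multiple (k + l) x = int_multiple k x + int_multiple l x"
proof (induction l rule: int_induct[where k = 0])
  case (step1 i)
  then show ?case
    using int_multiple_Suc[of "k + i" x] by (simp add: int_multiple_Suc add.assoc)
next
  case (step2 i)
  then show ?case
    using int_multiple_pred[of "k + i" x] by (simp add: int_multiple_pred add_diff_eq)
qed simp

lemma int_multiple_minus: "int_multiple (- k) x = - int_multiple k x"
  using int_multiple_add[of k "- k" x] by (simp add: eq_neg_iff_add_eq_0 add.commute)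

lemma int_multiple_diff: "int_multiple (k - l) x = int_multiple k x - int_multiple l x"
  using int_multiple_add[of k "- l" x] by (simp add: int_multiple_minus)

lemma int_multiple_mult: "int_multiple (k * l) x = int_multiple k (int_multiple l x)"
proof (induction k rule: int_induct[where k = 0])
  case (step1 i)
  then show ?case by (simp add: distrib_right int_multiple_add)
next
  case (step2 i)
  then show ?case by (simp add: left_diff_distrib int_multiple_diff)
qed simp

lemma int_multiple_distrib: "int_multiple k (x + y) = int_multiple k x + int_multiple k y"
proof (induction k rule: int_induct[where k = 0])
  case (step1 i)
  then show ?case by (simp only: int_multiple_Suc) (simp add: ac_simps)
next
  case (step2 i)
  then show ?case by (simp add: int_multiple_pred algebra_simps)
qed simp

lemma int_multiple_uminus: "int_multiple k (- x) = - int_multiple k x"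
  using int_multiple_distrib[of k x "- x"] int_multiple_mult[of k 0 x]
  by (simp add: eq_neg_iff_add_eq_0 add.commute)

lemma int_multiple_distrib_diff: "int_multiple k (x - y) = int_multiple k x - int_multiple k y"
  using int_multiple_distrib[of k x "- y"] by (simp add: int_multiple_uminus)

lemma int_multiple_eq_0D:
  assumes "int_multiple k (x::'g::torsion_free_ab_group) = 0" "x \<noteq> 0"
  shows "k = 0"
proof (rule ccontr)
  assume "k \<noteq> 0"
  then consider "0 < k" | "k < 0" by linarith
  then show False
  proof cases
    case 1
    then show False using assms multiple_eq_0D[of "nat k" x] by (simp add: int_multiple_def)
  next
    case 2
    then show False using assms multiple_eq_0D[of "nat (-k)" x] by (simp add: int_multiple_def)
  qed
qed

definition diff_closed :: "'g::ab_group_add set \<Rightarrow> bool"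
  where "diff_closed H \<longleftrightarrow> 0 \<in> H \<and> (\<forall>a\<in>H. \<forall>b\<in>H. a - b \<in> H)"

lemma diff_closed_add:
  assumes "diff_closed H" "a \<in> H" "b \<in> H"
  shows "a + b \<in> H"
proof -
  have "0 - b \<in> H" using assms unfolding diff_closed_def by blast
  then have "a - (0 - b) \<in> H" using assms unfolding diff_closed_def by blast
  then show ?thesis by simp
qed

lemma diff_closed_multiple:
  assumes "diff_closed H" "a \<in> H"
  shows "int_multiple k a \<in> H"
proof (induction k rule: int_induct[where k = 0])
  case base
  show ?case using assms by (simp add: diff_closed_def)
next
  case (step1 i)
  then show ?case using assms by (simp add: int_multiple_Suc diff_closed_add)
next
  case (step2 i)
  then show ?case using assms by (simp add: int_multiple_pred diff_closed_def)
qed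

text \<open>A subgroup \<open>H\<close> that is maximal among those containing no nonzero multiple of \<open>x\<close> has the property that every
\<open>y\<close> satisfies a relation \<open>m y - n x \<in> H\<close> with \<open>m \<noteq> 0\<close>. The ratio \<open>n / m\<close> depends on \<open>y\<close> only and is additive
in \<open>y\<close>: it is the projection of \<open>G \<otimes> \<rat>\<close> onto the line through \<open>x\<close>.\<close>

lemma separating_weight:
  fixes x :: "'g::torsion_free_ab_group"
  assumes x: "x \<noteq> 0"
  shows "\<exists>w :: 'g \<Rightarrow> rat. (\<forall>a b. w (a + b) = w a + w b) \<and> w x = 1"
proof -
  define \<H> where "\<H> = {H. diff_closed H \<and> (\<forall>k. int_multiple k x \<in> H \<longrightarrow> k = 0)}"
  have "\<exists>M\<in>\<H>. \<forall>H\<in>\<H>. M \<subseteq> H \<longrightarrow> H = M"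
  proof (rule subset_Zorn_nonempty)
    have "{0} \<in> \<H>"
      using int_multiple_eq_0D[OF _ x] by (auto simp: \<H>_def diff_closed_def)
    then show "\<H> \<noteq> {}" by blast
  next
    fix \<C> assume ne: "\<C> \<noteq> {}" and ch: "subset.chain \<H> \<C>"
    have sub: "\<C> \<subseteq> \<H>" using ch by (simp add: subset.chain_def)
    have "diff_closed (\<Union>\<C>)"
      unfolding diff_closed_def
    proof (intro conjI ballI)
      show "0 \<in> \<Union>\<C>" using ne sub by (auto simp: \<H>_def diff_closed_def)
    next
      fix a b assume "a \<in> \<Union>\<C>" "b \<in> \<Union>\<C>"
      then obtain A B where AB: "A \<in> \<C>" "a \<in> A" "B \<in> \<C>" "b \<in> B" by blast
      then consider "A \<subseteq> B" | "B \<subseteq> A"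
        using ch by (auto simp: subset_chain_def)
      then obtain E where "E \<in> \<C>" "a \<in> E" "b \<in> E" using AB by cases blast+
      then show "a - b \<in> \<Union>\<C>" using sub by (auto simp: \<H>_def diff_closed_def)
    qed
    then show "\<Union>\<C> \<in> \<H>" using sub by (auto simp: \<H>_def)
  qed
  then obtain H where "H \<in> \<H>" and max: "\<And>H'. H' \<in> \<H> \<Longrightarrow> H \<subseteq> H' \<Longrightarrow> H' = H"
    by blast
  then have H: "diff_closed H" and Hx: "\<And>k. int_multiple k x \<in> H \<Longrightarrow> k = 0"
    by (auto simp: \<H>_def)
  \<comment> \<open>If \<open>y\<close> is not in \<open>H\<close>, then the larger subgroup \<open>H + \<int> y\<close> contains a nonzero multiple of \<open>x\<close>.\<close>
  have ex: "\<exists>m n. m \<noteq> 0 \<and> int_multiple m y - int_multiple n x \<in> H" for y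
  proof (cases "y \<in> H")
    case True
    then show ?thesis by (intro exI[of _ 1] exI[of _ 0]) simp
  next
    case False
    define H' where "H' = {h + int_multiple k y | h k. h \<in> H}"
    have "diff_closed H'"
      unfolding diff_closed_def
    proof (intro conjI ballI)
      have "0 = 0 + int_multiple 0 y" "0 \<in> H" using H by (simp_all add: diff_closed_def)
      then show "0 \<in> H'" unfolding H'_def by blast
    next
      fix a b assume "a \<in> H'" "b \<in> H'"
      then obtain h k h' k' where "a = h + int_multiple k y" "b = h' + int_multiple k' y"
        "h \<in> H" "h' \<in> H" by (auto simp: H'_def)
      then have "a - b = (h - h') + int_multiple (k - k') y" "h - h' \<in> H"
        using H by (auto simp: int_multiple_diff diff_closed_def)
      then show "a - b \<in> H'" unfolding H'_def by blast
    qed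
    have "H \<subseteq> H'"
    proof
      fix h assume "h \<in> H"
      moreover have "h = h + int_multiple 0 y" by simp
      ultimately show "h \<in> H'" unfolding H'_def by blast
    qed
    moreover have "y \<in> H'"
    proof -
      have "y = 0 + int_multiple 1 y" "0 \<in> H" using H by (simp_all add: diff_closed_def)
      then show ?thesis unfolding H'_def by blast
    qed
    ultimately have "H' \<notin> \<H>"
      using max[of H'] False by blast
    with \<open>diff_closed H'\<close> obtain k where "int_multiple k x \<in> H'" "k \<noteq> 0"
      unfolding \<H>_def by blast
    then obtain h l where hl: "int_multiple k x = h + int_multiple l y" "h \<in> H"
      by (auto simp: H'_def)
    have "l \<noteq> 0"
    proof
      assume "l = 0"
      with hl have "int_multiple k x \<in> H" by simp
      with Hx \<open>k \<noteq> 0\<close> show False by blast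
    qed
    moreover have "int_multiple l y - int_multiple k x = 0 - h"
      using hl by simp
    moreover have "0 - h \<in> H" using H hl unfolding diff_closed_def by blast
    ultimately show ?thesis by (intro exI[of _ l] exI[of _ k]) simp
  qed
  \<comment> \<open>Eliminating \<open>y\<close> from two relations leaves a multiple of \<open>x\<close> in \<open>H\<close>.\<close>
  have unique: "m' * n = m * n'"
    if "int_multiple m y - int_multiple n x \<in> H" "int_multiple m' y - int_multiple n' x \<in> H"
    for m n m' n' y
  proof -
    have "int_multiple m (int_multiple m' y - int_multiple n' x)
        - int_multiple m' (int_multiple m y - int_multiple n x) \<in> H"
      using that H diff_closed_multiple[OF H] unfolding diff_closed_def by blast
    also have "int_multiple m (int_multiple m' y - int_multiple n' x)
        - int_multiple m' (int_multiple m y - int_multiple n x)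
        = int_multiple (m' * n - m * n') x"
      by (simp add: int_multiple_distrib_diff int_multiple_diff
          flip: int_multiple_mult) (simp add: mult.commute)
    finally show ?thesis using Hx[of "m' * n - m * n'"] by simp
  qed
  define w where "w y = (THE q::rat. \<exists>m n. m \<noteq> 0 \<and> int_multiple m y - int_multiple n x \<in> H
      \<and> q = of_int n / of_int m)" for y
  have w_eq: "w y = of_int n / of_int m"
    if "m \<noteq> 0" "int_multiple m y - int_multiple n x \<in> H" for y m n
    unfolding w_def
  proof (rule the_equality)
    fix q :: rat
    assume "\<exists>m n. m \<noteq> 0 \<and> int_multiple m y - int_multiple n x \<in> H \<and> q = of_int n / of_int m"
    then obtain m' n' where q: "m' \<noteq> 0" "int_multiple m' y - int_multiple n' x \<in> H"
      "q = of_int n' / of_int m'" by blast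
    have "of_int (m' * n) = (of_int (m * n') :: rat)"
      using unique[OF that(2) q(2)] by simp
    then show "q = of_int n / of_int m"
      using that(1) q(1,3) by (simp add: frac_eq_eq mult.commute)
  qed (use that in blast)
  have "w (a + b) = w a + w b" for a b
  proof -
    obtain m n where a: "m \<noteq> 0" "int_multiple m a - int_multiple n x \<in> H" using ex by blast
    obtain m' n' where b: "m' \<noteq> 0" "int_multiple m' b - int_multiple n' x \<in> H" using ex by blast
    have "int_multiple m' (int_multiple m a - int_multiple n x)
        + int_multiple m (int_multiple m' b - int_multiple n' x) \<in> H"
      using diff_closed_add[OF H diff_closed_multiple[OF H a(2)] diff_closed_multiple[OF H b(2)]] .
    also have "int_multiple m' (int_multiple m a - int_multiple n x)
        + int_multiple m (int_multiple m' b - int_multiple n' x)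
        = int_multiple (m * m') (a + b) - int_multiple (m' * n + m * n') x"
      by (simp add: int_multiple_distrib_diff int_multiple_distrib int_multiple_add
          flip: int_multiple_mult) (simp add: mult.commute)
    finally have "int_multiple (m * m') (a + b) - int_multiple (m' * n + m * n') x \<in> H" .
    then have "w (a + b) = of_int (m' * n + m * n') / of_int (m * m')"
      using a(1) b(1) by (intro w_eq) auto
    also have "\<dots> = w a + w b"
      unfolding w_eq[OF a] w_eq[OF b] using a(1) b(1) by (simp add: add_frac_eq mult.commute add.commute)
    finally show ?thesis .
  qed
  moreover have "w x = 1"
    using w_eq[of 1 x 1] H by (simp add: diff_closed_def)
  ultimately show ?thesis by blast
qed

lemma additive_0:
  assumes "\<And>a b. w (a + b) = w a + w (b::'g::ab_group_add)"
  shows "w 0 = (0::rat)"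
  using assms[of 0 0] by simp

lemma additive_diff:
  assumes "\<And>a b. w (a + b) = w a + w (b::'g::ab_group_add)"
  shows "w (a - b) = w a - (w b :: rat)"
  using assms[of "a - b" b] by simp

text \<open>By induction on \<open>V\<close>: to a weight that is nonzero on the previous elements, a separating weight for the new one
is added with a scalar that avoids finitely many values.\<close>

lemma nonvanishing_weight:
  fixes V :: "'g::torsion_free_ab_group set"
  assumes "finite V" "0 \<notin> V"
  shows "\<exists>w :: 'g \<Rightarrow> rat. (\<forall>a b. w (a + b) = w a + w b) \<and> (\<forall>v\<in>V. w v \<noteq> 0)"
  using assms
proof (induction V)
  case empty
  show ?case by (intro exI[of _ "\<lambda>_. 0"]) simp
next
  case (insert v V)
  then obtain w :: "'g \<Rightarrow> rat" where w: "\<And>a b. w (a + b) = w a + w b" "\<And>v. v \<in> V \<Longrightarrow> w v \<noteq> 0"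
    by auto
  obtain w' :: "'g \<Rightarrow> rat" where w': "\<And>a b. w' (a + b) = w' a + w' b" "w' v = 1"
    using separating_weight[of v] insert by auto
  have "finite ((\<lambda>y. - w' y / w y) ` insert v V)"
    using insert by simp
  then obtain c :: rat where c: "c \<notin> (\<lambda>y. - w' y / w y) ` insert v V"
    using ex_new_if_finite[OF infinite_UNIV_char_0] by blast
  have "w' y + c * w y \<noteq> 0" if "y \<in> insert v V" for y
  proof (cases "w y = 0")
    case True
    then have "y = v" using that w by auto
    then show ?thesis using True w' by simp
  next
    case False
    have "c \<noteq> - w' y / w y" using c that by blast
    then show ?thesis using False by (auto simp: field_simps add_eq_0_iff)
  qed
  then show ?case
    by (intro exI[of _ "\<lambda>y. w' y + c * w y"]) (simp add: w(1) w'(1) distrib_left)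
qed

lemma common_denominator:
  assumes "finite F"
  shows "\<exists>d::int. d > 0 \<and> (\<forall>q\<in>F. of_int d * (q::rat) \<in> \<int>)"
  using assms
proof (induction F)
  case empty
  show ?case by (intro exI[of _ 1]) simp
next
  case (insert q F)
  then obtain d where d: "d > 0" "\<And>q. q \<in> F \<Longrightarrow> of_int d * q \<in> \<int>" by blast
  obtain a b where ab: "q = of_int a / of_int b" "b > 0"
    by (metis Fract_of_int_quotient quotient_of_denom_pos' quotient_of_div surjective_pairing)
  show ?case
  proof (intro exI[of _ "b * d"] conjI ballI)
    fix r assume "r \<in> insert q F"
    then consider "r = q" | "r \<in> F" by blast
    then show "of_int (b * d) * r \<in> \<int>"
    proof cases
      case 1
      then have "of_int (b * d) * r = of_int (d * a)" using ab by simp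
      then show ?thesis by (metis Ints_of_int)
    next
      case 2
      have "of_int b * (of_int d * r) \<in> \<int>" by (rule Ints_mult[OF Ints_of_int d(2)[OF 2]])
      then show ?thesis by (simp only: of_int_mult mult.assoc)
    qed
  qed (use d ab in simp)
qed

text \<open>This is the only form in which torsion-freeness of the group is used later: a substitute for a total order
that also provides integral exponents for polynomials.\<close>

lemma injective_integral_weight:
  fixes F :: "'g::torsion_free_ab_group set"
  assumes "finite F"
  shows "\<exists>w :: 'g \<Rightarrow> rat. (\<forall>a b. w (a + b) = w a + w b) \<and> inj_on w F \<and> w ` F \<subseteq> \<int>"
proof -
  define V where "V = (\<lambda>(a, b). a - b) ` (F \<times> F) - {0}"
  have "finite V" "0 \<notin> V" using assms by (auto simp: V_def)
  from nonvanishing_weight[OF this] obtain w :: "'g \<Rightarrow> rat"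
    where w: "\<And>a b. w (a + b) = w a + w b" "\<And>v. v \<in> V \<Longrightarrow> w v \<noteq> 0" by blast
  obtain d where d: "d > 0" "\<And>q. q \<in> w ` F \<Longrightarrow> of_int d * q \<in> \<int>"
    using common_denominator[of "w ` F"] assms by blast
  have "inj_on (\<lambda>a. of_int d * w a) F"
  proof (rule inj_onI)
    fix a b assume ab: "a \<in> F" "b \<in> F" "of_int d * w a = of_int d * w b"
    then have "w (a - b) = 0" using d by (simp add: additive_diff[OF w(1)])
    then have "a - b \<notin> V" using w by blast
    then show "a = b" using ab by (force simp: V_def)
  qed
  then show ?thesis using d
    by (intro exI[of _ "\<lambda>a. of_int d * w a"]) (auto simp: w(1) distrib_left)
qed

section \<open>Integral elements\<close>

text \<open>Subrings are treated as plain subsets of a commutative ring type; \<open>subring_iff\<close> below gives the link with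
\<open>subring\<close>.\<close>

definition subring_closed :: "'k::comm_ring_1 set \<Rightarrow> bool"
  where "subring_closed S \<longleftrightarrow> 1 \<in> S \<and> (\<forall>x\<in>S. \<forall>y\<in>S. x - y \<in> S \<and> x * y \<in> S)"

lemma subring_closedD:
  assumes "subring_closed S"
  shows "1 \<in> S" "0 \<in> S" "x \<in> S \<Longrightarrow> y \<in> S \<Longrightarrow> x - y \<in> S" "x \<in> S \<Longrightarrow> y \<in> S \<Longrightarrow> x * y \<in> S"
    "x \<in> S \<Longrightarrow> - x \<in> S" "x \<in> S \<Longrightarrow> y \<in> S \<Longrightarrow> x + y \<in> S" "x \<in> S \<Longrightarrow> x ^ n \<in> S"
proof -
  show 1: "1 \<in> S" and diff: "\<And>x y. x \<in> S \<Longrightarrow> y \<in> S \<Longrightarrow> x - y \<in> S"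
    and mult: "\<And>x y. x \<in> S \<Longrightarrow> y \<in> S \<Longrightarrow> x * y \<in> S"
    using assms by (auto simp: subring_closed_def)
  show 0: "0 \<in> S" using diff[OF 1 1] by simp
  show minus: "- x \<in> S" if "x \<in> S" for x using diff[OF 0 that] by simp
  show "x + y \<in> S" if "x \<in> S" "y \<in> S" using diff[OF that(1) minus[OF that(2)]] by simp
  show "x ^ n \<in> S" if "x \<in> S" by (induction n) (simp_all add: 1 mult that)
qed

lemma subring_closed_sum:
  assumes "subring_closed S" "\<And>i. i \<in> I \<Longrightarrow> f i \<in> S"
  shows "(\<Sum>i\<in>I. f i) \<in> S"
  using assms(2) by (induction I rule: infinite_finite_induct) (simp_all add: subring_closedD[OF assms(1)])

lemma subring_closed_prod:
  assumes "subring_closed S" "\<And>i. i \<in> I \<Longrightarrow> f i \<in> S"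
  shows "(\<Prod>i\<in>I. f i) \<in> S"
  using assms(2) by (induction I rule: infinite_finite_induct) (simp_all add: subring_closedD[OF assms(1)])

definition polys_over :: "'k::comm_ring_1 set \<Rightarrow> 'k poly set"
  where "polys_over S = {p. \<forall>i. coeff p i \<in> S}"

lemma polys_over_coeff: "p \<in> polys_over S \<Longrightarrow> coeff p i \<in> S"
  by (simp add: polys_over_def)

lemma subring_closed_polys_over:
  assumes S: "subring_closed S"
  shows "subring_closed (polys_over S)"
  unfolding subring_closed_def
proof (intro conjI ballI)
  show "1 \<in> polys_over S"
    by (simp add: polys_over_def subring_closedD[OF S] coeff_1)
next
  fix p q assume "p \<in> polys_over S" "q \<in> polys_over S"
  then show "p - q \<in> polys_over S" "p * q \<in> polys_over S"
    by (auto simp: polys_over_def coeff_mult intro!: subring_closed_sum[OF S] subring_closedD[OF S])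
qed

lemma polys_over_pCons:
  assumes "0 \<in> S"
  shows "pCons a p \<in> polys_over S \<longleftrightarrow> a \<in> S \<and> p \<in> polys_over S"
  by (auto simp: polys_over_def coeff_pCons split: nat.splits)

lemma polys_over_monom: "0 \<in> S \<Longrightarrow> a \<in> S \<Longrightarrow> monom a n \<in> polys_over S"
  by (simp add: polys_over_def)

lemma polys_over_const: "0 \<in> S \<Longrightarrow> a \<in> S \<Longrightarrow> [:a:] \<in> polys_over S"
  by (simp add: polys_over_def coeff_pCons split: nat.splits)

lemma poly_in_subring:
  assumes "subring_closed S" "p \<in> polys_over S" "x \<in> S"
  shows "poly p x \<in> S"
  unfolding poly_altdef using assms
  by (auto intro!: subring_closed_sum subring_closedD[OF assms(1)] simp: polys_over_def)

lemma integral_iff: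
  "x \<in> integral_closure_in_field S \<longleftrightarrow> (\<exists>p\<in>polys_over S. lead_coeff p = 1 \<and> poly p x = 0)"
  by (auto simp: integral_closure_in_field_def polys_over_def)

lemma integral_mono: "S \<subseteq> T \<Longrightarrow> integral_closure_in_field S \<subseteq> integral_closure_in_field T"
  by (force simp: integral_closure_in_field_def)

lemma integral_self:
  assumes "subring_closed S"
  shows "S \<subseteq> integral_closure_in_field S"
proof
  fix x assume "x \<in> S"
  then have "[:- x, 1:] \<in> polys_over S"
    using subring_closedD[OF assms] by (simp add: polys_over_pCons) (simp add: polys_over_def)
  then show "x \<in> integral_closure_in_field S"
    unfolding integral_iff by (intro bexI[of _ "[:- x, 1:]"]) simp_all
qed

text \<open>The determinant is a polynomial expression in the entries, and polynomials with coefficients in \<open>S\<close> form a ring.\<close>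

lemma char_poly_over_subring:
  assumes S: "subring_closed S" and A: "A \<in> carrier_mat n n"
    and entries: "\<And>i j. i < n \<Longrightarrow> j < n \<Longrightarrow> A $$ (i, j) \<in> S"
  shows "char_poly A \<in> polys_over S"
proof -
  note P = subring_closed_polys_over[OF S]
  have entry: "char_poly_matrix A $$ (i, j) \<in> polys_over S" if "i < n" "j < n" for i j
  proof -
    have "char_poly_matrix A $$ (i, j) = (if i = j then [:0, 1:] else 0) + [:- (A $$ (i, j)):]"
      using A that by (simp add: char_poly_matrix_def)
    also have "\<dots> \<in> polys_over S"
      using entries[OF that] subring_closedD[OF S]
      by (intro subring_closedD(6)[OF P]) (simp_all add: polys_over_pCons, simp_all add: polys_over_def)
    finally show ?thesis .
  qed
  have "char_poly A = (\<Sum>p\<in>{p. p permutes {0..<n}}. signof p * (\<Prod>i = 0..<n. char_poly_matrix A $$ (i, p i)))"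
    unfolding char_poly_def using A by (intro det_def') simp
  also have "\<dots> \<in> polys_over S"
  proof (intro subring_closed_sum[OF P] subring_closedD(4)[OF P] subring_closed_prod[OF P])
    fix p i assume "p \<in> {p. p permutes {0..<n}}" "i \<in> {0..<n}"
    then show "char_poly_matrix A $$ (i, p i) \<in> polys_over S"
      by (auto intro!: entry dest: permutes_in_image[of p _ i])
  next
    fix p :: "nat \<Rightarrow> nat"
    show "signof p \<in> polys_over S"
      using subring_closedD[OF P] by (simp add: sign_def)
  qed
  finally show ?thesis .
qed

inductive_set module_span :: "'k::comm_ring_1 set \<Rightarrow> 'k set \<Rightarrow> 'k set" for S G where
  zero: "0 \<in> module_span S G"
| step: "s \<in> S \<Longrightarrow> g \<in> G \<Longrightarrow> y \<in> module_span S G \<Longrightarrow> s * g + y \<in> module_span S G"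

lemma module_span_add:
  assumes "x \<in> module_span S G" "y \<in> module_span S G"
  shows "x + y \<in> module_span S G"
  using assms(1) by induction (auto simp: assms(2) add.assoc intro: module_span.step)

lemma module_span_scale:
  assumes "x \<in> module_span S G" "t \<in> S" "subring_closed S"
  shows "t * x \<in> module_span S G"
  using assms(1)
  by induction (auto simp: distrib_left mult.assoc[symmetric] subring_closedD(4)[OF assms(3)] assms(2)
      intro: module_span.intros)

lemma module_span_sum:
  assumes "\<And>i. i \<in> I \<Longrightarrow> f i \<in> module_span S G"
  shows "(\<Sum>i\<in>I. f i) \<in> module_span S G"
  using assms by (induction I rule: infinite_finite_induct) (simp_all add: module_span_add module_span.zero)

lemma module_span_base:
  assumes "subring_closed S" "g \<in> G"
  shows "g \<in> module_span S G"
  using module_span.step[OF subring_closedD(1)[OF assms(1)] assms(2) module_span.zero] by simp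

lemma module_span_finite:
  assumes "y \<in> module_span S G" "finite G" "subring_closed S"
  shows "\<exists>s. (\<forall>g\<in>G. s g \<in> S) \<and> y = (\<Sum>g\<in>G. s g * g)"
  using assms(1)
proof induction
  case zero
  show ?case using subring_closedD(2)[OF assms(3)] by (intro exI[of _ "\<lambda>_. 0"]) simp
next
  case (step s g y)
  then obtain r where r: "\<forall>g\<in>G. r g \<in> S" "y = (\<Sum>g\<in>G. r g * g)" by blast
  have "s * g = (\<Sum>h\<in>G. if h = g then s * g else 0)"
    using assms(2) step by simp
  then have "s * g + y = (\<Sum>h\<in>G. (if h = g then s * g else 0) + r h * h)"
    by (simp add: r sum.distrib)
  also have "\<dots> = (\<Sum>h\<in>G. (r h + (if h = g then s else 0)) * h)"
    by (rule sum.cong) (auto simp: algebra_simps)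
  finally show ?case
    using r step subring_closedD[OF assms(3)]
    by (intro exI[of _ "\<lambda>h. r h + (if h = g then s else 0)"]) auto
qed

text \<open>Cayley-Hamilton: multiplication by \<open>x\<close> on the generators is given by a matrix \<open>A\<close> over \<open>S\<close>, so the vector
of generators is an eigenvector of \<open>A\<close> with eigenvalue \<open>x\<close>, and \<open>x\<close> is a root of the characteristic polynomial.\<close>

lemma integral_of_stable_module:
  fixes x :: "'k::field"
  assumes S: "subring_closed S" and G: "finite G" "g0 \<in> G" "g0 \<noteq> 0"
    and stable: "\<And>g. g \<in> G \<Longrightarrow> x * g \<in> module_span S G"
  shows "x \<in> integral_closure_in_field S"
proof -
  define n where "n = card G"
  obtain e where e: "bij_betw e {0..<n} G"
    using ex_bij_betw_nat_finite[OF G(1)] by (auto simp: n_def)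
  have "\<exists>s. (\<forall>h\<in>G. s h \<in> S) \<and> x * g = (\<Sum>h\<in>G. s h * h)" if "g \<in> G" for g
    using module_span_finite[OF stable[OF that] G(1) S] .
  then obtain s where s: "\<And>g h. g \<in> G \<Longrightarrow> h \<in> G \<Longrightarrow> s g h \<in> S"
    "\<And>g. g \<in> G \<Longrightarrow> x * g = (\<Sum>h\<in>G. s g h * h)"
    by metis
  define A where "A = mat n n (\<lambda>(i, j). s (e i) (e j))"
  define v where "v = vec n e"
  have A: "A \<in> carrier_mat n n" by (simp add: A_def)
  have eG: "e i \<in> G" if "i < n" for i using e that by (auto simp: bij_betw_def)
  have "A *\<^sub>v v = x \<cdot>\<^sub>v v"
  proof (rule eq_vecI)
    fix i assume "i < dim_vec (x \<cdot>\<^sub>v v)"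
    then have i: "i < n" by (simp add: v_def)
    have "(A *\<^sub>v v) $ i = (\<Sum>j = 0..<n. s (e i) (e j) * e j)"
      using i by (simp add: A_def v_def scalar_prod_def)
    also have "\<dots> = (\<Sum>h\<in>G. s (e i) h * h)"
      by (rule sum.reindex_bij_betw[OF e])
    also have "\<dots> = x * e i" using s(2)[OF eG[OF i]] by simp
    finally show "(A *\<^sub>v v) $ i = (x \<cdot>\<^sub>v v) $ i" using i by (simp add: v_def)
  qed (simp add: A_def v_def)
  moreover have "v \<noteq> 0\<^sub>v n"
  proof
    assume v: "v = 0\<^sub>v n"
    obtain i where "i < n" "e i = g0" using e G by (auto simp: bij_betw_def image_iff)
    then have "v $ i = g0" "(0\<^sub>v n :: 'k vec) $ i = 0" by (simp_all add: v_def)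
    then show False using v G by simp
  qed
  ultimately have "eigenvalue A x"
    unfolding eigenvalue_def eigenvector_def using A by (intro exI[of _ v]) (auto simp: v_def)
  then have "poly (char_poly A) x = 0"
    using eigenvalue_root_char_poly[OF A] by simp
  moreover have "lead_coeff (char_poly A) = 1"
    using degree_monic_char_poly[OF A] by simp
  moreover have "char_poly A \<in> polys_over S"
    using char_poly_over_subring[OF S A] s(1) eG by (simp add: A_def)
  ultimately show ?thesis unfolding integral_iff by blast
qed

text \<open>Over-rings of \<open>S\<close> that are finitely generated as \<open>S\<close>-modules. They witness integrality of all their elements, and
they can be enlarged by integral elements one at a time; so sums, products and integral towers need no
explicit equations.\<close>

definition finite_ring_over :: "'k::field set \<Rightarrow> 'k set \<Rightarrow> bool"
  where "finite_ring_over S A \<longleftrightarrow> subring_closed A \<and> S \<subseteq> A \<and>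
    (\<exists>G. finite G \<and> G \<subseteq> A \<and> A \<subseteq> module_span S G)"

lemma finite_ring_integral:
  assumes S: "subring_closed S" and A: "finite_ring_over S A" and x: "x \<in> A"
  shows "x \<in> integral_closure_in_field S"
proof -
  obtain G where G: "finite G" "G \<subseteq> A" "A \<subseteq> module_span S G" and A': "subring_closed A"
    using A by (auto simp: finite_ring_over_def)
  have "\<exists>g\<in>G. g \<noteq> 0"
  proof (rule ccontr)
    assume *: "\<not> (\<exists>g\<in>G. g \<noteq> 0)"
    have "y = 0" if "y \<in> module_span S G" for y
      using that
    proof induction
      case (step s g y)
      then show ?case using * by auto
    qed simp
    moreover have "1 \<in> module_span S G" using G subring_closedD(1)[OF A'] by blast
    ultimately show False using zero_neq_one by metis
  qed
  then obtain g0 where g0: "g0 \<in> G" "g0 \<noteq> 0" by blast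
  have "x * g \<in> module_span S G" if "g \<in> G" for g
    using G that x subring_closedD(4)[OF A' x] by blast
  then show ?thesis using integral_of_stable_module[OF S G(1) g0] by blast
qed

lemma adjoin_integral:
  fixes y :: "'k::field"
  assumes S: "subring_closed S" and A: "finite_ring_over S A" and y: "y \<in> integral_closure_in_field A"
  shows "\<exists>B. finite_ring_over S B \<and> A \<subseteq> B \<and> y \<in> B"
proof -
  obtain G where G: "finite G" "G \<subseteq> A" "A \<subseteq> module_span S G" and A': "subring_closed A" "S \<subseteq> A"
    using A by (auto simp: finite_ring_over_def)
  obtain p where p: "p \<in> polys_over A" "lead_coeff p = 1" "poly p y = 0"
    using y unfolding integral_iff by blast
  define n where "n = degree p"
  define Y where "Y = (\<lambda>j. y ^ j) ` {..<n}"
  \<comment> \<open>The powers of \<open>y\<close> below the degree of its equation span \<open>A[y]\<close> over \<open>A\<close>; their products with the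
    generators of \<open>A\<close> span it over \<open>S\<close>.\<close>
  define M where "M = module_span A Y"
  have yn: "y ^ n = (\<Sum>i<n. (- coeff p i) * y ^ i)"
  proof -
    have "0 = (\<Sum>i\<le>n. coeff p i * y ^ i)"
      using p(3) by (simp add: poly_altdef n_def)
    also have "{..n} = insert n {..<n}" by auto
    finally show ?thesis using p(2) by (simp add: n_def sum_negf eq_neg_iff_add_eq_0)
  qed
  have M_base: "y ^ j \<in> M" if "j < n" for j
    unfolding M_def using that by (intro module_span_base[OF A'(1)]) (auto simp: Y_def)
  have "y ^ n \<in> M"
    unfolding yn
    using M_base p(1) subring_closedD(5)[OF A'(1)] unfolding M_def
    by (intro module_span_sum module_span_scale[OF _ _ A'(1)]) (auto simp: polys_over_def)
  have y_stable: "y * z \<in> M" if "z \<in> M" for z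
    using that unfolding M_def
  proof induction
    case zero
    show ?case by (simp add: module_span.zero)
  next
    case (step s g z)
    from step(2) obtain j where j: "j < n" "g = y ^ j" by (auto simp: Y_def)
    have "y ^ Suc j \<in> M"
      using M_base[of "Suc j"] \<open>y ^ n \<in> M\<close> j by (cases "Suc j = n") auto
    then have "s * y ^ Suc j \<in> module_span A Y"
      using module_span_scale[OF _ step(1) A'(1)] by (simp add: M_def)
    then have "s * y ^ Suc j + y * z \<in> module_span A Y"
      using step by (intro module_span_add)
    then show ?case by (simp add: j algebra_simps)
  qed
  have powers: "y ^ k \<in> M" for k
  proof (induction k)
    case 0
    show ?case
    proof (cases "n = 0")
      case True
      then show ?thesis using yn by (simp add: M_def module_span.zero)
    next
      case False
      then show ?thesis using M_base[of 0] by simp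
    qed
  next
    case (Suc k)
    then show ?case using y_stable by simp
  qed
  define B where "B = (\<lambda>q. poly q y) ` polys_over A"
  note PA = subring_closed_polys_over[OF A'(1)]
  have "subring_closed B"
    unfolding subring_closed_def
  proof (intro conjI ballI)
    have "1 = poly 1 y" by simp
    then show "1 \<in> B" unfolding B_def using subring_closedD(1)[OF PA] by blast
  next
    fix a b assume "a \<in> B" "b \<in> B"
    then obtain f g where fg: "f \<in> polys_over A" "g \<in> polys_over A" "a = poly f y" "b = poly g y"
      by (auto simp: B_def)
    then have "a - b = poly (f - g) y" "a * b = poly (f * g) y" by simp_all
    then show "a - b \<in> B" "a * b \<in> B"
      unfolding B_def using subring_closedD(3,4)[OF PA fg(1,2)] by blast+
  qed
  moreover have AB: "A \<subseteq> B"
  proof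
    fix a assume "a \<in> A"
    then have "[:a:] \<in> polys_over A" "a = poly [:a:] y"
      using polys_over_const[OF subring_closedD(2)[OF A'(1)]] by simp_all
    then show "a \<in> B" unfolding B_def by blast
  qed
  moreover have "y \<in> B"
  proof -
    have "[:0, 1:] \<in> polys_over A"
      using subring_closedD[OF A'(1)] by (simp add: polys_over_pCons) (simp add: polys_over_def)
    moreover have "y = poly [:0, 1:] y" by simp
    ultimately show ?thesis unfolding B_def by blast
  qed
  moreover have "\<exists>G'. finite G' \<and> G' \<subseteq> B \<and> B \<subseteq> module_span S G'"
  proof (intro exI conjI)
    define G' where "G' = (\<lambda>(g, h). g * h) ` (G \<times> Y)"
    show "finite G'" unfolding G'_def Y_def using G by simp
    have "Y \<subseteq> B" using subring_closedD(7)[OF \<open>subring_closed B\<close> \<open>y \<in> B\<close>] by (auto simp: Y_def)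
    then show "G' \<subseteq> B"
      using G(2) AB by (auto simp: G'_def intro!: subring_closedD(4)[OF \<open>subring_closed B\<close>])
    have mult: "a * h \<in> module_span S G'" if "a \<in> module_span S G" "h \<in> Y" for a h
      using that(1)
    proof induction
      case zero
      show ?case by (simp add: module_span.zero)
    next
      case (step s g z)
      have "s * (g * h) + z * h \<in> module_span S G'"
        using step that(2) by (intro module_span.step) (auto simp: G'_def)
      then show ?case by (simp add: algebra_simps)
    qed
    have "z \<in> module_span S G'" if "z \<in> M" for z
      using that unfolding M_def
    proof induction
      case zero
      show ?case by (rule module_span.zero)
    next
      case (step s g z)
      then show ?case using mult[of s g] G by (intro module_span_add) auto
    qed
    moreover have "B \<subseteq> M"
    proof
      fix b assume "b \<in> B"
      then obtain q where q: "q \<in> polys_over A" "b = poly q y" by (auto simp: B_def)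
      show "b \<in> M"
        unfolding q(2) poly_altdef M_def
        using powers q(1) unfolding M_def polys_over_def
        by (intro module_span_sum module_span_scale[OF _ _ A'(1)]) auto
    qed
    ultimately show "B \<subseteq> module_span S G'" by blast
  qed
  ultimately show ?thesis
    using A' unfolding finite_ring_over_def by (intro exI[of _ B]) blast
qed

lemma finite_ring_self:
  assumes "subring_closed (S :: 'k::field set)"
  shows "finite_ring_over S S"
proof -
  have "x \<in> module_span S {1}" if "x \<in> S" for x
    using module_span.step[OF that _ module_span.zero, of 1 "{1}"] by simp
  then show ?thesis
    unfolding finite_ring_over_def using assms subring_closedD(1)[OF assms]
    by (intro conjI exI[of _ "{1}"]) auto
qed

lemma finite_ring_containing:
  fixes S :: "'k::field set"
  assumes S: "subring_closed S" and "finite F" "F \<subseteq> integral_closure_in_field S"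
  shows "\<exists>B. finite_ring_over S B \<and> F \<subseteq> B"
  using assms(2,3)
proof (induction F)
  case empty
  show ?case using finite_ring_self[OF S] by blast
next
  case (insert x F)
  then obtain B where B: "finite_ring_over S B" "F \<subseteq> B" by blast
  have "x \<in> integral_closure_in_field B"
    using insert integral_mono[of S B] B by (auto simp: finite_ring_over_def)
  from adjoin_integral[OF S B(1) this] show ?case using B by blast
qed

lemma subring_closed_integral_closure:
  fixes S :: "'k::field set"
  assumes S: "subring_closed S"
  shows "subring_closed (integral_closure_in_field S)"
  unfolding subring_closed_def
proof (intro conjI ballI)
  show "1 \<in> integral_closure_in_field S"
    using integral_self[OF S] subring_closedD(1)[OF S] by blast
next
  fix x y assume xy: "x \<in> integral_closure_in_field S" "y \<in> integral_closure_in_field S"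
  then obtain B where B: "finite_ring_over S B" "{x, y} \<subseteq> B"
    using finite_ring_containing[OF S, of "{x, y}"] by auto
  then have "x - y \<in> B" "x * y \<in> B"
    using subring_closedD(3,4)[of B x y] by (auto simp: finite_ring_over_def)
  then show "x - y \<in> integral_closure_in_field S" "x * y \<in> integral_closure_in_field S"
    using finite_ring_integral[OF S B(1)] by auto
qed

lemma integral_closure_idem:
  fixes S :: "'k::field set"
  assumes S: "subring_closed S"
  shows "integral_closure_in_field (integral_closure_in_field S) \<subseteq> integral_closure_in_field S"
proof
  fix x assume "x \<in> integral_closure_in_field (integral_closure_in_field S)"
  then obtain p where p: "p \<in> polys_over (integral_closure_in_field S)"
    "lead_coeff p = 1" "poly p x = 0"
    unfolding integral_iff by blast
  define F where "F = coeff p ` {..Polynomial.degree p}"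
  obtain B where B: "finite_ring_over S B" "F \<subseteq> B"
    using finite_ring_containing[OF S, of F] p by (auto simp: F_def polys_over_def)
  have "p \<in> polys_over B"
    unfolding polys_over_def
  proof (intro CollectI allI)
    fix i show "coeff p i \<in> B"
    proof (cases "i \<le> degree p")
      case True
      then show ?thesis using B by (auto simp: F_def)
    next
      case False
      then show ?thesis using B subring_closedD(2)[of B]
        by (simp add: coeff_eq_0 finite_ring_over_def)
    qed
  qed
  with p have "x \<in> integral_closure_in_field B" unfolding integral_iff by blast
  from adjoin_integral[OF S B(1) this] obtain B' where "finite_ring_over S B'" "x \<in> B'" by blast
  then show "x \<in> integral_closure_in_field S" using finite_ring_integral[OF S] by blast
qed

text \<open>Over the algebraic closure the divisor splits into linear factors. Its roots are roots of the multiple, hence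
integral, and the coefficients are polynomial expressions in the roots.\<close>

lemma coeffs_integral_of_monic_dvd:
  fixes p q :: "'k::field poly"
  assumes S: "subring_closed S" and q: "q \<in> polys_over S" "lead_coeff q = 1"
    and p: "p dvd q" "lead_coeff p = 1"
  shows "p \<in> polys_over (integral_closure_in_field S)"
proof -
  define S' where "S' = (to_ac ` S :: 'k alg_closure set)"
  have S': "subring_closed S'"
    unfolding subring_closed_def S'_def
  proof (intro conjI ballI)
    show "1 \<in> to_ac ` S" using subring_closedD(1)[OF S] by (force simp: image_iff)
  next
    fix x y assume "x \<in> to_ac ` S" "y \<in> to_ac ` S"
    then show "x - y \<in> to_ac ` S" "x * y \<in> to_ac ` S"
      using subring_closedD(3,4)[OF S] by (auto simp flip: to_ac_diff to_ac_mult)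
  qed
  define hom where "hom = map_poly (to_ac :: 'k \<Rightarrow> 'k alg_closure)"
  have coeff_hom: "coeff (hom r) i = to_ac (coeff r i)" for r i
    by (simp add: hom_def coeff_map_poly)
  have degree_hom: "degree (hom r) = degree r" for r
    by (simp add: hom_def degree_map_poly)
  have poly_hom: "poly (hom r) (to_ac x) = to_ac (poly r x)" for r x
    by (simp add: poly_altdef degree_hom coeff_hom to_ac_sum)
  obtain r where r: "q = p * r" using p(1) by blast
  have hom_mult: "hom (p * r) = hom p * hom r"
    by (rule poly_eqI) (simp add: coeff_hom coeff_mult to_ac_sum)
  have "lead_coeff (hom p) = 1" using p(2) by (simp add: coeff_hom degree_hom)
  then have "hom p \<noteq> 0" by auto
  then obtain A where A': "hom p = (\<Prod>a\<in>#A. [:- a, 1:])"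
    using alg_closed_imp_factorization[of "hom p"] p(2) by (auto simp: coeff_hom degree_hom)
  have root: "a \<in> integral_closure_in_field S'" if "a \<in># A" for a
  proof -
    have "[:- a, 1:] dvd hom p"
      unfolding A' using that by (intro dvd_prod_mset) auto
    then have "[:- a, 1:] dvd hom q" unfolding r hom_mult by (rule dvd_mult2)
    then have "poly (hom q) a = 0" by (simp add: poly_eq_0_iff_dvd)
    moreover have "hom q \<in> polys_over S'" using q by (simp add: polys_over_def coeff_hom S'_def)
    moreover have "lead_coeff (hom q) = 1" using q by (simp add: coeff_hom degree_hom)
    ultimately show ?thesis unfolding integral_iff by blast
  qed
  note I = subring_closed_integral_closure[OF S']
  have "(\<Prod>a\<in>#B. [:- a, 1:]) \<in> polys_over (integral_closure_in_field S')" if "set_mset B \<subseteq> set_mset A" for B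
    using that
  proof (induction B)
    case empty
    show ?case using subring_closedD(1)[OF subring_closed_polys_over[OF I]] by simp
  next
    case (add a B)
    then have "[:- a, 1:] \<in> polys_over (integral_closure_in_field S')"
      using root subring_closedD[OF I] by (simp add: polys_over_pCons) (simp add: polys_over_def)
    then have "[:- a, 1:] * (\<Prod>a\<in>#B. [:- a, 1:]) \<in> polys_over (integral_closure_in_field S')"
      using add by (intro subring_closedD(4)[OF subring_closed_polys_over[OF I]]) auto
    then show ?case by (simp only: image_mset_add_mset prod_mset.add_mset)
  qed
  then have hp: "hom p \<in> polys_over (integral_closure_in_field S')" unfolding A' by blast
  show ?thesis
    unfolding polys_over_def
  proof (intro CollectI allI)
    fix i
    have "to_ac (coeff p i) \<in> integral_closure_in_field S'"
      using polys_over_coeff[OF hp, of i] by (simp add: coeff_hom)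
    then obtain f where f: "f \<in> polys_over S'" "lead_coeff f = 1"
      "poly f (to_ac (coeff p i)) = 0"
      unfolding integral_iff by blast
    define g where "g = map_poly of_ac f"
    have "coeff f j \<in> to_ac ` S" for j using f(1) by (simp add: polys_over_def S'_def)
    then have "of_ac (coeff f j) \<in> S \<and> to_ac (of_ac (coeff f j)) = coeff f j" for j
      by (metis imageE of_ac_to_ac)
    then have g: "coeff g j \<in> S" "to_ac (coeff g j) = coeff f j" for j
      by (simp_all add: g_def coeff_map_poly)
    then have fg: "f = hom g" by (intro poly_eqI) (simp add: coeff_hom)
    have "to_ac (poly g (coeff p i)) = 0"
      using f(3) by (simp add: fg poly_hom)
    moreover have "to_ac (lead_coeff g) = 1"
      using f(2) by (simp add: fg coeff_hom degree_hom)
    then have "lead_coeff g = 1" by (metis to_ac_1 to_ac_eq_iff)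
    moreover have "g \<in> polys_over S" using g by (simp add: polys_over_def)
    ultimately show "coeff p i \<in> integral_closure_in_field S"
      unfolding integral_iff by auto
  qed
qed

text \<open>The integral closure of \<open>S[t]\<close> in \<open>K[t]\<close> is \<open>S'[t]\<close>, where \<open>S'\<close> is the integral closure of \<open>S\<close> in \<open>K\<close>. If \<open>P(h) = 0\<close>
then \<open>t ^ r - h\<close> divides \<open>P(t ^ r) - P(h) = P(t ^ r)\<close>, and for large \<open>r\<close> both are monic.\<close>

lemma coeffs_integral_of_integral_poly:
  fixes h :: "'k::field poly" and P :: "'k poly poly"
  assumes S: "subring_closed S" and P: "P \<in> polys_over (polys_over S)" "lead_coeff P = 1"
    and root: "poly P h = 0"
  shows "h \<in> polys_over (integral_closure_in_field S)"
proof -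
  define n where "n = degree P"
  \<comment> \<open>An exponent \<open>r\<close> above the degree of \<open>h\<close> and of all coefficients of \<open>P\<close>, so that the leading terms
    of \<open>t ^ r - h\<close> and of \<open>P(t ^ r)\<close> are powers of \<open>t\<close>.\<close>
  define r where "r = Suc (Max (insert (degree h) ((\<lambda>i. degree (coeff P i)) ` {..n})))"
  have hr: "degree h < r" and Pr: "\<And>i. i \<le> n \<Longrightarrow> degree (coeff P i) < r"
    unfolding r_def by (simp, intro le_imp_less_Suc Max_ge) auto
  define t where "t = monom (1::'k) r"
  have "[:- h, 1:] dvd P" using root by (simp add: poly_eq_0_iff_dvd)
  then obtain k where k: "P = [:- h, 1:] * k" by blast
  have "poly P t = (t - h) * poly k t" unfolding k by (simp add: algebra_simps)
  then have "t - h dvd poly P t" by simp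
  moreover have "lead_coeff (t - h) = 1"
  proof -
    have "degree (t - h) = r"
      using degree_add_eq_left[of "- h" t] hr by (simp add: t_def degree_monom_eq)
    then show ?thesis using hr by (simp add: t_def coeff_eq_0)
  qed
  moreover have "poly P t \<in> polys_over S"
    using poly_in_subring[OF subring_closed_polys_over[OF S] P(1)]
      polys_over_monom[OF subring_closedD(2,1)[OF S]] by (simp add: t_def)
  moreover have "lead_coeff (poly P t) = 1"
  proof -
    have tk: "t ^ k = monom 1 (r * k)" for k
      by (simp add: t_def monom_power mult.commute)
    define E where "E = (\<Sum>i<n. coeff P i * t ^ i)"
    have "poly P t = (\<Sum>i\<in>insert n {..<n}. coeff P i * t ^ i)"
      unfolding poly_altdef n_def by (rule sum.cong) auto
    then have eq: "poly P t = t ^ n + E"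
      using P(2) by (simp add: E_def n_def)
    have E: "degree E < r * n" if "n > 0"
      unfolding E_def
    proof (rule degree_sum_less)
      fix i assume "i \<in> {..<n}"
      then have i: "i < n" by simp
      have "degree (coeff P i * t ^ i) \<le> degree (coeff P i) + r * i"
        using degree_mult_le[of "coeff P i" "t ^ i"] by (simp add: tk degree_monom_eq)
      also have "\<dots> < r + r * i" using Pr[of i] i by simp
      also have "\<dots> \<le> r * n" using i by (metis Suc_leI mult_Suc_right mult_le_mono2)
      finally show "degree (coeff P i * t ^ i) < r * n" .
    qed (use that hr in simp)
    show ?thesis
    proof (cases "n = 0")
      case True
      then show ?thesis by (simp add: eq E_def)
    next
      case False
      then have "degree (t ^ n + E) = r * n"
        using E degree_add_eq_left[of E "t ^ n"] by (simp add: tk degree_monom_eq)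
      then show ?thesis using E False unfolding eq by (simp add: tk coeff_eq_0)
    qed
  qed
  ultimately have th: "t - h \<in> polys_over (integral_closure_in_field S)"
    using coeffs_integral_of_monic_dvd[OF S] by blast
  have "t \<in> polys_over (integral_closure_in_field S)"
    unfolding t_def using subring_closedD[OF subring_closed_integral_closure[OF S]]
    by (intro polys_over_monom)
  from subring_closedD(3)[OF subring_closed_polys_over[OF subring_closed_integral_closure[OF S]] this th]
  show ?thesis by simp
qed

section \<open>Quotients of polynomials, ideals and primes in a field\<close>

lemma bezout_field_poly:
  fixes F G :: "'k::field poly"
  assumes "G \<noteq> 0"
  shows "\<exists>d f g u v. F = d * f \<and> G = d * g \<and> u * f + v * g = 1"
  using assms
proof (induction "degree G" arbitrary: F G rule: less_induct)
  case less
  show ?case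
  proof (cases "F mod G = 0")
    case True
    then have "F = G * (F div G)" by (metis add.right_neutral mult_div_mod_eq)
    then show ?thesis
      by (intro exI[of _ G] exI[of _ "F div G"] exI[of _ 1] exI[of _ 0] exI[of _ 1]) simp
  next
    case False
    then have "degree (F mod G) < degree G"
      using degree_mod_less[OF less(2), of F] by blast
    from less(1)[OF this False, of G] obtain d f g u v
      where d: "G = d * f" "F mod G = d * g" "u * f + v * g = 1" by blast
    have "F = (F div G) * G + F mod G" by simp
    then have "F = d * ((F div G) * f + g)"
      using d(1,2) by (metis distrib_left mult.left_commute)
    moreover have "v * ((F div G) * f + g) + (u - v * (F div G)) * f = 1"
      using d(3) by (simp add: algebra_simps)
    ultimately show ?thesis using d(1) by blast
  qed
qed

text \<open>A homogeneous form of the rational root theorem: after removing the greatest common divisor, the denominator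
\<open>g\<close> divides \<open>W f ^ n\<close> and is coprime to \<open>f\<close>, so it divides \<open>W\<close>.\<close>

lemma denominator_dvd_of_relation:
  fixes F G W :: "'k::field poly"
  assumes rel: "(\<Sum>i\<le>n. A i * F ^ i * G ^ (n - i)) = 0" and An: "A n = W" and G: "G \<noteq> 0"
  shows "G dvd W * F"
proof -
  obtain d f g u v where d: "F = d * f" "G = d * g" "u * f + v * g = 1"
    using bezout_field_poly[OF G] by blast
  have "(\<Sum>i\<le>n. A i * F ^ i * G ^ (n - i)) = d ^ n * (\<Sum>i\<le>n. A i * f ^ i * g ^ (n - i))"
    unfolding sum_distrib_left
  proof (rule sum.cong)
    fix i assume "i \<in> {..n}"
    then have "d ^ n = d ^ i * d ^ (n - i)" by (simp flip: power_add)
    then show "A i * F ^ i * G ^ (n - i) = d ^ n * (A i * f ^ i * g ^ (n - i))"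
      by (simp add: d power_mult_distrib mult_ac)
  qed simp
  with rel G d have "(\<Sum>i\<le>n. A i * f ^ i * g ^ (n - i)) = 0" by simp
  moreover have "{..n} = insert n {..<n}" by auto
  ultimately have "W * f ^ n = - (\<Sum>i<n. A i * f ^ i * g ^ (n - i))"
    by (simp add: An eq_neg_iff_add_eq_0)
  moreover have "g dvd (\<Sum>i<n. A i * f ^ i * g ^ (n - i))"
    by (intro dvd_sum dvd_mult dvd_power) simp
  ultimately have "g dvd W * f ^ n" by simp
  then have "g dvd W"
  proof (induction n)
    case (Suc n)
    have "W * f ^ n = u * (W * f ^ Suc n) + v * W * f ^ n * g"
    proof -
      have "W * f ^ n = W * f ^ n * (u * f + v * g)" by (simp add: d)
      then show ?thesis by (simp add: algebra_simps)
    qed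
    moreover have "g dvd u * (W * f ^ Suc n) + v * W * f ^ n * g"
      by (rule dvd_add[OF dvd_mult[OF Suc(2)] dvd_triv_right])
    ultimately have "g dvd W * f ^ n" by (simp only:)
    then show ?case by (rule Suc(1))
  qed simp
  then obtain c where "W = g * c" by blast
  then have "W * F = G * (c * f)" by (simp add: d mult_ac)
  then show ?thesis by simp
qed

text \<open>The fraction \<open>F / G\<close> satisfies an equation over \<open>S[t]\<close> whose leading coefficient is the power \<open>t ^ N\<close>, that is, it
is integral over \<open>S[t, 1 / t]\<close>.\<close>

lemma integral_quotient:
  fixes F G :: "'k::field poly"
  assumes S: "subring_closed S"
    and rel: "(\<Sum>i\<le>n. A i * F ^ i * G ^ (n - i)) = 0" and An: "A n = monom 1 N"
    and G: "G \<noteq> 0" and A: "\<And>i. i \<le> n \<Longrightarrow> A i \<in> polys_over S"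
  shows "\<exists>h\<in>polys_over (integral_closure_in_field S). monom 1 N * F = G * h"
proof -
  define W where "W = monom (1::'k) N"
  have n: "n > 0"
  proof (rule ccontr)
    assume "\<not> n > 0"
    then show False using rel An by simp
  qed
  have "G dvd W * F" using denominator_dvd_of_relation[OF rel An G] by (simp add: W_def)
  then obtain h where h: "W * F = G * h" by (rule dvdE)
  \<comment> \<open>Substituting \<open>F / G = h / W\<close> and multiplying the relation by \<open>W ^ (2 n - 1)\<close> turns it into a monic
    equation for \<open>W h\<close> with these coefficients.\<close>
  define B where "B i = (if i < n then A i * W ^ (n - i) * W ^ (n - 1 - i) else 1)" for i
  define P where "P = (\<Sum>i\<le>n. monom (B i) i)"
  note PS = subring_closed_polys_over[OF S] 
  have W: "W \<in> polys_over S"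
    unfolding W_def by (intro polys_over_monom subring_closedD[OF S])
  have coeff_P: "coeff P j = (if j \<le> n then B j else 0)" for j
    by (simp add: P_def coeff_sum)
  have "P \<in> polys_over (polys_over S)"
    using A W subring_closedD[OF PS] by (auto simp: polys_over_def[of "polys_over S"] coeff_P B_def)
  moreover have "degree P = n"
  proof (rule antisym)
    show "degree P \<le> n" by (rule degree_le) (simp add: coeff_P)
    show "n \<le> degree P" by (rule le_degree) (simp add: coeff_P B_def)
  qed
  then have "lead_coeff P = 1" by (simp add: coeff_P B_def)
  moreover have "poly P (W * h) = 0"
  proof -
    have "G ^ n * poly P (W * h) = (\<Sum>i\<le>n. G ^ n * (B i * (W * h) ^ i))"
      by (simp add: P_def poly_sum poly_monom sum_distrib_left)
    also have "\<dots> = (\<Sum>i\<le>n. W ^ (n - 1) * W ^ n * (A i * F ^ i * G ^ (n - i)))"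
    proof (rule sum.cong)
      fix i assume "i \<in> {..n}"
      then have i: "i \<le> n" by simp
      have Gn: "G ^ n = G ^ i * G ^ (n - i)" using i by (simp flip: power_add)
      have hG: "h ^ i * G ^ i = W ^ i * F ^ i" by (metis h mult.commute power_mult_distrib)
      show "G ^ n * (B i * (W * h) ^ i) = W ^ (n - 1) * W ^ n * (A i * F ^ i * G ^ (n - i))"
      proof (cases "i < n")
        case True
        have "G ^ n * (B i * (W * h) ^ i)
            = A i * G ^ (n - i) * (W ^ (n - i) * (W ^ (n - 1 - i) * W ^ i)) * (h ^ i * G ^ i)"
          using True by (simp add: Gn B_def power_mult_distrib mult_ac)
        also have "\<dots> = A i * G ^ (n - i) * ((W ^ (n - i) * W ^ i) * (W ^ (n - 1 - i) * W ^ i)) * F ^ i"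
          unfolding hG by (simp add: mult_ac)
        also have "(W ^ (n - i) * W ^ i) * (W ^ (n - 1 - i) * W ^ i) = W ^ n * W ^ (n - 1)"
          using True by (simp flip: power_add)
        finally show ?thesis by (simp add: mult_ac)
      next
        case False
        then have "i = n" using i by simp
        have Wn: "W ^ n = W ^ (n - 1) * W" using n by (metis power_minus_mult)
        have "G ^ n * (B n * (W * h) ^ n) = W ^ n * (h ^ n * G ^ n)"
          by (simp add: B_def power_mult_distrib mult_ac)
        also have "\<dots> = W ^ n * (W ^ n * F ^ n)" using hG \<open>i = n\<close> by simp
        also have "\<dots> = W ^ (n - 1) * W ^ n * (W * F ^ n)"
          by (subst (1) Wn) (simp only: mult_ac)
        finally show ?thesis using \<open>i = n\<close> An by (simp add: W_def)
      qed
    qed simp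
    also have "\<dots> = 0" by (simp add: rel flip: sum_distrib_left)
    finally show ?thesis using G by simp
  qed
  ultimately have Xh: "W * h \<in> polys_over (integral_closure_in_field S)"
    using coeffs_integral_of_integral_poly[OF S] by blast
  have "h \<in> polys_over (integral_closure_in_field S)"
    unfolding polys_over_def
  proof (intro CollectI allI)
    fix i
    show "coeff h i \<in> integral_closure_in_field S"
      using polys_over_coeff[OF Xh, of "N + i"] by (simp add: W_def coeff_monom_mult)
  qed
  then show ?thesis using h by (auto simp: W_def)
qed

text \<open>Long division: only the leading coefficient of the divisor has to be inverted.\<close>

lemma quotient_over_subring:
  fixes G h :: "'k::field poly"
  assumes D: "subring_closed D" and G: "G \<in> polys_over D" "G \<noteq> 0" "inverse (lead_coeff G) \<in> D"
    and Gh: "G * h \<in> polys_over D"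
  shows "h \<in> polys_over D"
  using Gh
proof (induction "degree h" arbitrary: h rule: less_induct)
  case less
  define c where "c = lead_coeff h"
  define h' where "h' = h - monom c (degree h)"
  have "c = inverse (lead_coeff G) * lead_coeff (G * h)"
    using G(2) by (simp add: c_def lead_coeff_mult)
  also have "\<dots> \<in> D" using G(3) less(2) subring_closedD(4)[OF D] by (auto simp: polys_over_def)
  finally have m: "monom c (degree h) \<in> polys_over D"
    by (rule polys_over_monom[OF subring_closedD(2)[OF D]])
  have "h' \<in> polys_over D"
  proof (cases "h' = 0")
    case True
    then show ?thesis using subring_closedD(2)[OF D] by (simp add: polys_over_def)
  next
    case False
    have "degree h' \<le> degree h"
      unfolding h'_def by (intro degree_diff_le degree_monom_le) simp
    moreover have "coeff h' (degree h) = 0" by (simp add: h'_def c_def)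
    ultimately have "degree h' < degree h"
      using eq_zero_or_degree_less False by blast
    moreover have "G * h' = G * h - G * monom c (degree h)"
      by (simp add: h'_def right_diff_distrib)
    then have "G * h' \<in> polys_over D"
      using less(2) G(1) m subring_closedD(3,4)[OF subring_closed_polys_over[OF D]] by simp
    ultimately show ?thesis by (rule less(1))
  qed
  moreover have "h = h' + monom c (degree h)" by (simp add: h'_def)
  ultimately show ?case using m subring_closedD(6)[OF subring_closed_polys_over[OF D]] by metis
qed

text \<open>Ideals of a subset ring, as subsets of the ambient ring type; \<open>ideal_ring_on\<close> and \<open>primeideal_ring_on\<close> give the link
with the locale predicates.\<close>

definition ideal_of :: "'k::comm_ring_1 set \<Rightarrow> 'k set \<Rightarrow> bool"
  where "ideal_of T I \<longleftrightarrow> I \<subseteq> T \<and> 0 \<in> I \<and> (\<forall>x\<in>I. \<forall>y\<in>I. x + y \<in> I) \<and> (\<forall>t\<in>T. \<forall>x\<in>I. t * x \<in> I)"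

lemma ideal_ofD:
  assumes "ideal_of T I"
  shows "x \<in> I \<Longrightarrow> x \<in> T" "0 \<in> I" "x \<in> I \<Longrightarrow> y \<in> I \<Longrightarrow> x + y \<in> I" "t \<in> T \<Longrightarrow> x \<in> I \<Longrightarrow> t * x \<in> I"
  using assms by (auto simp: ideal_of_def)

lemma ideal_of_uminus:
  assumes "ideal_of T I" "subring_closed T" "x \<in> I"
  shows "- x \<in> I"
  using ideal_ofD(4)[OF assms(1) subring_closedD(5)[OF assms(2) subring_closedD(1)[OF assms(2)]] assms(3)]
  by simp

lemma ideal_of_diff:
  assumes "ideal_of T I" "subring_closed T" "x \<in> I" "y \<in> I"
  shows "x - y \<in> I"
  using ideal_ofD(3)[OF assms(1,3) ideal_of_uminus[OF assms(1,2,4)]] by simp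

lemma ideal_of_sum:
  assumes "ideal_of T I" "\<And>i. i \<in> A \<Longrightarrow> f i \<in> I"
  shows "(\<Sum>i\<in>A. f i) \<in> I"
  using assms(2) by (induction A rule: infinite_finite_induct) (simp_all add: ideal_ofD(2,3)[OF assms(1)])

definition prime_of :: "'k::comm_ring_1 set \<Rightarrow> 'k set \<Rightarrow> bool"
  where "prime_of T P \<longleftrightarrow> ideal_of T P \<and> 1 \<notin> P \<and> (\<forall>x\<in>T. \<forall>y\<in>T. x * y \<in> P \<longrightarrow> x \<in> P \<or> y \<in> P)"

lemma prime_ofD:
  assumes "prime_of T P"
  shows "ideal_of T P" "1 \<notin> P" "x \<in> T \<Longrightarrow> y \<in> T \<Longrightarrow> x * y \<in> P \<Longrightarrow> x \<in> P \<or> y \<in> P"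
  using assms by (auto simp: prime_of_def)

lemma prime_of_power:
  assumes "prime_of T P" "subring_closed T" "x \<in> T" "x ^ n \<in> P"
  shows "x \<in> P"
  using assms(4)
proof (induction n)
  case 0
  then show ?case using prime_ofD(2)[OF assms(1)] by simp
next
  case (Suc n)
  then show ?case
    using prime_ofD(3)[OF assms(1,3) subring_closedD(7)[OF assms(2,3), of n]] by auto
qed

text \<open>Krull's lemma: an ideal maximal among those avoiding a multiplicative set is prime. The maximality property
itself is also exported, because \<open>lying_over\<close> depends on it.\<close>

lemma maximal_ideal_avoiding:
  assumes T: "subring_closed T" and I: "ideal_of T I"
    and M: "1 \<in> M" "\<And>a b. a \<in> M \<Longrightarrow> b \<in> M \<Longrightarrow> a * b \<in> M" and IM: "I \<inter> M = {}"
  obtains N where "I \<subseteq> N" "prime_of T N" "N \<inter> M = {}"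
    "\<And>a. a \<in> T \<Longrightarrow> a \<notin> N \<Longrightarrow> \<exists>n\<in>N. \<exists>s\<in>T. n + s * a \<in> M"
proof -
  define \<I> where "\<I> = {J. ideal_of T J \<and> I \<subseteq> J \<and> J \<inter> M = {}}"
  have "\<exists>N\<in>\<I>. \<forall>J\<in>\<I>. N \<subseteq> J \<longrightarrow> J = N"
  proof (rule subset_Zorn_nonempty)
    show "\<I> \<noteq> {}" using I IM by (auto simp: \<I>_def)
  next
    fix \<C> assume ne: "\<C> \<noteq> {}" and ch: "subset.chain \<I> \<C>"
    have sub: "\<C> \<subseteq> \<I>" using ch by (simp add: subset.chain_def)
    have "ideal_of T (\<Union>\<C>)"
      unfolding ideal_of_def
    proof (intro conjI ballI)
      show "\<Union>\<C> \<subseteq> T" using sub by (auto simp: \<I>_def ideal_of_def)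
      show "0 \<in> \<Union>\<C>" using ne sub by (auto simp: \<I>_def ideal_of_def)
    next
      fix a b assume "a \<in> \<Union>\<C>" "b \<in> \<Union>\<C>"
      then obtain A B where AB: "A \<in> \<C>" "a \<in> A" "B \<in> \<C>" "b \<in> B" by blast
      then consider "A \<subseteq> B" | "B \<subseteq> A" using ch by (auto simp: subset_chain_def)
      then obtain E where "E \<in> \<C>" "a \<in> E" "b \<in> E" using AB by cases blast+
      moreover have "ideal_of T E" using sub \<open>E \<in> \<C>\<close> by (auto simp: \<I>_def)
      ultimately show "a + b \<in> \<Union>\<C>" using ideal_ofD(3) by blast
    next
      fix t a assume t: "t \<in> T" and "a \<in> \<Union>\<C>"
      then obtain E where E: "E \<in> \<C>" "a \<in> E" by blast
      then have "ideal_of T E" using sub by (auto simp: \<I>_def)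
      then show "t * a \<in> \<Union>\<C>" using ideal_ofD(4)[of T E t a] t E by blast
    qed
    then show "\<Union>\<C> \<in> \<I>" using sub ne by (auto simp: \<I>_def)
  qed
  then obtain N where "N \<in> \<I>" and max: "\<And>J. J \<in> \<I> \<Longrightarrow> N \<subseteq> J \<Longrightarrow> J = N" by blast
  then have N: "ideal_of T N" "I \<subseteq> N" "N \<inter> M = {}" by (auto simp: \<I>_def)
  have meets: "\<exists>n\<in>N. \<exists>s\<in>T. n + s * a \<in> M" if a: "a \<in> T" "a \<notin> N" for a
  proof -
    define J where "J = {n + s * a | n s. n \<in> N \<and> s \<in> T}"
    have "n \<in> J" if "n \<in> N" for n
    proof -
      have "n = n + 0 * a" by simp
      then show ?thesis unfolding J_def using that subring_closedD(2)[OF T] by blast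
    qed
    then have "N \<subseteq> J" by blast
    have "a = 0 + 1 * a" by simp
    then have "a \<in> J" unfolding J_def using ideal_ofD(2)[OF N(1)] subring_closedD(1)[OF T] by blast
    have "ideal_of T J"
      unfolding ideal_of_def
    proof (intro conjI ballI)
      show "J \<subseteq> T"
        using a ideal_ofD(1)[OF N(1)] by (auto simp: J_def intro!: subring_closedD(4,6)[OF T])
      show "0 \<in> J" using \<open>N \<subseteq> J\<close> ideal_ofD(2)[OF N(1)] by blast
    next
      fix x y assume "x \<in> J" "y \<in> J"
      then obtain n s n' s' where "x = n + s * a" "y = n' + s' * a" "n \<in> N" "n' \<in> N" "s \<in> T" "s' \<in> T"
        by (auto simp: J_def)
      then have "x + y = (n + n') + (s + s') * a" "n + n' \<in> N" "s + s' \<in> T"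
        using ideal_ofD(3)[OF N(1)] subring_closedD(6)[OF T] by (auto simp: algebra_simps)
      then show "x + y \<in> J" unfolding J_def by blast
    next
      fix t x assume t: "t \<in> T" and "x \<in> J"
      then obtain n s where "x = n + s * a" "n \<in> N" "s \<in> T" by (auto simp: J_def)
      then have "t * x = t * n + (t * s) * a" "t * n \<in> N" "t * s \<in> T"
        using t ideal_ofD(4)[OF N(1) t] subring_closedD(4)[OF T] by (simp_all add: distrib_left mult.assoc)
      then show "t * x \<in> J" unfolding J_def by blast
    qed
    then have "J \<inter> M \<noteq> {}"
      using max[of J] N(2) \<open>N \<subseteq> J\<close> \<open>a \<in> J\<close> a by (auto simp: \<I>_def)
    then show ?thesis by (auto simp: J_def)
  qed
  have "prime_of T N"
    unfolding prime_of_def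
  proof (intro conjI ballI impI)
    show "1 \<notin> N" using N M by blast
    fix x y assume xy: "x \<in> T" "y \<in> T" "x * y \<in> N"
    show "x \<in> N \<or> y \<in> N"
    proof (rule ccontr)
      assume "\<not> ?thesis"
      then obtain n s n' s' where ns: "n \<in> N" "s \<in> T" "n + s * x \<in> M" "n' \<in> N" "s' \<in> T" "n' + s' * y \<in> M"
        using meets xy by metis
      have "(n + s * x) * (n' + s' * y) = (n' + s' * y) * n + (s * x) * n' + (s * s') * (x * y)"
        by (simp add: algebra_simps)
      also have "\<dots> \<in> N"
      proof -
        have T': "n' + s' * y \<in> T" "s * x \<in> T" "s * s' \<in> T"
          using ns xy ideal_ofD(1)[OF N(1)] by (auto intro!: subring_closedD(4,6)[OF T])
        show ?thesis
          using ideal_ofD(4)[OF N(1) T'(1) ns(1)] ideal_ofD(4)[OF N(1) T'(2) ns(4)]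
            ideal_ofD(4)[OF N(1) T'(3) xy(3)] by (intro ideal_ofD(3)[OF N(1)])
      qed
      finally show False using M(2)[OF ns(3,6)] N(3) by blast
    qed
  qed (rule N(1))
  with N meets show ?thesis using that by blast
qed

text \<open>The prime \<open>N\<close> is a maximal ideal of \<open>S\<close> among those that avoid \<open>T - Q\<close>, so \<open>N \<inter> T \<subseteq> Q\<close>. If an element \<open>a\<close> of \<open>Q\<close> were
missing in \<open>N\<close>, then \<open>n + s a = t\<close> for some \<open>t\<close> in \<open>T - Q\<close>. The integral equation of \<open>s\<close>, multiplied by a
power of \<open>a\<close>, is an equation for \<open>s a \<equiv> t\<close> modulo \<open>N\<close> whose lower coefficients lie in \<open>Q\<close>, so a power of
\<open>t\<close> lies in \<open>Q\<close>.\<close>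

lemma lying_over:
  fixes T S :: "'k::field set"
  assumes T: "subring_closed T" and S: "subring_closed S" and TS: "T \<subseteq> S" "S \<subseteq> integral_closure_in_field T"
    and Q: "prime_of T Q"
  obtains N where "prime_of S N" "N \<inter> T = Q"
proof -
  have "ideal_of S {0}" using subring_closedD(2)[OF S] by (simp add: ideal_of_def)
  moreover have "1 \<in> T - Q" using prime_ofD(2)[OF Q] subring_closedD(1)[OF T] by simp
  moreover have "a * b \<in> T - Q" if "a \<in> T - Q" "b \<in> T - Q" for a b
    using that prime_ofD(3)[OF Q] subring_closedD(4)[OF T] by blast
  moreover have "{0} \<inter> (T - Q) = {}" using ideal_ofD(2)[OF prime_ofD(1)[OF Q]] by simp
  ultimately obtain N where N: "prime_of S N" "N \<inter> (T - Q) = {}"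
    and meets: "\<And>a. a \<in> S \<Longrightarrow> a \<notin> N \<Longrightarrow> \<exists>n\<in>N. \<exists>s\<in>S. n + s * a \<in> T - Q"
    by (rule maximal_ideal_avoiding[OF S, of "{0}" "T - Q"]) blast+
  note NI = prime_ofD(1)[OF N(1)] and QI = prime_ofD(1)[OF Q]
  have "Q \<subseteq> N"
  proof
    fix a assume a: "a \<in> Q"
    then have aT: "a \<in> T" using ideal_ofD(1)[OF QI] by blast
    show "a \<in> N"
    proof (rule ccontr)
      assume "a \<notin> N"
      then obtain n s where ns: "n \<in> N" "s \<in> S" and t: "n + s * a \<in> T" "n + s * a \<notin> Q"
        using meets aT TS by blast
      define t where "t = n + s * a"
      obtain p where p: "p \<in> polys_over T" "lead_coeff p = 1" "poly p s = 0"
        using ns(2) TS(2) unfolding integral_iff[symmetric] by (meson integral_iff subsetD)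
      define k where "k = degree p"
      \<comment> \<open>These are the coefficients of the equation of \<open>s a\<close>; all but the leading one are multiples of \<open>a\<close>.\<close>
      define c where "c i = coeff p i * a ^ (k - i)" for i
      have cT: "c i \<in> T" for i
        unfolding c_def using aT p(1) by (auto simp: polys_over_def intro!: subring_closedD(4,7)[OF T])
      have tT: "t \<in> T" using t by (simp add: t_def)
      have "(\<Sum>i\<le>k. c i * (s * a) ^ i) = a ^ k * poly p s"
        unfolding poly_altdef k_def[symmetric] sum_distrib_left
      proof (rule sum.cong)
        fix i assume "i \<in> {..k}"
        then have "a ^ k = a ^ (k - i) * a ^ i" by (simp flip: power_add)
        then show "c i * (s * a) ^ i = a ^ k * (coeff p i * s ^ i)"
          by (simp add: c_def power_mult_distrib mult_ac)
      qed simp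
      then have zero: "(\<Sum>i\<le>k. c i * (s * a) ^ i) = 0" using p(3) by simp
      have diff: "t ^ i - (s * a) ^ i \<in> N" for i
      proof (induction i)
        case 0
        show ?case using ideal_ofD(2)[OF NI] by simp
      next
        case (Suc i)
        have "t ^ Suc i - (s * a) ^ Suc i = t * (t ^ i - (s * a) ^ i) + (s * a) ^ i * n"
          by (simp add: t_def algebra_simps)
        moreover have "t \<in> S" "s * a \<in> S"
          using tT TS ns(2) aT subring_closedD(4)[OF S] by auto
        ultimately show ?case
          using Suc ns(1) ideal_ofD(3,4)[OF NI] subring_closedD(7)[OF S] by metis
      qed
      have "(\<Sum>i\<le>k. c i * t ^ i) = (\<Sum>i\<le>k. c i * (t ^ i - (s * a) ^ i))"
        using zero by (simp add: right_diff_distrib sum_subtractf)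
      also have "\<dots> \<in> N"
        using diff cT TS(1) by (intro ideal_of_sum[OF NI] ideal_ofD(4)[OF NI]) auto
      finally have "(\<Sum>i\<le>k. c i * t ^ i) \<in> N" .
      moreover have "(\<Sum>i\<le>k. c i * t ^ i) \<in> T"
        using cT tT by (intro subring_closed_sum[OF T] subring_closedD(4,7)[OF T]) auto
      ultimately have "(\<Sum>i\<le>k. c i * t ^ i) \<in> Q" using N(2) by blast
      moreover have "{..k} = insert k {..<k}" by auto
      then have "(\<Sum>i\<le>k. c i * t ^ i) = t ^ k + (\<Sum>i<k. c i * t ^ i)"
        using p(2) by (simp add: c_def k_def)
      moreover have "(\<Sum>i<k. c i * t ^ i) \<in> Q"
      proof (rule ideal_of_sum[OF QI])
        fix i assume "i \<in> {..<k}"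
        then have "a ^ (k - i) = a ^ (k - i - 1) * a" by (metis lessThan_iff power_minus_mult zero_less_diff)
        then have "c i * t ^ i = (coeff p i * a ^ (k - i - 1) * t ^ i) * a"
          by (simp add: c_def mult_ac)
        also have "\<dots> \<in> Q"
          using a aT tT p(1) by (intro ideal_ofD(4)[OF QI] subring_closedD(4,7)[OF T]) (auto simp: polys_over_def)
        finally show "c i * t ^ i \<in> Q" .
      qed
      ultimately have "t ^ k \<in> Q" using ideal_of_diff[OF QI T] by (metis add_diff_cancel_right')
      then have "t \<in> Q" by (rule prime_of_power[OF Q T tT])
      then show False using t by (simp add: t_def)
    qed
  qed
  then have "N \<inter> T = Q" using N(2) ideal_ofD(1)[OF QI] by blast
  with N show ?thesis using that by blast
qed

text \<open>Seidenberg's argument. Let \<open>c\<close> be the leading coefficient; then \<open>c u\<close> is integral over \<open>S\<close>, hence in \<open>S\<close>. If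
\<open>c\<close> is outside \<open>P\<close>, it is the required \<open>s\<close>. Otherwise \<open>c u\<close> is absorbed into the next coefficient, which lowers
the degree. The only way to lose the last coefficient outside \<open>P\<close> is that \<open>s = c u\<close> is itself outside \<open>P\<close>.\<close>

lemma comparable_of_relation:
  fixes u :: "'k::field"
  assumes S: "subring_closed S" and closed: "integral_closure_in_field S \<subseteq> S" and P: "prime_of S P"
    and u: "u \<noteq> 0" and a: "\<And>i. i \<le> n \<Longrightarrow> a i \<in> S" "(\<Sum>i\<le>n. a i * u ^ i) = 0" "\<exists>i\<le>n. a i \<notin> P"
  shows "\<exists>s\<in>S - P. s * u \<in> S \<or> s / u \<in> S"
  using a
proof (induction n arbitrary: a)
  case 0
  then show ?case using ideal_ofD(2)[OF prime_ofD(1)[OF P]] by simp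
next
  case (Suc n)
  note PI = prime_ofD(1)[OF P]
  define c where "c = a (Suc n)"
  define b where "b = c * u"
  have aS: "a i \<in> S" if "i \<le> n" for i using Suc.prems(1) that by simp
  have cS: "c \<in> S" using Suc.prems(1) by (simp add: c_def)
  have bS: "b \<in> S"
  proof -
    \<comment> \<open>The relation multiplied by \<open>c ^ n\<close> is a monic equation for \<open>c u\<close>.\<close>
    define p where "p = monom 1 (Suc n) + (\<Sum>i\<le>n. monom (a i * c ^ (n - i)) i)"
    have coeff_p: "coeff p j = (if j = Suc n then 1 else if j \<le> n then a j * c ^ (n - j) else 0)" for j
      by (simp add: p_def coeff_sum)
    have "degree p = Suc n"
    proof (rule antisym)
      show "degree p \<le> Suc n" by (rule degree_le) (simp add: coeff_p)
      show "Suc n \<le> degree p" by (rule le_degree) (simp add: coeff_p)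
    qed
    then have "lead_coeff p = 1" by (simp add: coeff_p)
    moreover have "p \<in> polys_over S"
      using aS cS subring_closedD[OF S] by (auto simp: polys_over_def coeff_p)
    moreover have "poly p b = 0"
    proof -
      have "poly p b = b ^ Suc n + (\<Sum>i\<le>n. a i * c ^ (n - i) * b ^ i)"
        by (simp add: p_def poly_sum poly_monom)
      also have "(\<Sum>i\<le>n. a i * c ^ (n - i) * b ^ i) = (\<Sum>i\<le>n. c ^ n * (a i * u ^ i))"
      proof (rule sum.cong)
        fix i assume "i \<in> {..n}"
        then have "c ^ n = c ^ (n - i) * c ^ i" by (simp flip: power_add)
        then show "a i * c ^ (n - i) * b ^ i = c ^ n * (a i * u ^ i)"
          by (simp add: b_def power_mult_distrib mult_ac)
      qed simp
      also have "b ^ Suc n = c ^ n * (a (Suc n) * u ^ Suc n)"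
        by (simp add: b_def c_def power_mult_distrib mult_ac)
      also have "c ^ n * (a (Suc n) * u ^ Suc n) + (\<Sum>i\<le>n. c ^ n * (a i * u ^ i))
          = c ^ n * (\<Sum>i\<le>Suc n. a i * u ^ i)"
        by (simp add: sum_distrib_left distrib_left)
      finally show ?thesis using Suc.prems(2) by simp
    qed
    ultimately show ?thesis using closed unfolding subset_iff integral_iff by blast
  qed
  show ?case
  proof (cases "c \<in> P")
    case False
    then show ?thesis using bS cS by (auto simp: b_def)
  next
    case True
    define a' where "a' i = (if i = n then b + a n else a i)" for i
    have a'S: "a' i \<in> S" if "i \<le> n" for i
      using aS[OF that] bS subring_closedD(6)[OF S] by (auto simp: a'_def)
    have split: "{..n} = insert n {..<n}" by auto
    have sum': "(\<Sum>i\<le>n. a' i * u ^ i) = 0"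
    proof -
      have "(\<Sum>i\<le>n. a' i * u ^ i) = (b + a n) * u ^ n + (\<Sum>i<n. a i * u ^ i)"
        unfolding split by (simp add: a'_def)
      also have "\<dots> = (\<Sum>i\<le>Suc n. a i * u ^ i)"
        unfolding atMost_Suc split by (simp add: b_def c_def algebra_simps)
      finally show ?thesis using Suc.prems(2) by simp
    qed
    show ?thesis
    proof (cases "\<exists>i\<le>n. a' i \<notin> P")
      case True
      show ?thesis by (rule Suc.IH[OF a'S sum' True])
    next
      case False
      then have inP: "a' i \<in> P" if "i \<le> n" for i using that by blast
      have "a i \<in> P" if "i < n" for i using inP[of i] that by (simp add: a'_def)
      moreover obtain i where "i \<le> Suc n" "a i \<notin> P" using Suc.prems(3) by blast
      ultimately have "a n \<notin> P" using True by (metis c_def le_Suc_eq le_neq_implies_less)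
      moreover have "b + a n \<in> P" using inP[of n] by (simp add: a'_def)
      ultimately have "b \<notin> P" using ideal_of_diff[OF PI S] by (metis add_diff_cancel_left')
      moreover have "b / u = c" using u by (simp add: b_def)
      ultimately show ?thesis using bS cS by (intro bexI[of _ b]) auto
    qed
  qed
qed

section \<open>Graded subrings of a field\<close>

text \<open>The field \<open>K\<close>, the family \<open>C\<close> of homogeneous parts of the graded quotient field, and the graded domain \<open>R\<close>
with fraction field \<open>K\<close>. All nonzero homogeneous elements are units, as expressed by \<open>C_inverse\<close>.\<close>

locale graded_in_field =
  fixes C :: "'g::torsion_free_ab_group \<Rightarrow> 'k::field set" and R :: "'k set"
  assumes C_zero: "0 \<in> C \<alpha>"
    and C_add: "x \<in> C \<alpha> \<Longrightarrow> y \<in> C \<alpha> \<Longrightarrow> x + y \<in> C \<alpha>"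
    and C_uminus: "x \<in> C \<alpha> \<Longrightarrow> - x \<in> C \<alpha>"
    and C_one: "1 \<in> C 0"
    and C_mult: "x \<in> C \<alpha> \<Longrightarrow> y \<in> C \<beta> \<Longrightarrow> x * y \<in> C (\<alpha> + \<beta>)"
    and C_inverse: "x \<in> C \<alpha> \<Longrightarrow> inverse x \<in> C (- \<alpha>)"
    and C_independent: "finite A \<Longrightarrow> (\<And>\<alpha>. \<alpha> \<in> A \<Longrightarrow> c \<alpha> \<in> C \<alpha>) \<Longrightarrow> (\<Sum>\<alpha>\<in>A. c \<alpha>) = 0 \<Longrightarrow>
      \<alpha> \<in> A \<Longrightarrow> c \<alpha> = 0"
    and R_subring: "subring_closed R"
    and R_decomposition: "r \<in> R \<Longrightarrow>
      \<exists>A c. finite A \<and> (\<forall>\<alpha>\<in>A. c \<alpha> \<in> C \<alpha> \<inter> R) \<and> r = (\<Sum>\<alpha>\<in>A. c \<alpha>)"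
    and R_fraction: "\<exists>f\<in>R. \<exists>g\<in>R. g \<noteq> 0 \<and> z = f / g"
    and C_fraction: "x \<in> C \<alpha> \<Longrightarrow> \<exists>f\<in>R. \<exists>g\<in>R. \<exists>\<beta>. g \<in> C \<beta> \<and> g \<noteq> 0 \<and> x = f / g"
begin

lemma C_diff: "x \<in> C \<alpha> \<Longrightarrow> y \<in> C \<alpha> \<Longrightarrow> x - y \<in> C \<alpha>"
  using C_add[of x \<alpha> "- y"] C_uminus by simp

lemma C_divide: "x \<in> C \<alpha> \<Longrightarrow> y \<in> C \<beta> \<Longrightarrow> x / y \<in> C (\<alpha> - \<beta>)"
  using C_mult[of x \<alpha> "inverse y" "- \<beta>"] C_inverse by (simp add: divide_inverse)

text \<open>The graded quotient field, as the sum of its homogeneous parts.\<close>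

definition D :: "'k set"
  where "D = {x. \<exists>A c. finite A \<and> (\<forall>\<alpha>\<in>A. c \<alpha> \<in> C \<alpha>) \<and> x = (\<Sum>\<alpha>\<in>A. c \<alpha>)}"

text \<open>The family of components is well defined on \<open>D\<close> by \<open>component_unique\<close>; outside \<open>D\<close> its value is arbitrary.\<close>

definition component :: "'k \<Rightarrow> 'g \<Rightarrow> 'k"
  where "component x = (SOME c. (\<forall>\<alpha>. c \<alpha> \<in> C \<alpha>) \<and> finite {\<alpha>. c \<alpha> \<noteq> 0} \<and>
    x = (\<Sum>\<alpha> | c \<alpha> \<noteq> 0. c \<alpha>))"

definition support :: "'k \<Rightarrow> 'g set"
  where "support x = {\<alpha>. component x \<alpha> \<noteq> 0}"

lemma component_spec:
  assumes "x \<in> D"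
  shows "component x \<alpha> \<in> C \<alpha>" "finite (support x)" "x = (\<Sum>\<alpha>\<in>support x. component x \<alpha>)"
proof -
  obtain A c where Ac: "finite A" "\<forall>\<alpha>\<in>A. c \<alpha> \<in> C \<alpha>" "x = (\<Sum>\<alpha>\<in>A. c \<alpha>)"
    using assms by (auto simp: D_def)
  define c' where "c' \<alpha> = (if \<alpha> \<in> A then c \<alpha> else 0)" for \<alpha>
  have sub: "{\<alpha>. c' \<alpha> \<noteq> 0} \<subseteq> A" by (auto simp: c'_def)
  have "x = (\<Sum>\<alpha>\<in>A. c' \<alpha>)" by (simp add: Ac(3) c'_def)
  also have "\<dots> = (\<Sum>\<alpha> | c' \<alpha> \<noteq> 0. c' \<alpha>)"
    by (rule sum.mono_neutral_right[OF Ac(1) sub]) auto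
  finally have "(\<forall>\<alpha>. c' \<alpha> \<in> C \<alpha>) \<and> finite {\<alpha>. c' \<alpha> \<noteq> 0} \<and> x = (\<Sum>\<alpha> | c' \<alpha> \<noteq> 0. c' \<alpha>)"
    using Ac finite_subset[OF sub] C_zero by (auto simp: c'_def)
  from someI[of "\<lambda>c. (\<forall>\<alpha>. c \<alpha> \<in> C \<alpha>) \<and> finite {\<alpha>. c \<alpha> \<noteq> 0} \<and> x = (\<Sum>\<alpha> | c \<alpha> \<noteq> 0. c \<alpha>)", OF this]
  show "component x \<alpha> \<in> C \<alpha>" "finite (support x)" "x = (\<Sum>\<alpha>\<in>support x. component x \<alpha>)"
    unfolding component_def support_def by blast+
qed

lemma sum_components:
  assumes "x \<in> D" "finite A" "support x \<subseteq> A"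
  shows "(\<Sum>\<alpha>\<in>A. component x \<alpha>) = x"
proof -
  have "(\<Sum>\<alpha>\<in>A. component x \<alpha>) = (\<Sum>\<alpha>\<in>support x. component x \<alpha>)"
    by (rule sum.mono_neutral_right[OF assms(2,3)]) (auto simp: support_def)
  then show ?thesis using component_spec(3)[OF assms(1)] by simp
qed

lemma component_unique:
  assumes c: "\<And>\<alpha>. c \<alpha> \<in> C \<alpha>" and A: "finite A" "\<And>\<alpha>. \<alpha> \<notin> A \<Longrightarrow> c \<alpha> = 0" and x: "x = (\<Sum>\<alpha>\<in>A. c \<alpha>)"
  shows "x \<in> D" "component x \<alpha> = c \<alpha>"
proof -
  show D: "x \<in> D" unfolding D_def using A c x by blast
  define B where "B = insert \<alpha> (A \<union> support x)"
  have B: "finite B" using A component_spec(2)[OF D] by (simp add: B_def)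
  have "(\<Sum>\<alpha>\<in>B. c \<alpha>) = x"
    unfolding x by (rule sum.mono_neutral_right[OF B]) (auto simp: B_def A)
  moreover have "(\<Sum>\<alpha>\<in>B. component x \<alpha>) = x"
    by (rule sum_components[OF D B]) (auto simp: B_def)
  ultimately have "(\<Sum>\<alpha>\<in>B. component x \<alpha> - c \<alpha>) = 0" by (simp add: sum_subtractf)
  then have "component x \<alpha> - c \<alpha> = 0"
    by (rule C_independent[OF B, rotated]) (auto simp: B_def intro!: C_diff c component_spec(1)[OF D])
  then show "component x \<alpha> = c \<alpha>" by simp
qed

lemma component_homogeneous:
  assumes "x \<in> C \<alpha>"
  shows "x \<in> D" "component x \<beta> = (if \<beta> = \<alpha> then x else 0)"
  using component_unique[where c = "\<lambda>\<beta>. if \<beta> = \<alpha> then x else 0" and A = "{\<alpha>}" and x = x] assms C_zero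
  by simp_all

lemma component_zero [simp]: "component 0 \<beta> = 0"
  using component_homogeneous(2)[OF C_zero] by simp

lemma component_diff:
  assumes "x \<in> D" "y \<in> D"
  shows "x - y \<in> D" "component (x - y) \<alpha> = component x \<alpha> - component y \<alpha>"
proof -
  define A where "A = support x \<union> support y"
  have A: "finite A" using assms component_spec(2) by (simp add: A_def)
  have "x - y = (\<Sum>\<alpha>\<in>A. component x \<alpha> - component y \<alpha>)"
    using sum_components[OF assms(1) A] sum_components[OF assms(2) A]
    by (simp add: A_def sum_subtractf)
  from component_unique[OF _ A _ this]
  show "x - y \<in> D" "component (x - y) \<alpha> = component x \<alpha> - component y \<alpha>"
    using assms by (auto simp: A_def support_def intro!: C_diff component_spec(1))
qed

lemma D_zero: "0 \<in> D"
  by (rule component_homogeneous(1)[OF C_zero])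

lemma component_uminus:
  assumes "x \<in> D"
  shows "- x \<in> D" "component (- x) \<alpha> = - component x \<alpha>"
  using component_diff[OF D_zero assms] by simp_all

lemma component_add:
  assumes "x \<in> D" "y \<in> D"
  shows "x + y \<in> D" "component (x + y) \<alpha> = component x \<alpha> + component y \<alpha>"
  using component_diff[OF assms(1) component_uminus(1)[OF assms(2)]] component_uminus(2)[OF assms(2)]
  by simp_all

lemma component_sum:
  assumes "\<And>i. i \<in> I \<Longrightarrow> f i \<in> D"
  shows "(\<Sum>i\<in>I. f i) \<in> D \<and> component (\<Sum>i\<in>I. f i) \<alpha> = (\<Sum>i\<in>I. component (f i) \<alpha>)"
  using assms
proof (induction I rule: infinite_finite_induct)
  case (insert i I)
  then show ?case using component_add[of "f i" "\<Sum>i\<in>I. f i"] by simp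
qed (simp_all add: D_zero)

lemma component_mult_homogeneous:
  assumes x: "x \<in> D" and h: "h \<in> C \<delta>"
  shows "x * h \<in> D" "component (x * h) \<gamma> = component x (\<gamma> - \<delta>) * h"
proof -
  define A where "A = (\<lambda>\<alpha>. \<alpha> + \<delta>) ` support x"
  have A: "finite A" using component_spec(2)[OF x] by (simp add: A_def)
  have "x * h = (\<Sum>\<alpha>\<in>support x. component x \<alpha> * h)"
    by (subst component_spec(3)[OF x]) (rule sum_distrib_right)
  also have "\<dots> = (\<Sum>\<gamma>\<in>A. component x (\<gamma> - \<delta>) * h)"
    unfolding A_def by (subst sum.reindex) (auto simp: inj_on_def)
  finally have eq: "x * h = (\<Sum>\<gamma>\<in>A. component x (\<gamma> - \<delta>) * h)" .
  have "component x (\<gamma> - \<delta>) * h \<in> C \<gamma>" for \<gamma>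
    using C_mult[OF component_spec(1)[OF x] h, of "\<gamma> - \<delta>"] by simp
  moreover have "component x (\<gamma> - \<delta>) * h = 0" if "\<gamma> \<notin> A" for \<gamma>
  proof (rule ccontr)
    assume "\<not> ?thesis"
    then have "\<gamma> - \<delta> \<in> support x" by (simp add: support_def)
    then have "(\<gamma> - \<delta>) + \<delta> \<in> A" unfolding A_def by blast
    then show False using that by simp
  qed
  ultimately show "x * h \<in> D" "component (x * h) \<gamma> = component x (\<gamma> - \<delta>) * h"
    using component_unique[OF _ A _ eq] by blast+
qed

lemma component_mult:
  assumes x: "x \<in> D" and y: "y \<in> D" and A: "finite A" "support x \<subseteq> A"
  shows "x * y \<in> D" "component (x * y) \<gamma> = (\<Sum>\<alpha>\<in>A. component x \<alpha> * component y (\<gamma> - \<alpha>))"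
proof -
  have "x * y = (\<Sum>\<alpha>\<in>A. component x \<alpha>) * y" by (simp add: sum_components[OF x A])
  then have eq: "x * y = (\<Sum>\<alpha>\<in>A. y * component x \<alpha>)"
    by (simp add: sum_distrib_left mult.commute)
  show "x * y \<in> D" "component (x * y) \<gamma> = (\<Sum>\<alpha>\<in>A. component x \<alpha> * component y (\<gamma> - \<alpha>))"
    unfolding eq using component_sum[of A "\<lambda>\<alpha>. y * component x \<alpha>"]
      component_mult_homogeneous[OF y component_spec(1)[OF x]] by (simp_all add: mult.commute)
qed

lemma subring_closed_D: "subring_closed D"
  unfolding subring_closed_def
  using component_homogeneous(1)[OF C_one] component_diff(1) component_mult(1) component_spec(2) by blast

text \<open>For a subring \<open>T\<close> this says that \<open>T\<close> is the direct sum of its homogeneous parts (\<open>internal_direct_sum_iff\<close>), for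
an ideal that it is generated by homogeneous elements (\<open>homogeneous_ideal_iff\<close>).\<close>

definition graded_set :: "'k set \<Rightarrow> bool"
  where "graded_set S \<longleftrightarrow> S \<subseteq> D \<and> (\<forall>x\<in>S. \<forall>\<alpha>. component x \<alpha> \<in> S)"

lemma graded_setD:
  assumes "graded_set S" "x \<in> S"
  shows "x \<in> D" "component x \<alpha> \<in> S"
  using assms by (auto simp: graded_set_def)

lemma graded_R: "graded_set R"
proof -
  have "r \<in> D \<and> component r \<alpha> \<in> R" if r: "r \<in> R" for r \<alpha>
  proof -
    obtain A c where A: "finite A" and c: "\<forall>\<alpha>\<in>A. c \<alpha> \<in> C \<alpha> \<inter> R" "r = (\<Sum>\<alpha>\<in>A. c \<alpha>)"
      using R_decomposition[OF r] by blast
    have eq: "r = (\<Sum>\<alpha>\<in>A. if \<alpha> \<in> A then c \<alpha> else 0)" using c by simp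
    have "r \<in> D" "component r \<alpha> = (if \<alpha> \<in> A then c \<alpha> else 0)"
      using component_unique[OF _ A _ eq] c C_zero by auto
    then show ?thesis using c subring_closedD(2)[OF R_subring] by simp
  qed
  then show ?thesis by (auto simp: graded_set_def)
qed

lemma D_fraction:
  assumes "x \<in> D"
  obtains f g \<beta> where "f \<in> R" "g \<in> R" "g \<in> C \<beta>" "g \<noteq> 0" "x = f / g"
proof -
  have "\<exists>f\<in>R. \<exists>g\<in>R. \<exists>\<beta>. g \<in> C \<beta> \<and> g \<noteq> 0 \<and> (\<Sum>\<alpha>\<in>A. c \<alpha>) = f / g"
    if "finite A" "\<forall>\<alpha>\<in>A. c \<alpha> \<in> C \<alpha>" for A and c :: "'g \<Rightarrow> 'k"
    using that
  proof (induction A)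
    case empty
    then show ?case
      using subring_closedD(1,2)[OF R_subring] C_one by (intro bexI[of _ 0] bexI[of _ 1] exI[of _ 0]) auto
  next
    case (insert \<alpha> A)
    then obtain f g \<beta> where fg: "f \<in> R" "g \<in> R" "g \<in> C \<beta>" "g \<noteq> 0" "(\<Sum>\<alpha>\<in>A. c \<alpha>) = f / g" by auto
    obtain f' g' \<beta>' where fg': "f' \<in> R" "g' \<in> R" "g' \<in> C \<beta>'" "g' \<noteq> 0" "c \<alpha> = f' / g'"
      using C_fraction[of "c \<alpha>" \<alpha>] insert by auto
    have "(\<Sum>\<alpha>\<in>insert \<alpha> A. c \<alpha>) = (f' * g + f * g') / (g' * g)"
      using insert(1,2) fg(4,5) fg'(4,5) by (simp add: add_frac_eq)
    moreover have "f' * g + f * g' \<in> R" "g' * g \<in> R" "g' * g \<noteq> 0"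
      using fg fg' by (auto intro!: subring_closedD(4,6)[OF R_subring])
    ultimately show ?case using C_mult[OF fg'(3) fg(3)] by blast
  qed
  moreover obtain A c where "finite A" "\<forall>\<alpha>\<in>A. c \<alpha> \<in> C \<alpha>" "x = (\<Sum>\<alpha>\<in>A. c \<alpha>)"
    using assms by (auto simp: D_def)
  ultimately show ?thesis using that by metis
qed

text \<open>Among the components of \<open>x\<close> and of \<open>y\<close> that lie outside \<open>I\<close>, those of largest weight are unique. Their product
is, modulo \<open>I\<close>, a component of \<open>x y\<close>, and it lies outside \<open>I\<close>.\<close>

lemma prime_of_homogeneous_test:
  assumes T: "subring_closed T" "graded_set T" and I: "ideal_of T I" "graded_set I" "1 \<notin> I"
    and test: "\<And>x y \<alpha> \<beta>. x \<in> T \<Longrightarrow> x \<in> C \<alpha> \<Longrightarrow> y \<in> T \<Longrightarrow> y \<in> C \<beta> \<Longrightarrow> x * y \<in> I \<Longrightarrow> x \<in> I \<or> y \<in> I"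
  shows "prime_of T I"
  unfolding prime_of_def
proof (intro conjI ballI impI)
  fix x y assume xT: "x \<in> T" and yT: "y \<in> T" and xy: "x * y \<in> I"
  have xD: "x \<in> D" and yD: "y \<in> D" using xT yT graded_setD(1)[OF T(2)] by auto
  show "x \<in> I \<or> y \<in> I"
  proof (rule ccontr)
    assume neither: "\<not> (x \<in> I \<or> y \<in> I)"
    define A where "A = {\<alpha>. component x \<alpha> \<notin> I}"
    define B where "B = {\<beta>. component y \<beta> \<notin> I}"
    have I0: "0 \<in> I" using ideal_ofD(2)[OF I(1)] .
    have AB_sub: "A \<subseteq> support x" "B \<subseteq> support y" using I0 by (auto simp: A_def B_def support_def)
    then have fin: "finite A" "finite B"
      using finite_subset component_spec(2)[OF xD] component_spec(2)[OF yD] by auto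
    have "\<exists>\<alpha>. component z \<alpha> \<notin> I" if "z \<in> D" "z \<notin> I" for z
    proof (rule ccontr)
      assume "\<not> ?thesis"
      then have "(\<Sum>\<alpha>\<in>support z. component z \<alpha>) \<in> I" by (intro ideal_of_sum[OF I(1)]) auto
      then show False using component_spec(3)[OF that(1)] that(2) by simp
    qed
    then have ne: "A \<noteq> {}" "B \<noteq> {}" using xD yD neither by (auto simp: A_def B_def)
    obtain w :: "'g \<Rightarrow> rat" where w: "\<And>a b. w (a + b) = w a + w b" "inj_on w (A \<union> B)"
      using injective_integral_weight[of "A \<union> B"] fin by auto
    have "\<exists>\<alpha>\<in>A. \<forall>\<beta>\<in>A. w \<beta> \<le> w \<alpha>" if A: "finite A" "A \<noteq> {}" for A
    proof -
      have "Max (w ` A) \<in> w ` A" using A by (intro Max_in) auto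
      then obtain \<alpha> where "\<alpha> \<in> A" "Max (w ` A) = w \<alpha>" by (auto simp: image_iff)
      then show ?thesis using Max_ge[of "w ` A"] A by auto
    qed
    from this[OF fin(1) ne(1)] this[OF fin(2) ne(2)]
    obtain \<alpha> \<beta> where \<alpha>: "\<alpha> \<in> A" "\<And>\<gamma>. \<gamma> \<in> A \<Longrightarrow> w \<gamma> \<le> w \<alpha>"
      and \<beta>: "\<beta> \<in> B" "\<And>\<gamma>. \<gamma> \<in> B \<Longrightarrow> w \<gamma> \<le> w \<beta>" by blast
    \<comment> \<open>If both factors were outside \<open>I\<close>, then \<open>w \<gamma> < w \<alpha>\<close> would force the weight of \<open>\<alpha> + \<beta> - \<gamma>\<close>
      above the maximum \<open>w \<beta>\<close>.\<close>
    have other: "component x \<gamma> * component y (\<alpha> + \<beta> - \<gamma>) \<in> I" if "\<gamma> \<noteq> \<alpha>" for \<gamma>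
    proof (cases "\<gamma> \<in> A \<and> \<alpha> + \<beta> - \<gamma> \<in> B")
      case True
      have "w \<gamma> \<noteq> w \<alpha>" using w(2) True \<alpha>(1) that by (auto simp: inj_on_def)
      then have "w \<gamma> < w \<alpha>" using \<alpha>(2)[of \<gamma>] True by simp
      moreover have "w (\<alpha> + \<beta> - \<gamma>) \<le> w \<beta>" using \<beta>(2) True by blast
      ultimately show ?thesis by (simp add: additive_diff[OF w(1)] w(1))
    next
      case False
      then consider "component x \<gamma> \<in> I" | "component y (\<alpha> + \<beta> - \<gamma>) \<in> I" by (auto simp: A_def B_def)
      then show ?thesis
      proof cases
        case 1
        then have "component y (\<alpha> + \<beta> - \<gamma>) * component x \<gamma> \<in> I"
          using graded_setD(2)[OF T(2) yT] by (intro ideal_ofD(4)[OF I(1)])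
        then show ?thesis by (simp add: mult.commute)
      next
        case 2
        then show ?thesis using graded_setD(2)[OF T(2) xT] by (intro ideal_ofD(4)[OF I(1)])
      qed
    qed
    have mem: "\<alpha> \<in> support x" using \<alpha>(1) AB_sub by blast
    have "component (x * y) (\<alpha> + \<beta>) = (\<Sum>\<gamma>\<in>support x. component x \<gamma> * component y (\<alpha> + \<beta> - \<gamma>))"
      by (rule component_mult(2)[OF xD yD component_spec(2)[OF xD] subset_refl])
    also have "\<dots> = component x \<alpha> * component y \<beta>
        + (\<Sum>\<gamma>\<in>support x - {\<alpha>}. component x \<gamma> * component y (\<alpha> + \<beta> - \<gamma>))"
      by (subst sum.remove[OF component_spec(2)[OF xD] mem]) simp
    finally have eq: "component x \<alpha> * component y \<beta> = component (x * y) (\<alpha> + \<beta>)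
        - (\<Sum>\<gamma>\<in>support x - {\<alpha>}. component x \<gamma> * component y (\<alpha> + \<beta> - \<gamma>))" by simp
    have "component x \<alpha> * component y \<beta> \<in> I"
      unfolding eq using other graded_setD(2)[OF I(2) xy]
      by (intro ideal_of_diff[OF I(1) T(1)] ideal_of_sum[OF I(1)]) auto
    then have "component x \<alpha> \<in> I \<or> component y \<beta> \<in> I"
      using graded_setD(2)[OF T(2)] xT yT component_spec(1)[OF xD] component_spec(1)[OF yD]
      by (intro test) auto
    then show False using \<alpha>(1) \<beta>(1) by (simp add: A_def B_def)
  qed
qed (use I in auto)

text \<open>For an ideal \<open>P\<close> of a graded subring \<open>T\<close> this is the largest homogeneous ideal contained in \<open>P\<close>.\<close>

definition graded_core :: "'k set \<Rightarrow> 'k set \<Rightarrow> 'k set"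
  where "graded_core T P = {x \<in> T. \<forall>\<alpha>. component x \<alpha> \<in> P}"

lemma graded_core_homogeneous:
  assumes "x \<in> C \<alpha>" "x \<in> T" "x \<in> P" "0 \<in> P"
  shows "x \<in> graded_core T P"
  using assms by (simp add: graded_core_def component_homogeneous(2)[OF assms(1)])

lemma graded_core_ideal:
  assumes T: "subring_closed T" "graded_set T" and P: "ideal_of T P"
  shows "ideal_of T (graded_core T P)" "graded_set (graded_core T P)" "graded_core T P \<subseteq> P"
proof -
  note TD = graded_setD[OF T(2)]
  show "ideal_of T (graded_core T P)"
    unfolding ideal_of_def
  proof (intro conjI ballI)
    show "graded_core T P \<subseteq> T" by (auto simp: graded_core_def)
    show "0 \<in> graded_core T P"
      using subring_closedD(2)[OF T(1)] ideal_ofD(2)[OF P] by (simp add: graded_core_def)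
  next
    fix x y assume "x \<in> graded_core T P" "y \<in> graded_core T P"
    then show "x + y \<in> graded_core T P"
      using TD(1) subring_closedD(6)[OF T(1)] ideal_ofD(3)[OF P]
      by (simp add: graded_core_def component_add(2))
  next
    fix t x assume t: "t \<in> T" and x: "x \<in> graded_core T P"
    then have xT: "x \<in> T" by (simp add: graded_core_def)
    have "component (t * x) \<alpha> \<in> P" for \<alpha>
      unfolding component_mult(2)[OF TD(1)[OF t] TD(1)[OF xT] component_spec(2)[OF TD(1)[OF t]] subset_refl]
      using x TD(2)[OF t] by (intro ideal_of_sum[OF P] ideal_ofD(4)[OF P]) (auto simp: graded_core_def)
    then show "t * x \<in> graded_core T P"
      using subring_closedD(4)[OF T(1) t xT] by (simp add: graded_core_def)
  qed
  show "graded_set (graded_core T P)"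
    unfolding graded_set_def
  proof (intro conjI ballI allI)
    show "graded_core T P \<subseteq> D" using TD(1) by (auto simp: graded_core_def)
    fix x \<alpha> assume x: "x \<in> graded_core T P"
    then have "x \<in> T" by (simp add: graded_core_def)
    then show "component x \<alpha> \<in> graded_core T P"
      using x TD by (intro graded_core_homogeneous[OF component_spec(1)])
        (auto simp: graded_core_def ideal_ofD(2)[OF P])
  qed
  show "graded_core T P \<subseteq> P"
  proof
    fix x assume x: "x \<in> graded_core T P"
    then have "x \<in> D" using TD(1) by (auto simp: graded_core_def)
    have "(\<Sum>\<alpha>\<in>support x. component x \<alpha>) \<in> P"
      using x by (intro ideal_of_sum[OF P]) (auto simp: graded_core_def)
    then show "x \<in> P" using component_spec(3)[OF \<open>x \<in> D\<close>] by simp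
  qed
qed

lemma prime_graded_core:
  assumes T: "subring_closed T" "graded_set T" and P: "prime_of T P"
  shows "prime_of T (graded_core T P)"
proof -
  note PI = prime_ofD(1)[OF P] and core = graded_core_ideal[OF T prime_ofD(1)[OF P]]
  show ?thesis
  proof (rule prime_of_homogeneous_test[OF T core(1,2)])
    show "1 \<notin> graded_core T P" using core(3) prime_ofD(2)[OF P] by blast
    fix x y \<alpha> \<beta> assume xy: "x \<in> T" "x \<in> C \<alpha>" "y \<in> T" "y \<in> C \<beta>" "x * y \<in> graded_core T P"
    then have "x \<in> P \<or> y \<in> P" using core(3) prime_ofD(3)[OF P] by blast
    then show "x \<in> graded_core T P \<or> y \<in> graded_core T P"
      using xy graded_core_homogeneous ideal_ofD(2)[OF PI] by blast
  qed
qed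

text \<open>The shift by \<open>N\<close> makes all exponents nonnegative; weights of both signs occur, since \<open>R\<close> may contain
homogeneous units.\<close>

definition weight_admissible :: "('g \<Rightarrow> rat) \<Rightarrow> nat \<Rightarrow> 'k \<Rightarrow> bool"
  where "weight_admissible w N x \<longleftrightarrow> x \<in> D \<and> (\<forall>\<alpha>\<in>support x. w \<alpha> \<in> \<int> \<and> 0 \<le> \<lfloor>w \<alpha>\<rfloor> + int N)"

text \<open>The image of \<open>x = \<Sum> x\<^sub>\<alpha>\<close> under the substitution \<open>x\<^sub>\<alpha> \<mapsto> x\<^sub>\<alpha> t ^ (w \<alpha> + N)\<close>. Sums are preserved for fixed \<open>N\<close>, shifts
add up under multiplication, and \<open>t = 1\<close> gives back \<open>x\<close>.\<close>

definition weight_poly :: "('g \<Rightarrow> rat) \<Rightarrow> nat \<Rightarrow> 'k \<Rightarrow> 'k poly"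
  where "weight_poly w N x = (\<Sum>\<alpha>\<in>support x. monom (component x \<alpha>) (nat (\<lfloor>w \<alpha>\<rfloor> + int N)))"

lemma weight_poly_superset:
  assumes "x \<in> D" "finite A" "support x \<subseteq> A"
  shows "weight_poly w N x = (\<Sum>\<alpha>\<in>A. monom (component x \<alpha>) (nat (\<lfloor>w \<alpha>\<rfloor> + int N)))"
  unfolding weight_poly_def by (rule sum.mono_neutral_left[OF assms(2,3)]) (auto simp: support_def)

lemma weight_poly_zero: "weight_admissible w N 0" "weight_poly w N 0 = 0"
  by (simp_all add: weight_admissible_def weight_poly_def support_def D_zero)

lemma weight_poly_homogeneous:
  assumes "x \<in> C \<alpha>"
  shows "weight_poly w N x = monom x (nat (\<lfloor>w \<alpha>\<rfloor> + int N))"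
    "w \<alpha> \<in> \<int> \<Longrightarrow> 0 \<le> \<lfloor>w \<alpha>\<rfloor> + int N \<Longrightarrow> weight_admissible w N x"
proof -
  have s: "support x \<subseteq> {\<alpha>}" by (auto simp: support_def component_homogeneous(2)[OF assms] split: if_splits)
  show "weight_poly w N x = monom x (nat (\<lfloor>w \<alpha>\<rfloor> + int N))"
    using weight_poly_superset[OF component_homogeneous(1)[OF assms] _ s]
    by (simp add: component_homogeneous(2)[OF assms])
  show "w \<alpha> \<in> \<int> \<Longrightarrow> 0 \<le> \<lfloor>w \<alpha>\<rfloor> + int N \<Longrightarrow> weight_admissible w N x"
    using s component_homogeneous(1)[OF assms] by (auto simp: weight_admissible_def)
qed

lemma weight_poly_add:
  assumes "weight_admissible w N x" "weight_admissible w N y"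
  shows "weight_admissible w N (x + y)" "weight_poly w N (x + y) = weight_poly w N x + weight_poly w N y"
proof -
  have D: "x \<in> D" "y \<in> D" using assms by (auto simp: weight_admissible_def)
  define A where "A = support x \<union> support y"
  have A: "finite A" "support x \<subseteq> A" "support y \<subseteq> A" using D component_spec(2) by (auto simp: A_def)
  have s: "support (x + y) \<subseteq> A"
    by (auto simp: A_def support_def component_add(2)[OF D])
  show "weight_admissible w N (x + y)"
    using s assms component_add(1)[OF D] by (auto simp: weight_admissible_def A_def)
  show "weight_poly w N (x + y) = weight_poly w N x + weight_poly w N y"
    by (simp add: weight_poly_superset[OF D(1) A(1,2)] weight_poly_superset[OF D(2) A(1,3)]
        weight_poly_superset[OF component_add(1)[OF D] A(1) s] component_add(2)[OF D]
        add_monom sum.distrib flip: add_monom)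
qed

lemma weight_poly_sum:
  assumes "\<And>i. i \<in> I \<Longrightarrow> weight_admissible w N (f i)"
  shows "weight_admissible w N (\<Sum>i\<in>I. f i) \<and>
    weight_poly w N (\<Sum>i\<in>I. f i) = (\<Sum>i\<in>I. weight_poly w N (f i))"
  using assms
proof (induction I rule: infinite_finite_induct)
  case (insert i I)
  then show ?case using weight_poly_add[of w N "f i" "\<Sum>i\<in>I. f i"] by simp
qed (simp_all add: weight_poly_zero)

lemma weight_poly_mult:
  assumes w: "\<And>a b. w (a + b) = w a + w b"
    and x: "weight_admissible w N x" and y: "weight_admissible w M y"
  shows "weight_admissible w (N + M) (x * y)"
    "weight_poly w (N + M) (x * y) = weight_poly w N x * weight_poly w M y"
proof -
  have D: "x \<in> D" "y \<in> D" using x y by (auto simp: weight_admissible_def)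
  define f where "f = (\<lambda>(\<alpha>, \<beta>). component x \<alpha> * component y \<beta>)"
  define I where "I = support x \<times> support y"
  have xy: "x * y = (\<Sum>p\<in>I. f p)"
    unfolding f_def I_def sum.cartesian_product[symmetric] sum_product[symmetric]
    by (simp flip: component_spec(3)[OF D(1)] component_spec(3)[OF D(2)])
  have f: "weight_admissible w (N + M) (f p) \<and> weight_poly w (N + M) (f p) =
      monom (component x (fst p)) (nat (\<lfloor>w (fst p)\<rfloor> + int N)) *
      monom (component y (snd p)) (nat (\<lfloor>w (snd p)\<rfloor> + int M))" if "p \<in> I" for p
  proof -
    obtain \<alpha> \<beta> where p: "p = (\<alpha>, \<beta>)" by force
    then have ab: "\<alpha> \<in> support x" "\<beta> \<in> support y" using that by (auto simp: I_def)
    then have wx: "w \<alpha> \<in> \<int>" "0 \<le> \<lfloor>w \<alpha>\<rfloor> + int N" "w \<beta> \<in> \<int>" "0 \<le> \<lfloor>w \<beta>\<rfloor> + int M"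
      using x y by (auto simp: weight_admissible_def)
    then have fl: "\<lfloor>w (\<alpha> + \<beta>)\<rfloor> = \<lfloor>w \<alpha>\<rfloor> + \<lfloor>w \<beta>\<rfloor>" "w (\<alpha> + \<beta>) \<in> \<int>"
      by (auto simp: w elim!: Ints_cases)
    have fC: "f p \<in> C (\<alpha> + \<beta>)"
      using C_mult component_spec(1)[OF D(1)] component_spec(1)[OF D(2)] by (simp add: f_def p)
    have e: "nat (\<lfloor>w \<alpha>\<rfloor> + \<lfloor>w \<beta>\<rfloor> + int (N + M)) = nat (\<lfloor>w \<alpha>\<rfloor> + int N) + nat (\<lfloor>w \<beta>\<rfloor> + int M)"
      using wx by simp
    show ?thesis
    proof
      show "weight_admissible w (N + M) (f p)"
        using wx fl by (intro weight_poly_homogeneous(2)[OF fC]) auto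
      show "weight_poly w (N + M) (f p) =
      monom (component x (fst p)) (nat (\<lfloor>w (fst p)\<rfloor> + int N)) *
      monom (component y (snd p)) (nat (\<lfloor>w (snd p)\<rfloor> + int M))"
        unfolding weight_poly_homogeneous(1)[OF fC] fl e by (simp add: f_def p mult_monom)
    qed
  qed
  show "weight_admissible w (N + M) (x * y)"
    unfolding xy using weight_poly_sum[of I w "N + M" f] f by blast
  have "weight_poly w (N + M) (x * y) = (\<Sum>p\<in>I. weight_poly w (N + M) (f p))"
    unfolding xy using weight_poly_sum[of I w "N + M" f] f by blast
  also have "\<dots> = (\<Sum>p\<in>I. monom (component x (fst p)) (nat (\<lfloor>w (fst p)\<rfloor> + int N)) *
      monom (component y (snd p)) (nat (\<lfloor>w (snd p)\<rfloor> + int M)))"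
    using f by (intro sum.cong) auto
  also have "\<dots> = weight_poly w N x * weight_poly w M y"
    unfolding weight_poly_def sum_product sum.cartesian_product I_def by (simp add: case_prod_beta)
  finally show "weight_poly w (N + M) (x * y) = weight_poly w N x * weight_poly w M y" .
qed

lemma weight_poly_one:
  assumes w: "\<And>a b. w (a + b) = w a + w b"
  shows "weight_admissible w N 1" "weight_poly w N 1 = monom 1 N"
  using weight_poly_homogeneous[OF C_one, where w = w and N = N] additive_0[OF w] by simp_all

lemma weight_poly_power:
  assumes w: "\<And>a b. w (a + b) = w a + w b" and x: "weight_admissible w N x"
  shows "weight_admissible w (N * k) (x ^ k) \<and> weight_poly w (N * k) (x ^ k) = weight_poly w N x ^ k"
proof (induction k)
  case 0
  show ?case using weight_poly_one[OF w, of 0] by simp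
next
  case (Suc k)
  then show ?case using weight_poly_mult[OF w x, of "N * k" "x ^ k"] by simp
qed

lemma poly_weight_poly_1: "x \<in> D \<Longrightarrow> poly (weight_poly w N x) 1 = x"
  using component_spec(3)[of x] by (simp add: weight_poly_def poly_sum poly_monom)

lemma weight_poly_over:
  assumes "subring_closed T" "graded_set T" "x \<in> T"
  shows "weight_poly w N x \<in> polys_over T"
  unfolding weight_poly_def using graded_setD(2)[OF assms(2,3)] subring_closedD(2)[OF assms(1)]
  by (intro subring_closed_sum[OF subring_closed_polys_over[OF assms(1)]] polys_over_monom)

lemma coeff_weight_poly:
  assumes x: "weight_admissible w N x" and inj: "inj_on w (support x)" and \<alpha>: "\<alpha> \<in> support x"
  shows "coeff (weight_poly w N x) (nat (\<lfloor>w \<alpha>\<rfloor> + int N)) = component x \<alpha>"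
proof -
  have D: "x \<in> D" using x by (simp add: weight_admissible_def)
  have e: "nat (\<lfloor>w \<beta>\<rfloor> + int N) = nat (\<lfloor>w \<alpha>\<rfloor> + int N) \<longleftrightarrow> \<beta> = \<alpha>" if "\<beta> \<in> support x" for \<beta>
  proof
    assume "nat (\<lfloor>w \<beta>\<rfloor> + int N) = nat (\<lfloor>w \<alpha>\<rfloor> + int N)"
    moreover have "w \<alpha> \<in> \<int>" "0 \<le> \<lfloor>w \<alpha>\<rfloor> + int N" "w \<beta> \<in> \<int>" "0 \<le> \<lfloor>w \<beta>\<rfloor> + int N"
      using x \<alpha> that by (auto simp: weight_admissible_def)
    ultimately have "w \<beta> = w \<alpha>" by (auto elim!: Ints_cases)
    then show "\<beta> = \<alpha>" using inj \<alpha> that by (auto simp: inj_on_def)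
  qed simp
  have "coeff (weight_poly w N x) (nat (\<lfloor>w \<alpha>\<rfloor> + int N))
      = (\<Sum>\<beta>\<in>support x. if \<beta> = \<alpha> then component x \<beta> else 0)"
    unfolding weight_poly_def coeff_sum by (rule sum.cong) (simp_all add: e)
  also have "\<dots> = component x \<alpha>" using component_spec(2)[OF D] \<alpha> by simp
  finally show ?thesis .
qed

text \<open>The integral equation of \<open>f / g\<close>, cleared of denominators, is a polynomial identity in \<open>f\<close>, \<open>g\<close> and elements of
\<open>R\<close>, so it carries over to the weight polynomials, where \<open>integral_quotient\<close> applies.\<close>

lemma integral_weight_quotient:
  assumes f: "f \<in> R" and g: "g \<in> R" "g \<noteq> 0" and int: "f / g \<in> integral_closure_in_field R"
  obtains w :: "'g \<Rightarrow> rat" and N h where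
    "\<And>a b. w (a + b) = w a + w b" "inj_on w (support f \<union> support g)"
    "weight_admissible w N f" "weight_admissible w N g"
    "h \<in> polys_over (integral_closure_in_field R)"
    "monom 1 N * weight_poly w N f = weight_poly w N g * h"
proof -
  note RD = graded_setD[OF graded_R]
  obtain p where p: "p \<in> polys_over R" "lead_coeff p = 1" "poly p (f / g) = 0"
    using int unfolding integral_iff by blast
  define n where "n = degree p"
  define a where "a i = coeff p i" for i
  have aR: "a i \<in> R" for i using p(1) by (simp add: a_def polys_over_def)
  define F where "F = support f \<union> support g \<union> (\<Union>i\<le>n. support (a i))"
  have F: "finite F" using component_spec(2) RD(1) f g aR by (simp add: F_def)
  obtain w :: "'g \<Rightarrow> rat" where w: "\<And>a b. w (a + b) = w a + w b" and inj: "inj_on w F" and wF: "w ` F \<subseteq> \<int>"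
    using injective_integral_weight[OF F] by blast
  define N where "N = nat (\<Sum>\<alpha>\<in>F. \<bar>\<lfloor>w \<alpha>\<rfloor>\<bar>)"
  have N: "0 \<le> \<lfloor>w \<alpha>\<rfloor> + int N" if "\<alpha> \<in> F" for \<alpha>
    using member_le_sum[OF that, of "\<lambda>\<alpha>. \<bar>\<lfloor>w \<alpha>\<rfloor>\<bar>"] F by (simp add: N_def sum_nonneg)
  have adm: "weight_admissible w N x" if "x \<in> R" "support x \<subseteq> F" for x
    unfolding weight_admissible_def using that RD(1) N wF by blast
  have adm_f: "weight_admissible w N f" and adm_g: "weight_admissible w N g"
    and adm_a: "\<And>i. i \<le> n \<Longrightarrow> weight_admissible w N (a i)"
    using f g aR by (auto intro!: adm simp: F_def)
  define \<Phi> where "\<Phi> = weight_poly w N"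
  \<comment> \<open>Every term of the cleared equation has \<open>n + 1\<close> factors, so a common shift works for all of them.\<close>
  have summand: "weight_admissible w (N + N * n) (a i * f ^ i * g ^ (n - i)) \<and>
      weight_poly w (N + N * n) (a i * f ^ i * g ^ (n - i)) = \<Phi> (a i) * \<Phi> f ^ i * \<Phi> g ^ (n - i)"
    if "i \<le> n" for i
  proof -
    have "N + N * n = (N + N * i) + N * (n - i)" using that by (simp flip: distrib_left)
    then show ?thesis
      using weight_poly_mult[OF w, of N "a i" "N * i" "f ^ i"] adm_a[OF that]
        weight_poly_power[OF w adm_f, of i] weight_poly_power[OF w adm_g, of "n - i"]
        weight_poly_mult[OF w, of "N + N * i" "a i * f ^ i" "N * (n - i)" "g ^ (n - i)"]
      by (simp add: \<Phi>_def add.assoc)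
  qed
  have "(\<Sum>i\<le>n. a i * f ^ i * g ^ (n - i)) = g ^ n * poly p (f / g)"
    unfolding poly_altdef sum_distrib_left n_def[symmetric]
  proof (rule sum.cong)
    fix i assume "i \<in> {..n}"
    then have "g ^ n = g ^ i * g ^ (n - i)" by (simp flip: power_add)
    then show "a i * f ^ i * g ^ (n - i) = g ^ n * (coeff p i * (f / g) ^ i)"
      using g by (simp add: a_def power_divide)
  qed simp
  then have "(\<Sum>i\<le>n. \<Phi> (a i) * \<Phi> f ^ i * \<Phi> g ^ (n - i)) = 0"
    using weight_poly_sum[of "{..n}" w "N + N * n" "\<lambda>i. a i * f ^ i * g ^ (n - i)"] summand p(3)
    by (simp add: weight_poly_zero)
  moreover have "\<Phi> (a n) = monom 1 N"
    using weight_poly_one(2)[OF w] p(2) by (simp add: \<Phi>_def a_def n_def)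
  moreover have "\<Phi> g \<noteq> 0"
    using poly_weight_poly_1[of g w N] RD(1)[OF g(1)] g(2) by (auto simp: \<Phi>_def)
  moreover have "\<Phi> (a i) \<in> polys_over R" for i
    unfolding \<Phi>_def by (rule weight_poly_over[OF R_subring graded_R aR])
  ultimately obtain h where "h \<in> polys_over (integral_closure_in_field R)"
    "monom 1 N * \<Phi> f = \<Phi> g * h"
    using integral_quotient[OF R_subring, where n = n and A = "\<lambda>i. \<Phi> (a i)" and F = "\<Phi> f" and G = "\<Phi> g" and N = N]
    by auto
  moreover have "inj_on w (support f \<union> support g)"
    by (rule inj_on_subset[OF inj]) (auto simp: F_def)
  ultimately show ?thesis using that w adm_f adm_g by (auto simp: \<Phi>_def)
qed

text \<open>Since \<open>w\<close> is injective on the support of \<open>g\<close>, the leading coefficient of the weight polynomial of \<open>g\<close> is a single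
component of \<open>g\<close>, hence invertible in \<open>D\<close>. So \<open>h\<close> has coefficients in \<open>D\<close>, and \<open>f / g = h(1)\<close>.\<close>

lemma integral_in_D:
  assumes "x \<in> integral_closure_in_field R"
  shows "x \<in> D"
proof -
  note RD = graded_setD[OF graded_R]
  obtain f g where fg: "f \<in> R" "g \<in> R" "g \<noteq> 0" "x = f / g" using R_fraction by blast
  then have int: "f / g \<in> integral_closure_in_field R" using assms by simp
  obtain w N h where w: "\<And>a b. w (a + b) = w a + (w b :: rat)" and inj: "inj_on w (support f \<union> support g)"
    and adm: "weight_admissible w N f" "weight_admissible w N g"
    and h: "monom 1 N * weight_poly w N f = weight_poly w N g * h"
    using integral_weight_quotient[OF fg(1-3) int] by metis
  note DD = subring_closed_D
  have gD: "graded_set D" using component_homogeneous(1)[OF component_spec(1)] by (auto simp: graded_set_def)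
  have g0: "weight_poly w N g \<noteq> 0"
    using poly_weight_poly_1[of g w N] RD(1)[OF fg(2)] fg(3) by auto
  have "\<exists>\<alpha>\<in>support g. degree (weight_poly w N g) = nat (\<lfloor>w \<alpha>\<rfloor> + int N)"
  proof (rule ccontr)
    assume "\<not> ?thesis"
    then have "lead_coeff (weight_poly w N g) = 0"
      unfolding weight_poly_def[of w N g] coeff_sum by (intro sum.neutral) (auto simp: weight_poly_def)
    then show False using g0 by simp
  qed
  then obtain \<alpha> where \<alpha>: "\<alpha> \<in> support g" "degree (weight_poly w N g) = nat (\<lfloor>w \<alpha>\<rfloor> + int N)" by blast
  then have "lead_coeff (weight_poly w N g) = component g \<alpha>"
    using coeff_weight_poly[OF adm(2) inj_on_subset[OF inj] \<alpha>(1)] by simp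
  then have "inverse (lead_coeff (weight_poly w N g)) \<in> D"
    using component_homogeneous(1)[OF C_inverse[OF component_spec(1)[OF RD(1)[OF fg(2)]]]] by simp
  moreover have "weight_poly w N g * h \<in> polys_over D"
    unfolding h[symmetric] using RD(1)[OF fg(1)] subring_closedD(1,2)[OF DD]
    by (intro subring_closedD(4)[OF subring_closed_polys_over[OF DD]] polys_over_monom
        weight_poly_over[OF DD gD])
  ultimately have "h \<in> polys_over D"
    by (rule quotient_over_subring[OF DD weight_poly_over[OF DD gD RD(1)[OF fg(2)]] g0])
  then have "poly h 1 \<in> D" using poly_in_subring[OF DD] subring_closedD(1)[OF DD] by blast
  moreover have "poly (monom 1 N * weight_poly w N f) 1 = poly (weight_poly w N g * h) 1"
    by (simp only: h)
  then have "f = g * poly h 1"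
    using poly_weight_poly_1 RD(1) fg(1,2) by (simp add: poly_monom)
  then have "poly h 1 = x" using fg(3,4) by simp
  ultimately show ?thesis by simp
qed

text \<open>For a fraction with homogeneous denominator \<open>g\<close> the weight polynomial of \<open>g\<close> is a monomial, and the coefficients
of \<open>h\<close>, known to be integral, are the components of the fraction.\<close>

lemma graded_integral_closure: "graded_set (integral_closure_in_field R)"
  unfolding graded_set_def
proof (intro conjI ballI allI)
  show "integral_closure_in_field R \<subseteq> D" using integral_in_D by blast
  fix x \<alpha> assume x: "x \<in> integral_closure_in_field R"
  then have xD: "x \<in> D" by (rule integral_in_D)
  obtain f g \<beta> where fg: "f \<in> R" "g \<in> R" "g \<in> C \<beta>" "g \<noteq> 0" "x = f / g"
    using D_fraction[OF xD] .
  then have int: "f / g \<in> integral_closure_in_field R" using x by simp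
  obtain w N h where w: "\<And>a b. w (a + b) = w a + (w b :: rat)" and inj: "inj_on w (support f \<union> support g)"
    and adm: "weight_admissible w N f" "weight_admissible w N g"
    and h: "h \<in> polys_over (integral_closure_in_field R)"
      "monom 1 N * weight_poly w N f = weight_poly w N g * h"
    using integral_weight_quotient[OF fg(1,2,4) int] by metis
  show "component x \<alpha> \<in> integral_closure_in_field R"
  proof (cases "component x \<alpha> = 0")
    case True
    then show ?thesis using subring_closedD(2)[OF subring_closed_integral_closure[OF R_subring]] by simp
  next
    case False
    have "f = x * g" using fg by simp
    then have cf: "component f (\<alpha> + \<beta>) = component x \<alpha> * g"
      using component_mult_homogeneous(2)[OF xD fg(3)] by simp
    then have sf: "\<alpha> + \<beta> \<in> support f" using False fg by (simp add: support_def)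
    define k where "k = nat (\<lfloor>w \<beta>\<rfloor> + int N)"
    define m where "m = N + nat (\<lfloor>w (\<alpha> + \<beta>)\<rfloor> + int N)"
    have "coeff (monom 1 N * weight_poly w N f) m = component x \<alpha> * g"
      using coeff_weight_poly[OF adm(1) inj_on_subset[OF inj] sf] cf by (simp add: m_def coeff_monom_mult)
    moreover have "coeff (weight_poly w N g * h) m
        = (if k \<le> m then g * coeff h (m - k) else 0)"
      unfolding weight_poly_homogeneous(1)[OF fg(3)] k_def[symmetric] by (simp add: coeff_monom_mult)
    ultimately have "component x \<alpha> = coeff h (m - k)"
      using h(2) False fg(4) by (auto split: if_splits)
    then show ?thesis using polys_over_coeff[OF h(1)] by simp
  qed
qed

end

section \<open>The predicates of the statement in terms of subsets of the field\<close>

lemma ring_on_simps: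
  "carrier (ring_on T) = T" "x \<otimes>\<^bsub>ring_on T\<^esub> y = x * y" "\<one>\<^bsub>ring_on T\<^esub> = 1"
  "x \<oplus>\<^bsub>ring_on T\<^esub> y = x + y" "\<zero>\<^bsub>ring_on T\<^esub> = 0"
  "x \<otimes>\<^bsub>ring_of_type_algebra\<^esub> y = x * y" "x \<oplus>\<^bsub>ring_of_type_algebra\<^esub> y = x + y"
  "\<one>\<^bsub>ring_of_type_algebra\<^esub> = 1" "\<zero>\<^bsub>ring_of_type_algebra\<^esub> = 0"
  by (simp_all add: ring_of_type_algebra_def)

lemma ring_on_UNIV: "ring_on UNIV = ring_of_type_algebra"
  by (simp add: ring_of_type_algebra_def)

lemma cring_ring_on:
  assumes T: "subring_closed T"
  shows "cring (ring_on T)"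
proof (rule cringI)
  note T' = subring_closedD[OF T]
  show "abelian_group (ring_on T)"
    by (rule abelian_groupI; simp add: ring_on_simps T' add.assoc add.commute)
      (metis T'(5) add.right_inverse)
  show "Group.comm_monoid (ring_on T)"
    by (rule comm_monoidI; simp add: ring_on_simps T' mult.assoc mult.commute)
qed (simp add: ring_on_simps distrib_right)

lemma uminus_ring_on:
  assumes "subring_closed T" "x \<in> T"
  shows "\<ominus>\<^bsub>ring_on T\<^esub> x = - x"
proof -
  interpret cring "ring_on T" by (rule cring_ring_on[OF assms(1)])
  show ?thesis
    using minus_equality[of "- x" x] assms subring_closedD(5)[OF assms(1)] by (simp add: ring_on_simps)
qed

lemma additive_subgroup_ring_on:
  assumes T: "subring_closed T"
  shows "additive_subgroup I (ring_on T) \<longleftrightarrow>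
    I \<subseteq> T \<and> 0 \<in> I \<and> (\<forall>x\<in>I. \<forall>y\<in>I. x + y \<in> I) \<and> (\<forall>x\<in>I. - x \<in> I)" (is "?l \<longleftrightarrow> ?r")
proof
  interpret cring "ring_on T" by (rule cring_ring_on[OF T])
  assume ?l
  then interpret additive_subgroup I "ring_on T" .
  have sub: "I \<subseteq> T" using a_subset by (simp add: ring_on_simps)
  have "- x \<in> I" if "x \<in> I" for x
  proof -
    have "\<ominus>\<^bsub>ring_on T\<^esub> x = - x" using that sub by (intro uminus_ring_on[OF T]) blast
    with a_inv_closed[OF that] show ?thesis by (simp only:)
  qed
  moreover have "0 \<in> I" using zero_closed by (simp add: ring_on_simps)
  moreover have "x + y \<in> I" if "x \<in> I" "y \<in> I" for x y
    using a_closed[OF that] by (simp add: ring_on_simps)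
  ultimately show ?r using sub by blast
next
  interpret cring "ring_on T" by (rule cring_ring_on[OF T])
  assume r: ?r
  show ?l
    unfolding additive_subgroup_def
  proof (rule group.subgroupI[OF a_group])
    fix a b
    assume a: "a \<in> I"
    then have "\<ominus>\<^bsub>ring_on T\<^esub> a \<in> I" using r uminus_ring_on[OF T, of a] by auto
    then show "inv\<^bsub>add_monoid (ring_on T)\<^esub> a \<in> I" by (simp add: a_inv_def)
    assume "b \<in> I"
    then show "a \<otimes>\<^bsub>add_monoid (ring_on T)\<^esub> b \<in> I" using r a by (simp add: ring_on_simps)
  qed (use r in \<open>auto simp: ring_on_simps\<close>)
qed

lemma subring_iff: "subring T ring_of_type_algebra \<longleftrightarrow> subring_closed T"
proof
  interpret cring "ring_on UNIV :: 'a ring"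
    by (rule cring_ring_on) (simp add: subring_closed_def)
  have neg: "\<ominus>\<^bsub>ring_on UNIV\<^esub> x = - x" for x :: 'a
    by (rule uminus_ring_on) (simp_all add: subring_closed_def)
  {
    assume "subring T ring_of_type_algebra"
    then have T: "subring T (ring_on UNIV)" by (simp only: ring_on_UNIV)
    have "x - y \<in> T" if "x \<in> T" "y \<in> T" for x y
      using subringE(7)[OF T that(1) subringE(5)[OF T that(2)]] by (simp add: neg ring_on_simps)
    then show "subring_closed T"
      using subringE(3,6)[OF T] by (auto simp: subring_closed_def ring_on_simps)
  }
  {
    assume T: "subring_closed T"
    have "subring T (ring_on UNIV)"
      by (rule subringI) (use subring_closedD[OF T] in \<open>auto simp: neg ring_on_simps\<close>)
    then show "subring T ring_of_type_algebra" by (simp only: ring_on_UNIV)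
  }
qed

lemma ideal_ring_on:
  assumes T: "subring_closed T"
  shows "ideal I (ring_on T) \<longleftrightarrow> ideal_of T I"
proof
  interpret cring "ring_on T" by (rule cring_ring_on[OF T])
  {
    assume "ideal I (ring_on T)"
    then interpret ideal I "ring_on T" .
    have "additive_subgroup I (ring_on T)" ..
    then show "ideal_of T I"
      using I_l_closed by (auto simp: ideal_of_def additive_subgroup_ring_on[OF T] ring_on_simps)
  }
  {
    assume I: "ideal_of T I"
    have "additive_subgroup I (ring_on T)"
      using I ideal_of_uminus[OF I T] by (auto simp: ideal_of_def additive_subgroup_ring_on[OF T])
    then have "subgroup I (add_monoid (ring_on T))" by (simp add: additive_subgroup_def)
    moreover have "ring (ring_on T)" ..
    moreover have "x * t \<in> I" if "t \<in> T" "x \<in> I" for t x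
      using ideal_ofD(4)[OF I that] by (simp add: mult.commute)
    ultimately show "ideal I (ring_on T)"
      using ideal_ofD(4)[OF I] by (intro idealI) (auto simp: ring_on_simps)
  }
qed

lemma primeideal_ring_on:
  assumes T: "subring_closed T"
  shows "primeideal P (ring_on T) \<longleftrightarrow> prime_of T P"
proof
  assume "primeideal P (ring_on T)"
  then interpret primeideal P "ring_on T" .
  have "ideal P (ring_on T)" ..
  then have P: "ideal_of T P" by (simp add: ideal_ring_on[OF T])
  have "1 \<notin> P"
  proof
    assume "1 \<in> P"
    then have "P = T" using ideal_ofD(1,4)[OF P] by fastforce
    then show False using I_notcarr by (simp add: ring_on_simps)
  qed
  then show "prime_of T P" using P I_prime by (auto simp: prime_of_def ring_on_simps)
next
  assume P: "prime_of T P"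
  have "T \<noteq> P" using prime_ofD(2)[OF P] subring_closedD(1)[OF T] by blast
  then show "primeideal P (ring_on T)"
    using prime_ofD[OF P] ideal_ring_on[OF T] cring_ring_on[OF T]
    by (intro primeidealI) (auto simp: ring_on_simps)
qed

lemma genideal_ring_on:
  assumes T: "subring_closed T" and S: "S \<subseteq> T"
  shows "ideal_of T (Idl\<^bsub>ring_on T\<^esub> S)" "S \<subseteq> Idl\<^bsub>ring_on T\<^esub> S"
    "ideal_of T J \<Longrightarrow> S \<subseteq> J \<Longrightarrow> Idl\<^bsub>ring_on T\<^esub> S \<subseteq> J"
proof -
  interpret cring "ring_on T" by (rule cring_ring_on[OF T])
  have S': "S \<subseteq> carrier (ring_on T)" using S by (simp add: ring_on_simps)
  show "ideal_of T (Idl\<^bsub>ring_on T\<^esub> S)" using genideal_ideal[OF S'] by (simp add: ideal_ring_on[OF T])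
  show "S \<subseteq> Idl\<^bsub>ring_on T\<^esub> S" by (rule genideal_self[OF S'])
  show "ideal_of T J \<Longrightarrow> S \<subseteq> J \<Longrightarrow> Idl\<^bsub>ring_on T\<^esub> S \<subseteq> J"
    by (rule genideal_minimal) (simp add: ideal_ring_on[OF T])
qed

lemma ideal_prod_inverse:
  assumes T: "subring_closed T" and I: "ideal_of T I"
  shows "ideal_of T (ideal_prod ring_of_type_algebra I (ideal_inverse T I))"
proof -
  let ?J = "ideal_prod ring_of_type_algebra I (ideal_inverse T I)"
  have sub: "z \<in> T" if "z \<in> ?J" for z
    using that
  proof induction
    case (prod i j)
    then show ?case by (simp add: ideal_inverse_def ring_of_type_algebra_def mult.commute)
  next
    case (sum s t)
    then show ?case using subring_closedD(6)[OF T] by (simp add: ring_of_type_algebra_def)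
  qed
  have "t * z \<in> ?J" if "z \<in> ?J" "t \<in> T" for z t
    using that(1)
  proof induction
    case (prod i j)
    then have "(t * i) * j \<in> ?J"
      using ideal_prod.prod[of "t * i" I j _ ring_of_type_algebra] ideal_ofD(4)[OF I that(2)]
      by (simp add: ring_of_type_algebra_def)
    then show ?case by (simp add: ring_of_type_algebra_def mult.assoc)
  next
    case (sum s s')
    then show ?case
      using ideal_prod.sum[of "t * s" ring_of_type_algebra I _ "t * s'"]
      by (simp add: ring_of_type_algebra_def distrib_left)
  qed
  moreover have "0 \<in> ?J"
    using ideal_prod.prod[of 0 I 0 "ideal_inverse T I" ring_of_type_algebra] ideal_ofD(2)[OF I]
      subring_closedD(2)[OF T] by (simp add: ring_of_type_algebra_def ideal_inverse_def)
  moreover have "x + y \<in> ?J" if "x \<in> ?J" "y \<in> ?J" for x y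
    using ideal_prod.sum[OF that] by (simp add: ring_of_type_algebra_def)
  ultimately show ?thesis using sub by (auto simp: ideal_of_def)
qed

lemma invertible_ideal_iff:
  assumes T: "subring_closed T" and I: "ideal_of T I"
  shows "invertible_ideal T I \<longleftrightarrow> 1 \<in> ideal_prod ring_of_type_algebra I (ideal_inverse T I)"
proof -
  note J = ideal_prod_inverse[OF T I]
  show ?thesis
    unfolding invertible_ideal_def using ideal_ofD(1,4)[OF J] subring_closedD(1)[OF T] by fastforce
qed

text \<open>Gauss's lemma: the product of the first coefficients outside \<open>P\<close> is, modulo \<open>P\<close>, a coefficient of the product.\<close>

lemma prime_of_polys_over:
  assumes S: "subring_closed S" and P: "prime_of S P"
    and q: "q \<in> polys_over S" and r: "r \<in> polys_over S" and qr: "q * r \<in> polys_over P"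
  shows "q \<in> polys_over P \<or> r \<in> polys_over P"
proof (rule ccontr)
  note PI = prime_ofD(1)[OF P]
  assume "\<not> ?thesis"
  then have ex: "\<exists>i. coeff q i \<notin> P" "\<exists>j. coeff r j \<notin> P"
    by (auto simp: polys_over_def)
  define i where "i = (LEAST i. coeff q i \<notin> P)"
  define j where "j = (LEAST j. coeff r j \<notin> P)"
  have i: "coeff q i \<notin> P" "\<And>k. k < i \<Longrightarrow> coeff q k \<in> P"
    unfolding i_def using LeastI_ex[OF ex(1)] not_less_Least by blast+
  have j: "coeff r j \<notin> P" "\<And>k. k < j \<Longrightarrow> coeff r k \<in> P"
    unfolding j_def using LeastI_ex[OF ex(2)] not_less_Least by blast+
  have other: "coeff q k * coeff r (i + j - k) \<in> P" if "k \<noteq> i" "k \<le> i + j" for k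
  proof (cases "k < i")
    case True
    have "coeff r (i + j - k) * coeff q k \<in> P"
      using i(2)[OF True] r by (intro ideal_ofD(4)[OF PI]) (auto simp: polys_over_def)
    then show ?thesis by (simp add: mult.commute)
  next
    case False
    then have "i + j - k < j" using that by simp
    then show ?thesis using j(2) q by (intro ideal_ofD(4)[OF PI]) (auto simp: polys_over_def)
  qed
  have "coeff (q * r) (i + j) = coeff q i * coeff r j
      + (\<Sum>k\<in>{..i + j} - {i}. coeff q k * coeff r (i + j - k))"
    unfolding coeff_mult by (subst sum.remove[of _ i]) auto
  then have eq: "coeff q i * coeff r j = coeff (q * r) (i + j)
      - (\<Sum>k\<in>{..i + j} - {i}. coeff q k * coeff r (i + j - k))" by simp
  have "coeff q i * coeff r j \<in> P"
    unfolding eq using qr other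
    by (intro ideal_of_diff[OF PI S] ideal_of_sum[OF PI]) (auto simp: polys_over_def)
  then show False
    using prime_ofD(3)[OF P polys_over_coeff[OF q] polys_over_coeff[OF r]] i(1) j(1) by blast
qed

context graded_in_field
begin

lemma homogeneous_ideal_iff:
  assumes T: "subring_closed T" "graded_set T"
  shows "homogeneous_ideal (\<lambda>\<alpha>. T \<inter> C \<alpha>) T I \<longleftrightarrow> ideal_of T I \<and> graded_set I"
proof (intro iffI conjI)
  assume "homogeneous_ideal (\<lambda>\<alpha>. T \<inter> C \<alpha>) T I"
  then obtain S where S: "S \<subseteq> (\<Union>\<alpha>. T \<inter> C \<alpha>) - {0}" "I = Idl\<^bsub>ring_on T\<^esub> S"
    by (auto simp: homogeneous_ideal_def homogeneous_elements_def)
  then have "S \<subseteq> T" by blast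
  note gen = genideal_ring_on[OF T(1) this, folded S(2)]
  show I: "ideal_of T I" by (rule gen(1))
  note core = graded_core_ideal[OF T I]
  have "S \<subseteq> graded_core T I"
    using S gen(2) ideal_ofD(2)[OF I] by (auto intro: graded_core_homogeneous)
  then have "I = graded_core T I" using gen(3)[OF core(1)] core(3) by blast
  then show "graded_set I" using core(2) by simp
next
  assume I: "ideal_of T I \<and> graded_set I"
  define S where "S = (\<Union>\<alpha>. I \<inter> C \<alpha>) - {0}"
  have "S \<subseteq> T" using I by (auto simp: S_def ideal_of_def)
  note gen = genideal_ring_on[OF T(1) this]
  have "I \<subseteq> Idl\<^bsub>ring_on T\<^esub> S"
  proof
    fix x assume x: "x \<in> I"
    then have "x \<in> D" using I graded_setD by blast
    have "(\<Sum>\<alpha>\<in>support x. component x \<alpha>) \<in> Idl\<^bsub>ring_on T\<^esub> S"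
    proof (rule ideal_of_sum[OF gen(1)])
      fix \<alpha> assume "\<alpha> \<in> support x"
      then have "component x \<alpha> \<in> S"
        using I x graded_setD(2) component_spec(1)[OF \<open>x \<in> D\<close>] unfolding S_def support_def by blast
      then show "component x \<alpha> \<in> Idl\<^bsub>ring_on T\<^esub> S" using gen(2) by blast
    qed
    then show "x \<in> Idl\<^bsub>ring_on T\<^esub> S" using component_spec(3)[OF \<open>x \<in> D\<close>] by simp
  qed
  moreover have "Idl\<^bsub>ring_on T\<^esub> S \<subseteq> I" using I by (intro gen(3)) (auto simp: S_def)
  moreover have "S \<subseteq> homogeneous_elements (\<lambda>\<alpha>. T \<inter> C \<alpha>)"
    using I by (auto simp: S_def homogeneous_elements_def ideal_of_def)
  ultimately show "homogeneous_ideal (\<lambda>\<alpha>. T \<inter> C \<alpha>) T I"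
    unfolding homogeneous_ideal_def by blast
qed

lemma gr_i_extension_iff:
  assumes T: "subring_closed T" "graded_set T"
  shows "gr_i_extension R0 (\<lambda>\<alpha>. T \<inter> C \<alpha>) T \<longleftrightarrow>
    (\<forall>Q1 Q2. prime_of T Q1 \<and> graded_set Q1 \<and> prime_of T Q2 \<and> graded_set Q2 \<and> Q1 \<inter> R0 = Q2 \<inter> R0
      \<longrightarrow> Q1 = Q2)"
  unfolding gr_i_extension_def primeideal_ring_on[OF T(1)] homogeneous_ideal_iff[OF T]
  using prime_ofD(1) by blast

lemma internal_direct_sum_iff:
  assumes T: "subring_closed T"
  shows "internal_direct_sum (\<lambda>\<alpha>. T \<inter> C \<alpha>) T \<longleftrightarrow> graded_set T"
proof
  assume "internal_direct_sum (\<lambda>\<alpha>. T \<inter> C \<alpha>) T"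
  then have im: "(\<lambda>c. \<Sum>\<alpha> | c \<alpha> \<noteq> 0. c \<alpha>) ` {c. (\<forall>\<alpha>. c \<alpha> \<in> T \<inter> C \<alpha>) \<and> finite {\<alpha>. c \<alpha> \<noteq> 0}} = T"
    by (simp add: internal_direct_sum_def bij_betw_def)
  have "x \<in> D \<and> component x \<alpha> \<in> T" if "x \<in> T" for x \<alpha>
  proof -
    have "x \<in> (\<lambda>c. \<Sum>\<alpha> | c \<alpha> \<noteq> 0. c \<alpha>) ` {c. (\<forall>\<alpha>. c \<alpha> \<in> T \<inter> C \<alpha>) \<and> finite {\<alpha>. c \<alpha> \<noteq> 0}}"
      using that im by simp
    then obtain c where c: "\<And>\<alpha>. c \<alpha> \<in> T \<inter> C \<alpha>" "finite {\<alpha>. c \<alpha> \<noteq> 0}" "x = (\<Sum>\<alpha> | c \<alpha> \<noteq> 0. c \<alpha>)"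
      by blast
    then have "x \<in> D" "component x \<alpha> = c \<alpha>"
      using component_unique[OF _ c(2) _ c(3)] by blast+
    then show ?thesis using c(1) by simp
  qed
  then show "graded_set T" by (auto simp: graded_set_def)
next
  assume gr: "graded_set T"
  define F where "F = {c. (\<forall>\<alpha>. c \<alpha> \<in> T \<inter> C \<alpha>) \<and> finite {\<alpha>. c \<alpha> \<noteq> 0}}"
  have comp: "(\<Sum>\<alpha> | c \<alpha> \<noteq> 0. c \<alpha>) \<in> T \<and> component (\<Sum>\<alpha> | c \<alpha> \<noteq> 0. c \<alpha>) = c" if "c \<in> F" for c
  proof
    show "(\<Sum>\<alpha> | c \<alpha> \<noteq> 0. c \<alpha>) \<in> T" using that by (intro subring_closed_sum[OF T]) (auto simp: F_def)
    show "component (\<Sum>\<alpha> | c \<alpha> \<noteq> 0. c \<alpha>) = c"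
    proof
      fix \<alpha>
      show "component (\<Sum>\<alpha> | c \<alpha> \<noteq> 0. c \<alpha>) \<alpha> = c \<alpha>"
        using that by (intro component_unique(2)[OF _ _ _ refl]) (auto simp: F_def)
    qed
  qed
  have "inj_on (\<lambda>c. \<Sum>\<alpha> | c \<alpha> \<noteq> 0. c \<alpha>) F"
    by (rule inj_on_inverseI[of _ component]) (use comp in blast)
  moreover have "(\<lambda>c. \<Sum>\<alpha> | c \<alpha> \<noteq> 0. c \<alpha>) ` F = T"
  proof (intro equalityI subsetI)
    fix x assume "x \<in> (\<lambda>c. \<Sum>\<alpha> | c \<alpha> \<noteq> 0. c \<alpha>) ` F"
    then show "x \<in> T" using comp by blast
  next
    fix x assume x: "x \<in> T"
    then have xD: "x \<in> D" using gr graded_setD(1) by blast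
    have "component x \<in> F"
      using graded_setD(2)[OF gr x] component_spec(1,2)[OF xD] by (auto simp: F_def support_def)
    moreover have "x = (\<Sum>\<alpha> | component x \<alpha> \<noteq> 0. component x \<alpha>)"
      using component_spec(3)[OF xD] by (simp add: support_def)
    ultimately show "x \<in> (\<lambda>c. \<Sum>\<alpha> | c \<alpha> \<noteq> 0. c \<alpha>) ` F" by blast
  qed
  moreover have "additive_subgroup (T \<inter> C \<alpha>) ring_of_type_algebra" for \<alpha>
  proof -
    have "additive_subgroup (T \<inter> C \<alpha>) (ring_on UNIV)"
      using subring_closedD[OF T] C_zero C_add C_uminus
      by (subst additive_subgroup_ring_on) (auto simp: subring_closed_def)
    then show ?thesis by (simp only: ring_on_UNIV)
  qed
  ultimately show "internal_direct_sum (\<lambda>\<alpha>. T \<inter> C \<alpha>) T"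
    unfolding internal_direct_sum_def bij_betw_def F_def[symmetric] by blast
qed

lemma power_homogeneous: "u \<in> C \<delta> \<Longrightarrow> u ^ n \<in> C (int_multiple (int n) \<delta>)"
proof (induction n)
  case 0
  then show ?case by (simp add: C_one)
next
  case (Suc n)
  have "u ^ n * u \<in> C (int_multiple (int n) \<delta> + \<delta>)" using Suc by (intro C_mult)
  moreover have "int_multiple (int n) \<delta> + \<delta> = int_multiple (int (Suc n)) \<delta>"
    using int_multiple_Suc[of "int n" \<delta>] by (simp add: add.commute)
  ultimately show ?case by (simp add: mult.commute)
qed

lemma component_poly:
  assumes u: "u \<in> C \<delta>" and S: "graded_set S" and q: "q \<in> polys_over S"
  obtains q' where "poly q u \<in> D" "component (poly q u) \<gamma> = poly q' u"
    "\<And>i. coeff q' i = component (coeff q i) (\<gamma> - int_multiple (int i) \<delta>)"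
proof -
  note qD = graded_setD(1)[OF S polys_over_coeff[OF q]]
  define q' where "q' = (\<Sum>i\<le>degree q.
    monom (component (coeff q i) (\<gamma> - int_multiple (int i) \<delta>)) i)"
  have c: "coeff q' i = component (coeff q i) (\<gamma> - int_multiple (int i) \<delta>)" for i
    by (simp add: q'_def coeff_sum coeff_eq_0)
  have "poly q u \<in> D \<and> component (poly q u) \<gamma>
      = (\<Sum>i\<le>degree q. component (coeff q i * u ^ i) \<gamma>)"
    unfolding poly_altdef using component_mult_homogeneous(1)[OF qD power_homogeneous[OF u]]
    by (intro component_sum)
  moreover have "(\<Sum>i\<le>degree q. component (coeff q i * u ^ i) \<gamma>) = poly q' u"
    by (simp add: q'_def poly_sum poly_monom component_mult_homogeneous(2)[OF qD power_homogeneous[OF u]])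
  ultimately show ?thesis using c that by metis
qed

text \<open>In \<open>T = S[u]\<close> an element \<open>\<Sum> a\<^sub>i u ^ i\<close> determines the residue classes of its coefficients modulo \<open>P\<close>: a polynomial
vanishing at \<open>u\<close> with a coefficient outside \<open>P\<close> would make \<open>u\<close> comparable. So there is a map from \<open>T\<close> to the
polynomial ring over \<open>S / P\<close>. The primes \<open>Q1\<close> and \<open>Q2\<close> are the preimages of \<open>0\<close> and of the polynomials
without constant term, and only \<open>Q2\<close> contains \<open>u\<close>.\<close>

lemma two_primes_over:
  assumes S: "subring_closed S" "graded_set S" and closed: "integral_closure_in_field S \<subseteq> S"
    and P: "prime_of S P" "graded_set P" and u: "u \<in> C \<delta>" "u \<noteq> 0"
    and incomparable: "\<And>s. s \<in> S \<Longrightarrow> s \<notin> P \<Longrightarrow> s * u \<notin> S \<and> s / u \<notin> S"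
  obtains T Q1 Q2 where "subring_closed T" "graded_set T" "S \<subseteq> T"
    "prime_of T Q1" "graded_set Q1" "prime_of T Q2" "graded_set Q2" "Q1 \<inter> S = P" "Q2 \<inter> S = P" "Q1 \<noteq> Q2"
proof -
  note PI = prime_ofD(1)[OF P(1)] and PS = subring_closed_polys_over[OF S(1)]
  note S' = subring_closedD[OF S(1)]
  define ev where "ev q = poly q u" for q
  define Qs where "Qs = {q \<in> polys_over S. coeff q 0 \<in> P}"
  define T where "T = ev ` polys_over S"
  define Q1 where "Q1 = ev ` polys_over P"
  define Q2 where "Q2 = ev ` Qs"
  have PsubS: "polys_over P \<subseteq> polys_over S" using ideal_ofD(1)[OF PI] by (auto simp: polys_over_def)
  have QsubS: "Qs \<subseteq> polys_over S" by (auto simp: Qs_def)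
  have PQ: "polys_over P \<subseteq> Qs" using PsubS by (auto simp: Qs_def polys_over_def)
  \<comment> \<open>This is what makes the residue classes of the coefficients well defined.\<close>
  have kernel: "q \<in> polys_over P" if q: "q \<in> polys_over S" "ev q = 0" for q
  proof (rule ccontr)
    assume "q \<notin> polys_over P"
    then obtain i where i: "coeff q i \<notin> P" by (auto simp: polys_over_def)
    then have "i \<le> degree q" using ideal_ofD(2)[OF PI] by (metis coeff_eq_0 not_le)
    with i have "\<exists>s\<in>S - P. s * u \<in> S \<or> s / u \<in> S"
      using q(2) polys_over_coeff[OF q(1)] unfolding ev_def poly_altdef
      by (intro comparable_of_relation[OF S(1) closed P(1) u(2), of "degree q" "coeff q"]) auto
    then show False using incomparable by blast
  qed
  have addP: "p + q \<in> polys_over P" if "p \<in> polys_over P" "q \<in> polys_over P" for p q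
    using that ideal_ofD(3)[OF PI] by (simp add: polys_over_def)
  have multP: "p * q \<in> polys_over P" if "p \<in> polys_over S" "q \<in> polys_over P" for p q
  proof -
    have "coeff (p * q) i \<in> P" for i
      unfolding coeff_mult
      by (intro ideal_of_sum[OF PI] ideal_ofD(4)[OF PI] polys_over_coeff[OF that(1)] polys_over_coeff[OF that(2)])
    then show ?thesis by (simp add: polys_over_def)
  qed
  have addQ: "p + q \<in> Qs" if "p \<in> Qs" "q \<in> Qs" for p q
    using that ideal_ofD(3)[OF PI] subring_closedD(6)[OF PS] by (simp add: Qs_def)
  have multQ: "p * q \<in> Qs" if "p \<in> polys_over S" "q \<in> Qs" for p q
    using that ideal_ofD(4)[OF PI] subring_closedD(4)[OF PS] by (simp add: Qs_def coeff_mult polys_over_def)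
  have ev_hom: "ev (p + q) = ev p + ev q" "ev (p * q) = ev p * ev q" "ev (p - q) = ev p - ev q" for p q
    by (simp_all add: ev_def)
  have lift1: "q \<in> polys_over P" if "q \<in> polys_over S" "ev q \<in> Q1" for q
  proof -
    obtain r where r: "r \<in> polys_over P" "ev q = ev r" using \<open>ev q \<in> Q1\<close> by (auto simp: Q1_def)
    then have "q - r \<in> polys_over P"
      using that(1) PsubS by (intro kernel subring_closedD(3)[OF PS]) (auto simp: ev_hom)
    from addP[OF this r(1)] show ?thesis by simp
  qed
  have lift2: "q \<in> Qs" if "q \<in> polys_over S" "ev q \<in> Q2" for q
  proof -
    obtain r where r: "r \<in> Qs" "ev q = ev r" using \<open>ev q \<in> Q2\<close> by (auto simp: Q2_def)
    then have "q - r \<in> polys_over P"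
      using that(1) QsubS by (intro kernel subring_closedD(3)[OF PS]) (auto simp: ev_hom)
    then have "q - r \<in> Qs" using PQ by blast
    from addQ[OF this r(1)] show ?thesis by simp
  qed
  have const: "ev [:s:] = s" for s by (simp add: ev_def)
  have ST: "S \<subseteq> T"
  proof
    fix s assume "s \<in> S"
    then have "[:s:] \<in> polys_over S" by (rule polys_over_const[OF S'(2)])
    then show "s \<in> T" unfolding T_def using const[of s] by (metis imageI)
  qed
  have T: "subring_closed T"
    unfolding subring_closed_def
  proof (intro conjI ballI)
    show "1 \<in> T" using ST S'(1) by blast
    fix x y assume "x \<in> T" "y \<in> T"
    then obtain p q where "p \<in> polys_over S" "q \<in> polys_over S" "x = ev p" "y = ev q" by (auto simp: T_def)
    then show "x - y \<in> T" "x * y \<in> T"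
      unfolding T_def using subring_closedD(3,4)[OF PS, of p q] by (auto simp flip: ev_hom)
  qed
  have graded: "graded_set (ev ` V)"
    if V: "V \<subseteq> polys_over S" "\<And>q q' \<gamma>. q \<in> V \<Longrightarrow>
      (\<And>i. coeff q' i = component (coeff q i) (\<gamma> - int_multiple (int i) \<delta>)) \<Longrightarrow> q' \<in> V" for V
    unfolding graded_set_def
  proof (intro conjI ballI allI subsetI)
    fix x assume "x \<in> ev ` V"
    then obtain q where q: "q \<in> V" "x = poly q u" by (auto simp: ev_def)
    then show "x \<in> D" using component_poly[OF u(1) S(2), of q] V(1) by blast
    fix \<gamma>
    have "q \<in> polys_over S" using V(1) q(1) by blast
    then obtain q' where "component x \<gamma> = ev q'"
      "\<And>i. coeff q' i = component (coeff q i) (\<gamma> - int_multiple (int i) \<delta>)"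
      unfolding q(2) ev_def by (rule component_poly[OF u(1) S(2), where \<gamma> = \<gamma>]) blast
    then show "component x \<gamma> \<in> ev ` V" using V(2)[OF q(1)] by blast
  qed
  have "graded_set T"
    unfolding T_def by (rule graded) (auto simp: polys_over_def intro!: graded_setD(2)[OF S(2)])
  moreover have "graded_set Q1"
    unfolding Q1_def by (rule graded[OF PsubS]) (auto simp: polys_over_def intro!: graded_setD(2)[OF P(2)])
  moreover have "graded_set Q2"
    unfolding Q2_def by (rule graded[OF QsubS])
      (auto simp: Qs_def polys_over_def intro!: graded_setD(2)[OF P(2)] graded_setD(2)[OF S(2)])
  moreover have "Q1 \<inter> S = P"
  proof (intro equalityI subsetI)
    fix s assume "s \<in> Q1 \<inter> S"
    then have "[:s:] \<in> polys_over P"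
      using lift1[OF polys_over_const[OF S'(2)]] const by simp
    then show "s \<in> P" using polys_over_coeff[of "[:s:]" P 0] by simp
  next
    fix s assume s: "s \<in> P"
    then have "[:s:] \<in> polys_over P" by (rule polys_over_const[OF ideal_ofD(2)[OF PI]])
    then have "s \<in> Q1" unfolding Q1_def using const[of s] by (metis imageI)
    then show "s \<in> Q1 \<inter> S" using s ideal_ofD(1)[OF PI] by blast
  qed
  moreover have "Q2 \<inter> S = P"
  proof (intro equalityI subsetI)
    fix s assume "s \<in> Q2 \<inter> S"
    then have "[:s:] \<in> Qs" using lift2[OF polys_over_const[OF S'(2)]] const by simp
    then show "s \<in> P" by (simp add: Qs_def)
  next
    fix s assume s: "s \<in> P"
    then have "[:s:] \<in> Qs" using polys_over_const[OF ideal_ofD(2)[OF PI]] PQ by blast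
    then have "s \<in> Q2" unfolding Q2_def using const[of s] by (metis imageI)
    then show "s \<in> Q2 \<inter> S" using s ideal_ofD(1)[OF PI] by blast
  qed
  moreover have "Q1 \<noteq> Q2"
  proof
    assume eq: "Q1 = Q2"
    have "[:0, 1:] \<in> polys_over S" using S' by (simp add: polys_over_pCons) (simp add: polys_over_def)
    then have "[:0, 1:] \<in> Qs" using ideal_ofD(2)[OF PI] by (simp add: Qs_def)
    then have "ev [:0, 1:] \<in> Q1" unfolding eq Q2_def by blast
    then have "[:0, 1:] \<in> polys_over P" by (rule lift1[OF \<open>[:0, 1:] \<in> polys_over S\<close>])
    then show False using prime_ofD(2)[OF P(1)] polys_over_coeff[of "[:0, 1:]" P 1] by simp
  qed
  moreover have "prime_of T Q1"
    unfolding prime_of_def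
  proof (intro conjI ballI impI)
    show "ideal_of T Q1"
      unfolding ideal_of_def
    proof (intro conjI ballI)
      show "Q1 \<subseteq> T" using PsubS by (auto simp: Q1_def T_def)
      have "ev 0 = 0" "0 \<in> polys_over P" using ideal_ofD(2)[OF PI] by (simp_all add: ev_def polys_over_def)
      then show "0 \<in> Q1" unfolding Q1_def by (metis imageI)
    next
      fix x y assume "x \<in> Q1" "y \<in> Q1"
      then show "x + y \<in> Q1" unfolding Q1_def using addP by (auto simp flip: ev_hom)
    next
      fix t x assume "t \<in> T" "x \<in> Q1"
      then show "t * x \<in> Q1" unfolding Q1_def T_def using multP by (auto simp flip: ev_hom)
    qed
    show "1 \<notin> Q1" using \<open>Q1 \<inter> S = P\<close> prime_ofD(2)[OF P(1)] S'(1) by blast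
  next
    fix x y assume "x \<in> T" "y \<in> T" and xy: "x * y \<in> Q1"
    then obtain p q where pq: "p \<in> polys_over S" "q \<in> polys_over S" "x = ev p" "y = ev q" by (auto simp: T_def)
    then have "p * q \<in> polys_over P"
      using xy by (intro lift1 subring_closedD(4)[OF PS]) (auto simp: ev_hom)
    from prime_of_polys_over[OF S(1) P(1) pq(1,2) this]
    show "x \<in> Q1 \<or> y \<in> Q1" using pq(3,4) by (auto simp: Q1_def)
  qed
  moreover have "prime_of T Q2"
    unfolding prime_of_def
  proof (intro conjI ballI impI)
    show "ideal_of T Q2"
      unfolding ideal_of_def
    proof (intro conjI ballI)
      show "Q2 \<subseteq> T" using QsubS by (auto simp: Q2_def T_def)
      have "ev 0 = 0" "0 \<in> Qs" using ideal_ofD(2)[OF PI] S'(2) by (simp_all add: ev_def polys_over_def Qs_def)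
      then show "0 \<in> Q2" unfolding Q2_def by (metis imageI)
    next
      fix x y assume "x \<in> Q2" "y \<in> Q2"
      then show "x + y \<in> Q2" unfolding Q2_def using addQ by (auto simp flip: ev_hom)
    next
      fix t x assume "t \<in> T" "x \<in> Q2"
      then show "t * x \<in> Q2" unfolding Q2_def T_def using multQ by (auto simp flip: ev_hom)
    qed
    show "1 \<notin> Q2" using \<open>Q2 \<inter> S = P\<close> prime_ofD(2)[OF P(1)] S'(1) by blast
  next
    fix x y assume "x \<in> T" "y \<in> T" and xy: "x * y \<in> Q2"
    then obtain p q where pq: "p \<in> polys_over S" "q \<in> polys_over S" "x = ev p" "y = ev q" by (auto simp: T_def)
    then have "p * q \<in> Qs"
      using xy by (intro lift2 subring_closedD(4)[OF PS]) (auto simp: ev_hom)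
    then have "coeff p 0 * coeff q 0 \<in> P" by (simp add: Qs_def coeff_mult)
    then have "coeff p 0 \<in> P \<or> coeff q 0 \<in> P"
      using pq by (intro prime_ofD(3)[OF P(1)]) (auto simp: polys_over_def)
    then show "x \<in> Q2 \<or> y \<in> Q2" using pq by (auto simp: Q2_def Qs_def)
  qed
  ultimately show ?thesis using that T ST by blast
qed

end

section \<open>The equivalence for graded subrings of a field\<close>

context graded_in_field
begin

text \<open>The graded core of \<open>P\<close> is a homogeneous prime, so \<open>two_primes_over\<close> yields an element \<open>s\<close> outside this core; a
component of \<open>s\<close> outside \<open>P\<close> has the same property because \<open>u\<close> is homogeneous.\<close>

lemma homogeneous_comparable_at_prime:
  assumes S: "subring_closed S" "graded_set S" and closed: "integral_closure_in_field S \<subseteq> S"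
    and inj: "\<And>T. subring_closed T \<Longrightarrow> graded_set T \<Longrightarrow> S \<subseteq> T \<Longrightarrow> gr_i_extension S (\<lambda>\<alpha>. T \<inter> C \<alpha>) T"
    and P: "prime_of S P" and u: "u \<in> C \<delta>" "u \<noteq> 0"
  shows "\<exists>s\<in>S - P. s * u \<in> S \<or> s / u \<in> S"
proof -
  note PI = prime_ofD(1)[OF P] and core = graded_core_ideal[OF S prime_ofD(1)[OF P]]
  define P' where "P' = graded_core S P"
  have "\<exists>s\<in>S. s \<notin> P' \<and> (s * u \<in> S \<or> s / u \<in> S)"
  proof (rule ccontr)
    assume "\<not> ?thesis"
    then have incomparable: "\<And>s. s \<in> S \<Longrightarrow> s \<notin> P' \<Longrightarrow> s * u \<notin> S \<and> s / u \<notin> S" by blast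
    have P': "prime_of S P'" "graded_set P'"
      using prime_graded_core[OF S P] core(2) by (simp_all add: P'_def)
    obtain T Q1 Q2 where T: "subring_closed T" "graded_set T" "S \<subseteq> T"
      and Q: "prime_of T Q1" "graded_set Q1" "prime_of T Q2" "graded_set Q2"
      and eq: "Q1 \<inter> S = P'" "Q2 \<inter> S = P'" "Q1 \<noteq> Q2"
      by (rule two_primes_over[OF S closed P' u incomparable])
    then show False using inj[OF T] unfolding gr_i_extension_iff[OF T(1,2)] by metis
  qed
  then obtain s where s: "s \<in> S" "s \<notin> P'" "s * u \<in> S \<or> s / u \<in> S" by blast
  then obtain \<gamma> where \<gamma>: "component s \<gamma> \<notin> P" by (auto simp: P'_def graded_core_def)
  have cS: "component s \<gamma> \<in> S" and sD: "s \<in> D" using graded_setD[OF S(2) s(1)] by auto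
  from s(3) have "component s \<gamma> * u \<in> S \<or> component s \<gamma> / u \<in> S"
  proof
    assume "s * u \<in> S"
    then have "component (s * u) (\<gamma> + \<delta>) \<in> S" by (rule graded_setD(2)[OF S(2)])
    then show ?thesis using component_mult_homogeneous(2)[OF sD u(1), of "\<gamma> + \<delta>"] by simp
  next
    assume "s / u \<in> S"
    then have "component (s / u) (\<gamma> - \<delta>) \<in> S" by (rule graded_setD(2)[OF S(2)])
    then show ?thesis
      using component_mult_homogeneous(2)[OF sD C_inverse[OF u(1)], of "\<gamma> - \<delta>"]
      by (simp add: divide_inverse)
  qed
  then show ?thesis using cS \<gamma> by blast
qed

text \<open>If \<open>J = I I\<inverse>\<close> were proper, it would lie in a prime \<open>P\<close>. Comparability at \<open>P\<close> totally preorders the finitely many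
homogeneous generators of \<open>I\<close> by local divisibility. If the generator \<open>a\<close> divides the others locally with
common denominator \<open>t\<close> outside \<open>P\<close>, then \<open>t / a\<close> lies in \<open>I\<inverse>\<close> and \<open>t = a (t / a)\<close> lies in \<open>J\<close>, a contradiction.\<close>

lemma gr_Prufer_of_gr_injective:
  assumes S: "subring_closed S" "graded_set S" and closed: "integral_closure_in_field S \<subseteq> S"
    and inj: "\<And>T. subring_closed T \<Longrightarrow> graded_set T \<Longrightarrow> S \<subseteq> T \<Longrightarrow> gr_i_extension S (\<lambda>\<alpha>. T \<inter> C \<alpha>) T"
  shows "gr_Prufer_domain (\<lambda>\<alpha>. S \<inter> C \<alpha>) S"
  unfolding gr_Prufer_domain_def
proof (intro allI impI, elim conjE)
  fix I
  assume hom: "homogeneous_ideal (\<lambda>\<alpha>. S \<inter> C \<alpha>) S I" and fg: "finitely_generated_ideal S I" and ne: "I \<noteq> {0}"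
  note S' = subring_closedD[OF S(1)]
  have I: "ideal_of S I" "graded_set I" using hom homogeneous_ideal_iff[OF S] by blast+
  obtain F where F: "finite F" "F \<subseteq> S" "I = Idl\<^bsub>ring_on S\<^esub> F"
    using fg by (auto simp: finitely_generated_ideal_def)
  note gen = genideal_ring_on[OF S(1) F(2), folded F(3)]
  \<comment> \<open>The given finite generators need not be homogeneous, but their components generate the same ideal.\<close>
  define H where "H = (\<Union>f\<in>F. component f ` support f)"
  have FD: "f \<in> D" "f \<in> I" if "f \<in> F" for f using that gen(2) graded_setD(1)[OF I(2)] by auto
  have H: "finite H" using F(1) component_spec(2) FD(1) by (auto simp: H_def)
  have HI: "a \<in> I" "a \<noteq> 0" "\<exists>\<alpha>. a \<in> C \<alpha>" if a: "a \<in> H" for a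
  proof -
    obtain f \<alpha> where f: "f \<in> F" "\<alpha> \<in> support f" "a = component f \<alpha>" using a by (auto simp: H_def)
    show "a \<in> I" using f FD graded_setD(2)[OF I(2)] by simp
    show "a \<noteq> 0" using f by (simp add: support_def)
    show "\<exists>\<alpha>. a \<in> C \<alpha>" using f FD component_spec(1) by blast
  qed
  have I_minimal: "I \<subseteq> J" if J: "ideal_of S J" and HJ: "H \<subseteq> J" for J
  proof (rule gen(3)[OF J], rule subsetI)
    fix f assume f: "f \<in> F"
    have "(\<Sum>\<alpha>\<in>support f. component f \<alpha>) \<in> J"
      using HJ f by (intro ideal_of_sum[OF J]) (auto simp: H_def)
    then show "f \<in> J" using component_spec(3)[OF FD(1)[OF f]] by simp
  qed
  have "H \<noteq> {}"
  proof
    assume "H = {}"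
    then have "I \<subseteq> {0}" using S' by (intro I_minimal) (auto simp: ideal_of_def)
    then show False using ne ideal_ofD(2)[OF I(1)] by blast
  qed
  define J where "J = ideal_prod ring_of_type_algebra I (ideal_inverse S I)"
  have J: "ideal_of S J" unfolding J_def by (rule ideal_prod_inverse[OF S(1) I(1)])
  have "1 \<in> J"
  proof (rule ccontr)
    assume "1 \<notin> J"
    then have avoids: "J \<inter> {1} = {}" by blast
    obtain P where P: "J \<subseteq> P" "prime_of S P"
      by (rule maximal_ideal_avoiding[OF S(1) J _ _ avoids]) auto
    note PI = prime_ofD(1)[OF P(2)]
    \<comment> \<open>Divisibility of \<open>b\<close> by \<open>a\<close> in the localization of \<open>S\<close> at \<open>P\<close>.\<close>
    define le where "le a b \<longleftrightarrow> (\<exists>s\<in>S - P. s * (b / a) \<in> S)" for a b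
    have total: "le a b \<or> le b a" if ab: "a \<in> H" "b \<in> H" for a b
    proof -
      obtain \<alpha> \<beta> where "a \<in> C \<alpha>" "b \<in> C \<beta>" using HI(3)[OF ab(1)] HI(3)[OF ab(2)] by blast
      then have "b / a \<in> C (\<beta> - \<alpha>)" by (intro C_divide)
      from homogeneous_comparable_at_prime[OF S closed inj P(2) this]
      show ?thesis using HI(2) ab by (auto simp: le_def)
    qed
    have trans: "le a c" if "le a b" "le b c" "b \<noteq> 0" for a b c
    proof -
      obtain s t where st: "s \<in> S - P" "t \<in> S - P" "s * (b / a) \<in> S" "t * (c / b) \<in> S"
        using \<open>le a b\<close> \<open>le b c\<close> unfolding le_def by blast
      have "(s * t) * (c / a) = (s * (b / a)) * (t * (c / b))" using \<open>b \<noteq> 0\<close> by simp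
      then have "(s * t) * (c / a) \<in> S" using S'(4)[OF st(3,4)] by simp
      moreover have "s * t \<in> S - P" using st(1,2) S'(4) prime_ofD(3)[OF P(2)] by blast
      ultimately show ?thesis unfolding le_def by blast
    qed
    have least: "\<exists>a\<in>H'. \<forall>b\<in>H'. le a b" if "finite H'" "H' \<noteq> {}" "H' \<subseteq> H" for H'
      using that
    proof (induction H' rule: finite_ne_induct)
      case (singleton a)
      then show ?case using total by blast
    next
      case (insert a H')
      then obtain b where b: "b \<in> H'" "\<And>c. c \<in> H' \<Longrightarrow> le b c" by blast
      have aH: "a \<in> H" "b \<in> H" using insert b by auto
      show ?case
      proof (cases "le a b")
        case True
        then have "le a c" if "c \<in> H'" for c using trans[OF True b(2)[OF that]] HI(2)[OF aH(2)] by blast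
        then show ?thesis using total[OF aH(1) aH(1)] by blast
      next
        case False
        then have "le b a" using total aH by blast
        then show ?thesis using b by blast
      qed
    qed
    from least[OF H \<open>H \<noteq> {}\<close> subset_refl]
    obtain a where a: "a \<in> H" "\<And>b. b \<in> H \<Longrightarrow> le a b" by blast
    then have "\<forall>b\<in>H. \<exists>s. s \<in> S \<and> s \<notin> P \<and> s * (b / a) \<in> S"
      unfolding le_def by blast
    from bchoice[OF this]
    obtain s where all: "\<forall>b\<in>H. s b \<in> S \<and> s b \<notin> P \<and> s b * (b / a) \<in> S" ..
    then have s: "\<And>b. b \<in> H \<Longrightarrow> s b \<in> S" "\<And>b. b \<in> H \<Longrightarrow> s b \<notin> P"
      "\<And>b. b \<in> H \<Longrightarrow> s b * (b / a) \<in> S" by simp_all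
    define t where "t = (\<Prod>b\<in>H. s b)"
    have "(\<Prod>b\<in>H'. s b) \<in> S - P" if "finite H'" "H' \<subseteq> H" for H'
      using that
    proof (induction H')
      case empty
      then show ?case using S'(1) prime_ofD(2)[OF P(2)] by simp
    next
      case (insert b H')
      then show ?case using s(1,2)[of b] S'(4) prime_ofD(3)[OF P(2), of "s b" "\<Prod>b\<in>H'. s b"] by auto
    qed
    then have t: "t \<in> S" "t \<notin> P" unfolding t_def using H by blast+
    have "I \<subseteq> {x \<in> S. t * (x / a) \<in> S}"
    proof (rule I_minimal)
      show "ideal_of S {x \<in> S. t * (x / a) \<in> S}"
        unfolding ideal_of_def
      proof (intro conjI ballI)
        fix x y assume "x \<in> {x \<in> S. t * (x / a) \<in> S}" "y \<in> {x \<in> S. t * (x / a) \<in> S}"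
        then show "x + y \<in> {x \<in> S. t * (x / a) \<in> S}"
          using S'(6)[of x y] S'(6)[of "t * (x / a)" "t * (y / a)"] by (simp add: distrib_left add_divide_distrib)
      next
        fix r x assume r: "r \<in> S" and x: "x \<in> {x \<in> S. t * (x / a) \<in> S}"
        then have "t * (x / a) \<in> S" by blast
        then have "r * (t * (x / a)) \<in> S" by (rule S'(4)[OF r])
        moreover have "r * (t * (x / a)) = t * (r * x / a)" by simp
        ultimately have "t * (r * x / a) \<in> S" by (simp only:)
        then show "r * x \<in> {x \<in> S. t * (x / a) \<in> S}" using r x S'(4) by blast
      qed (use S' in auto)
      show "H \<subseteq> {x \<in> S. t * (x / a) \<in> S}"
      proof
        fix b assume b: "b \<in> H"
        have "t = (\<Prod>c\<in>H - {b}. s c) * s b"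
          unfolding t_def by (subst prod.remove[OF H b]) (simp add: mult.commute)
        then have "t * (b / a) = (\<Prod>c\<in>H - {b}. s c) * (s b * (b / a))" by (simp only: mult.assoc)
        moreover have "(\<Prod>c\<in>H - {b}. s c) \<in> S" using s(1) by (intro subring_closed_prod[OF S(1)]) auto
        ultimately have "t * (b / a) \<in> S" using s(3)[OF b] S'(4) by metis
        then show "b \<in> {x \<in> S. t * (x / a) \<in> S}" using HI(1)[OF b] ideal_ofD(1)[OF I(1)] by blast
      qed
    qed
    then have "t / a \<in> ideal_inverse S I" by (auto simp: ideal_inverse_def)
    then have "a * (t / a) \<in> J"
      unfolding J_def using ideal_prod.prod[OF HI(1)[OF a(1)], of "t / a" "ideal_inverse S I" ring_of_type_algebra]
      by (simp add: ring_on_simps)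
    then have "t \<in> P" using HI(2)[OF a(1)] P(1) by auto
    then show False using t by blast
  qed
  then show "invertible_ideal S I" using invertible_ideal_iff[OF S(1) I(1)] by (simp add: J_def)
qed

text \<open>The elements \<open>y\<close> and \<open>z\<close> of \<open>(a, b)\<inverse>\<close> collect the cofactors of \<open>a\<close> and \<open>b\<close> in an expression of \<open>1\<close> as a sum of
products from \<open>(a, b)\<close> and \<open>(a, b)\<inverse>\<close>.\<close>

lemma invertible_pair:
  assumes S: "subring_closed S" "graded_set S" and Prufer: "gr_Prufer_domain (\<lambda>\<alpha>. S \<inter> C \<alpha>) S"
    and a: "a \<in> S" "a \<in> C \<alpha>" and b: "b \<in> S" "b \<in> C \<beta>" "b \<noteq> 0"
  obtains y z where "a * y \<in> S" "b * y \<in> S" "a * z \<in> S" "b * z \<in> S" "a * y + b * z = 1"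
proof -
  define I where "I = Idl\<^bsub>ring_on S\<^esub> {a, b}"
  have "{a, b} \<subseteq> S" using a b by simp
  note gen = genideal_ring_on[OF S(1) this, folded I_def]
  have "graded_set I"
  proof -
    note core = graded_core_ideal[OF S gen(1)]
    have "{a, b} \<subseteq> graded_core S I"
      using a b gen(2) ideal_ofD(2)[OF gen(1)] by (auto intro: graded_core_homogeneous)
    then have "I = graded_core S I" using gen(3)[OF core(1)] core(3) by blast
    then show ?thesis using core(2) by simp
  qed
  then have "homogeneous_ideal (\<lambda>\<alpha>. S \<inter> C \<alpha>) S I" using homogeneous_ideal_iff[OF S] gen(1) by blast
  moreover have "finitely_generated_ideal S I"
    unfolding finitely_generated_ideal_def I_def
    using \<open>{a, b} \<subseteq> S\<close> by (intro exI[of _ "{a, b}"]) simp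
  moreover have "I \<noteq> {0}" using gen(2) b(3) by blast
  ultimately have "invertible_ideal S I" using Prufer unfolding gr_Prufer_domain_def by blast
  then have one: "1 \<in> ideal_prod ring_of_type_algebra I (ideal_inverse S I)"
    using invertible_ideal_iff[OF S(1) gen(1)] by blast
  note S' = subring_closedD[OF S(1)]
  define Inv where "Inv = ideal_inverse S I"
  have Inv: "y \<in> Inv \<longleftrightarrow> (\<forall>x\<in>I. x * y \<in> S)" for y
    by (simp add: Inv_def ideal_inverse_def mult.commute)
  have scale: "r * y \<in> Inv" if "r \<in> S" "y \<in> Inv" for r y
    unfolding Inv
  proof
    fix x assume "x \<in> I"
    then have "x * y \<in> S" using that(2) Inv by blast
    then have "r * (x * y) \<in> S" by (rule S'(4)[OF that(1)])
    then show "x * (r * y) \<in> S" by (simp add: mult.left_commute)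
  qed
  have add: "y + z \<in> Inv" if "y \<in> Inv" "z \<in> Inv" for y z
    using that S'(6) unfolding Inv by (simp add: distrib_left)
  define J where "J = {r * a + s * b | r s. r \<in> S \<and> s \<in> S}"
  have "I \<subseteq> J"
  proof (rule gen(3))
    show "ideal_of S J"
      unfolding ideal_of_def
    proof (intro conjI ballI)
      show "J \<subseteq> S" using a(1) b(1) by (auto simp: J_def intro!: S'(4,6))
      have "0 = 0 * a + 0 * b" by simp
      then show "0 \<in> J" unfolding J_def using S'(2) by blast
    next
      fix x y assume "x \<in> J" "y \<in> J"
      then obtain r s r' s' where "x = r * a + s * b" "y = r' * a + s' * b"
        and rs: "r \<in> S" "s \<in> S" "r' \<in> S" "s' \<in> S" by (auto simp: J_def)
      then have "x + y = (r + r') * a + (s + s') * b" by (simp add: algebra_simps)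
      then show "x + y \<in> J" unfolding J_def using S'(6) rs by blast
    next
      fix t x assume t: "t \<in> S" and "x \<in> J"
      then obtain r s where "x = r * a + s * b" and rs: "r \<in> S" "s \<in> S" by (auto simp: J_def)
      then have "t * x = (t * r) * a + (t * s) * b" by (simp add: algebra_simps)
      then show "t * x \<in> J" unfolding J_def using S'(4) t rs by blast
    qed
    have "a = 1 * a + 0 * b" "b = 0 * a + 1 * b" by simp_all
    then show "{a, b} \<subseteq> J" unfolding J_def using S'(1,2) by blast
  qed
  have "\<exists>y\<in>Inv. \<exists>z\<in>Inv. x = a * y + b * z" if "x \<in> ideal_prod ring_of_type_algebra I Inv" for x
    using that
  proof induction
    case (prod i j)
    then obtain r s where rs: "i = r * a + s * b" "r \<in> S" "s \<in> S" using \<open>I \<subseteq> J\<close> by (auto simp: J_def)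
    have "i \<otimes>\<^bsub>ring_of_type_algebra\<^esub> j = a * (r * j) + b * (s * j)"
      by (simp add: ring_on_simps rs(1) algebra_simps)
    then show ?case using scale[OF rs(2) prod(2)] scale[OF rs(3) prod(2)] by blast
  next
    case (sum x x')
    then obtain y z y' z' where yz: "y \<in> Inv" "z \<in> Inv" "x = a * y + b * z"
      "y' \<in> Inv" "z' \<in> Inv" "x' = a * y' + b * z'" by blast
    then have "x \<oplus>\<^bsub>ring_of_type_algebra\<^esub> x' = a * (y + y') + b * (z + z')"
      by (simp add: ring_on_simps algebra_simps)
    then show ?case using add yz by blast
  qed
  then obtain y z where "y \<in> Inv" "z \<in> Inv" "1 = a * y + b * z" using one Inv_def by blast
  then show ?thesis using gen(2) Inv by (intro that[of y z]) auto
qed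

text \<open>Primes \<open>N1\<close> and \<open>N2\<close> of the integral closure \<open>U\<close> of \<open>T\<close> over \<open>Q1\<close> and \<open>Q2\<close> have contractions to \<open>S\<close> with equal graded
cores, that is, they contain the same homogeneous elements of \<open>S\<close>. For homogeneous \<open>x\<close> in \<open>Q1\<close> there is a
homogeneous \<open>c\<close> in \<open>S\<close> outside both primes such that \<open>c x\<close> or \<open>c / x\<close> lies in \<open>S\<close>. The second case would give
\<open>c = (c / x) x \<in> N1\<close>; in the first case \<open>c x\<close> passes from \<open>N1\<close> to \<open>N2\<close>, and so does \<open>x\<close>.\<close>

lemma gr_injective_of_gr_Prufer:
  assumes S: "subring_closed S" "graded_set S" and RS: "R \<subseteq> S" "S \<subseteq> integral_closure_in_field R"
    and Prufer: "gr_Prufer_domain (\<lambda>\<alpha>. S \<inter> C \<alpha>) S" and inj: "gr_i_extension R (\<lambda>\<alpha>. S \<inter> C \<alpha>) S"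
    and T: "subring_closed T" "graded_set T" "R \<subseteq> T"
  shows "gr_i_extension R (\<lambda>\<alpha>. T \<inter> C \<alpha>) T"
proof -
  define U where "U = integral_closure_in_field T"
  have U: "subring_closed U" "T \<subseteq> U" unfolding U_def
    by (rule subring_closed_integral_closure[OF T(1)], rule integral_self[OF T(1)])
  have SU: "S \<subseteq> U" using RS(2) integral_mono[OF T(3)] by (auto simp: U_def)
  have contraction: "prime_of S (N \<inter> S)" if N: "prime_of U N" for N
  proof -
    note NI = prime_ofD(1)[OF N]
    have "ideal_of S (N \<inter> S)"
      unfolding ideal_of_def
    proof (intro conjI ballI)
      show "0 \<in> N \<inter> S" using ideal_ofD(2)[OF NI] subring_closedD(2)[OF S(1)] by blast
      show "x + y \<in> N \<inter> S" if "x \<in> N \<inter> S" "y \<in> N \<inter> S" for x y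
        using that ideal_ofD(3)[OF NI] subring_closedD(6)[OF S(1)] by blast
      show "t * x \<in> N \<inter> S" if "t \<in> S" "x \<in> N \<inter> S" for t x
        using that SU ideal_ofD(4)[OF NI, of t x] subring_closedD(4)[OF S(1), of t x] by blast
    qed blast
    moreover have "x \<in> N \<inter> S \<or> y \<in> N \<inter> S" if "x \<in> S" "y \<in> S" "x * y \<in> N \<inter> S" for x y
      using prime_ofD(3)[OF N, of x y] that SU by blast
    ultimately show ?thesis using prime_ofD(2)[OF N] unfolding prime_of_def by blast
  qed
  define core where "core N = graded_core S (N \<inter> S)" for N
  have core_R: "core N \<inter> R = Q \<inter> R" if N: "prime_of U N" "N \<inter> T = Q" and Q: "graded_set Q" for N Q
  proof (intro equalityI subsetI)
    note cI = graded_core_ideal[OF S prime_ofD(1)[OF contraction[OF N(1)]]]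
    fix x assume "x \<in> core N \<inter> R"
    then show "x \<in> Q \<inter> R" using cI(3) T(3) N(2) by (auto simp: core_def)
  next
    fix x assume x: "x \<in> Q \<inter> R"
    have "component x \<alpha> \<in> N \<inter> S" for \<alpha>
      using graded_setD(2)[OF Q, of x \<alpha>] graded_setD(2)[OF graded_R, of x \<alpha>] x N(2) RS(1) by blast
    then show "x \<in> core N \<inter> R" using x RS(1) by (auto simp: core_def graded_core_def)
  qed
  have sub: "Q1 \<subseteq> Q2"
    if Q1: "prime_of T Q1" "graded_set Q1" and Q2: "prime_of T Q2" "graded_set Q2"
      and eq: "Q1 \<inter> R = Q2 \<inter> R" for Q1 Q2
  proof -
    obtain N1 where N1: "prime_of U N1" "N1 \<inter> T = Q1"
      using lying_over[OF T(1) U _ Q1(1)] by (auto simp: U_def)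
    obtain N2 where N2: "prime_of U N2" "N2 \<inter> T = Q2"
      using lying_over[OF T(1) U _ Q2(1)] by (auto simp: U_def)
    note c1 = contraction[OF N1(1)] and c2 = contraction[OF N2(1)]
    note I1 = prime_ofD(1)[OF N1(1)] and I2 = prime_ofD(1)[OF N2(1)]
    have "core N1 \<inter> R = core N2 \<inter> R" using core_R[OF N1 Q1(2)] core_R[OF N2 Q2(2)] eq by simp
    then have cores: "core N1 = core N2"
      using inj prime_graded_core[OF S c1] prime_graded_core[OF S c2]
        graded_core_ideal(2)[OF S prime_ofD(1)[OF c1]] graded_core_ideal(2)[OF S prime_ofD(1)[OF c2]]
      unfolding gr_i_extension_iff[OF S] core_def by blast
    have hom_iff: "x \<in> N1 \<longleftrightarrow> x \<in> N2" if "x \<in> C \<alpha>" "x \<in> S" for x \<alpha>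
    proof -
      have "x \<in> core N \<longleftrightarrow> x \<in> N" if "prime_of U N" for N
        using graded_core_homogeneous[OF \<open>x \<in> C \<alpha>\<close> \<open>x \<in> S\<close>, of "N \<inter> S"] \<open>x \<in> S\<close>
          graded_core_ideal(3)[OF S prime_ofD(1)[OF contraction[OF that]]]
          ideal_ofD(2)[OF prime_ofD(1)[OF contraction[OF that]]] by (auto simp: core_def)
      then show ?thesis using cores N1(1) N2(1) by blast
    qed
    have homogeneous: "x \<in> Q2" if x: "x \<in> Q1" "x \<in> C \<delta>" for x \<delta>
    proof (cases "x = 0")
      case True
      then show ?thesis using ideal_ofD(2)[OF prime_ofD(1)[OF Q2(1)]] by simp
    next
      case False
      have xT: "x \<in> T" using x(1) ideal_ofD(1)[OF prime_ofD(1)[OF Q1(1)]] by blast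
      have xN1: "x \<in> N1" using x(1) N1(2) by blast
      obtain a b \<beta> where ab: "a \<in> R" "b \<in> R" "b \<in> C \<beta>" "b \<noteq> 0" "x = a / b"
        using C_fraction[OF x(2)] by blast
      have "a \<in> C (\<delta> + \<beta>)" using C_mult[OF x(2) ab(3)] ab(4,5) by simp
      then obtain y z where yz: "a * y \<in> S" "b * y \<in> S" "a * z \<in> S" "b * z \<in> S" "a * y + b * z = 1"
        using invertible_pair[OF S Prufer _ _ _ ab(3,4)] ab(1,2) RS(1) by blast
      have "\<exists>s\<in>S. s \<notin> core N1 \<and> (s * x \<in> S \<or> s / x \<in> S)"
      proof -
        note cI = prime_ofD(1,2)[OF prime_graded_core[OF S c1], folded core_def]
        \<comment> \<open>As \<open>a y + b z = 1\<close>, one summand is outside the core. Multiplying \<open>x = a / b\<close> by \<open>b z\<close>, or dividing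
          \<open>a y\<close> by \<open>x\<close>, stays in \<open>S\<close>.\<close>
        have "a * y \<notin> core N1 \<or> b * z \<notin> core N1"
          using ideal_ofD(3)[OF cI(1)] cI(2) yz(5) by metis
        moreover have "(b * z) * x = a * z" "a * y / x = b * y" using ab(4,5) False by auto
        ultimately show ?thesis using yz by metis
      qed
      then obtain s where s: "s \<in> S" "s \<notin> core N1" "s * x \<in> S \<or> s / x \<in> S" by blast
      then obtain \<gamma> where \<gamma>: "component s \<gamma> \<notin> N1"
        using graded_setD(2)[OF S(2) s(1)] by (auto simp: core_def graded_core_def)
      define c where "c = component s \<gamma>"
      have sD: "s \<in> D" and cS: "c \<in> S" using graded_setD[OF S(2) s(1)] by (auto simp: c_def)
      have cC: "c \<in> C \<gamma>" unfolding c_def by (rule component_spec(1)[OF sD])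
      have cU: "c \<in> U" and xU: "x \<in> U" using cS SU xT U(2) by auto
      have cN: "c \<notin> N1" "c \<notin> N2" using \<gamma> hom_iff[OF cC cS] by (auto simp: c_def)
      from s(3) show ?thesis
      proof
        assume "s * x \<in> S"
        then have "component (s * x) (\<gamma> + \<delta>) \<in> S" by (rule graded_setD(2)[OF S(2)])
        then have cx: "c * x \<in> S"
          using component_mult_homogeneous(2)[OF sD x(2), of "\<gamma> + \<delta>"] by (simp add: c_def)
        have "c * x \<in> N1" by (rule ideal_ofD(4)[OF I1 cU xN1])
        then have "c * x \<in> N2" using hom_iff[OF C_mult[OF cC x(2)] cx] by blast
        then have "x \<in> N2" using prime_ofD(3)[OF N2(1) cU xU] cN by blast
        then show ?thesis using N2(2) xT by blast
      next
        assume "s / x \<in> S"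
        then have "component (s / x) (\<gamma> - \<delta>) \<in> S" by (rule graded_setD(2)[OF S(2)])
        then have "c / x \<in> S"
          using component_mult_homogeneous(2)[OF sD C_inverse[OF x(2)], of "\<gamma> - \<delta>"]
          by (simp add: c_def divide_inverse)
        then have "(c / x) * x \<in> N1" using SU xN1 by (intro ideal_ofD(4)[OF I1]) auto
        then show ?thesis using cN(1) False by simp
      qed
    qed
    show "Q1 \<subseteq> Q2"
    proof
      fix x assume x: "x \<in> Q1"
      then have xD: "x \<in> D" by (rule graded_setD(1)[OF Q1(2)])
      have "(\<Sum>\<alpha>\<in>support x. component x \<alpha>) \<in> Q2"
        using homogeneous graded_setD(2)[OF Q1(2) x] component_spec(1)[OF xD]
        by (intro ideal_of_sum[OF prime_ofD(1)[OF Q2(1)]]) blast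
      then show "x \<in> Q2" using component_spec(3)[OF xD] by simp
    qed
  qed
  show ?thesis unfolding gr_i_extension_iff[OF T(1,2)] using sub by (metis subset_antisym)
qed

text \<open>In the forward direction overrings of \<open>S\<close> are in particular overrings of \<open>R\<close>, and primes with equal contraction
to \<open>S\<close> have equal contraction to \<open>R\<close>; so the property passes from \<open>R\<close> to \<open>S\<close>.\<close>

lemma gr_injective_iff:
  defines "S \<equiv> integral_closure_in_field R"
  shows "(\<forall>T. subring_closed T \<and> graded_set T \<and> R \<subseteq> T \<longrightarrow> gr_i_extension R (\<lambda>\<alpha>. T \<inter> C \<alpha>) T) \<longleftrightarrow>
    gr_i_extension R (\<lambda>\<alpha>. S \<inter> C \<alpha>) S \<and> gr_Prufer_domain (\<lambda>\<alpha>. S \<inter> C \<alpha>) S"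
proof -
  have S: "subring_closed S" "graded_set S" and RS: "R \<subseteq> S" "S \<subseteq> integral_closure_in_field R"
    and closed: "integral_closure_in_field S \<subseteq> S"
    unfolding S_def using subring_closed_integral_closure[OF R_subring] graded_integral_closure
      integral_self[OF R_subring] integral_closure_idem[OF R_subring] by auto
  show ?thesis
  proof
    assume inj: "\<forall>T. subring_closed T \<and> graded_set T \<and> R \<subseteq> T \<longrightarrow> gr_i_extension R (\<lambda>\<alpha>. T \<inter> C \<alpha>) T"
    have "gr_i_extension S (\<lambda>\<alpha>. T \<inter> C \<alpha>) T" if T: "subring_closed T" "graded_set T" "S \<subseteq> T" for T
      unfolding gr_i_extension_iff[OF T(1,2)]
    proof (intro allI impI)
      fix Q1 Q2
      assume Q: "prime_of T Q1 \<and> graded_set Q1 \<and> prime_of T Q2 \<and> graded_set Q2 \<and> Q1 \<inter> S = Q2 \<inter> S"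
      then have "Q1 \<inter> R = Q2 \<inter> R" using RS(1) by blast
      moreover have "gr_i_extension R (\<lambda>\<alpha>. T \<inter> C \<alpha>) T" using inj T RS(1) by blast
      ultimately show "Q1 = Q2" using Q unfolding gr_i_extension_iff[OF T(1,2)] by blast
    qed
    then have "gr_Prufer_domain (\<lambda>\<alpha>. S \<inter> C \<alpha>) S" by (rule gr_Prufer_of_gr_injective[OF S closed])
    then show "gr_i_extension R (\<lambda>\<alpha>. S \<inter> C \<alpha>) S \<and> gr_Prufer_domain (\<lambda>\<alpha>. S \<inter> C \<alpha>) S"
      using inj S RS(1) by blast
  next
    assume "gr_i_extension R (\<lambda>\<alpha>. S \<inter> C \<alpha>) S \<and> gr_Prufer_domain (\<lambda>\<alpha>. S \<inter> C \<alpha>) S"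
    then show "\<forall>T. subring_closed T \<and> graded_set T \<and> R \<subseteq> T \<longrightarrow> gr_i_extension R (\<lambda>\<alpha>. T \<inter> C \<alpha>) T"
      using gr_injective_of_gr_Prufer[OF S RS] by blast
  qed
qed

end

section \<open>The grading of the fraction field\<close>

lemma graded_domain_components:
  assumes "graded_integral_domain \<A>"
  shows "0 \<in> \<A> \<beta>" "x \<in> \<A> \<beta> \<Longrightarrow> y \<in> \<A> \<beta> \<Longrightarrow> x + y \<in> \<A> \<beta>" "x \<in> \<A> \<beta> \<Longrightarrow> - x \<in> \<A> \<beta>"
    "x \<in> \<A> \<beta> \<Longrightarrow> y \<in> \<A> \<gamma> \<Longrightarrow> x * y \<in> \<A> (\<beta> + \<gamma>)"
proof -
  have "additive_subgroup (\<A> \<beta>) ring_of_type_algebra"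
    using assms by (simp add: graded_integral_domain_def internal_direct_sum_def)
  then have "additive_subgroup (\<A> \<beta>) (ring_on UNIV)" by (simp only: ring_on_UNIV)
  then have "0 \<in> \<A> \<beta> \<and> (\<forall>x\<in>\<A> \<beta>. \<forall>y\<in>\<A> \<beta>. x + y \<in> \<A> \<beta>) \<and> (\<forall>x\<in>\<A> \<beta>. - x \<in> \<A> \<beta>)"
    by (subst (asm) additive_subgroup_ring_on) (simp_all add: subring_closed_def)
  then show "0 \<in> \<A> \<beta>" "x \<in> \<A> \<beta> \<Longrightarrow> y \<in> \<A> \<beta> \<Longrightarrow> x + y \<in> \<A> \<beta>" "x \<in> \<A> \<beta> \<Longrightarrow> - x \<in> \<A> \<beta>"
    by blast+
  show "x \<in> \<A> \<beta> \<Longrightarrow> y \<in> \<A> \<gamma> \<Longrightarrow> x * y \<in> \<A> (\<beta> + \<gamma>)"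
    using assms by (auto simp: graded_integral_domain_def)
qed

lemma graded_domain_decomposition:
  assumes "graded_integral_domain \<A>"
  obtains c where "\<And>\<beta>. c \<beta> \<in> \<A> \<beta>" "finite {\<beta>. c \<beta> \<noteq> 0}" "r = (\<Sum>\<beta> | c \<beta> \<noteq> 0. c \<beta>)"
proof -
  have "(\<lambda>c. \<Sum>i | c i \<noteq> 0. c i) ` {c. (\<forall>i. c i \<in> \<A> i) \<and> finite {i. c i \<noteq> 0}} = UNIV"
    using assms by (simp add: graded_integral_domain_def internal_direct_sum_def bij_betw_def)
  then have "r \<in> (\<lambda>c. \<Sum>i | c i \<noteq> 0. c i) ` {c. (\<forall>i. c i \<in> \<A> i) \<and> finite {i. c i \<noteq> 0}}" by simp
  then show ?thesis using that by blast
qed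

lemma graded_domain_independent:
  assumes gr: "graded_integral_domain \<A>" and B: "finite B" and c: "\<And>\<beta>. \<beta> \<in> B \<Longrightarrow> c \<beta> \<in> \<A> \<beta>"
    and sum: "(\<Sum>\<beta>\<in>B. c \<beta>) = 0" and \<beta>: "\<beta> \<in> B"
  shows "c \<beta> = 0"
proof -
  define F where "F = {c. (\<forall>i. c i \<in> \<A> i) \<and> finite {i. c i \<noteq> 0}}"
  have inj: "inj_on (\<lambda>c. \<Sum>i | c i \<noteq> 0. c i) F"
    using gr by (simp add: graded_integral_domain_def internal_direct_sum_def bij_betw_def F_def)
  define d where "d i = (if i \<in> B then c i else 0)" for i
  have sub: "{i. d i \<noteq> 0} \<subseteq> B" by (auto simp: d_def)
  have "(\<Sum>i | d i \<noteq> 0. d i) = (\<Sum>i\<in>B. d i)"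
    by (rule sum.mono_neutral_left[OF B sub]) auto
  also have "\<dots> = (\<Sum>i | (0::'a) \<noteq> 0. 0)" using sum by (simp add: d_def)
  finally have "(\<Sum>i | d i \<noteq> 0. d i) = (\<Sum>i | (\<lambda>_::'b. 0::'a) i \<noteq> 0. (\<lambda>_. 0) i)" by simp
  moreover have "d \<in> F" "(\<lambda>_. 0) \<in> F"
    using c finite_subset[OF sub B] graded_domain_components(1)[OF gr] by (auto simp: F_def d_def)
  ultimately have "d = (\<lambda>_. 0)" using inj_onD[OF inj, of d "\<lambda>_. 0"] by simp
  then have "d \<beta> = 0" by simp
  then show ?thesis using \<beta> by (simp add: d_def)
qed

lemma graded_domain_nonzero_homogeneous:
  assumes "graded_integral_domain \<A>"
  obtains h \<eta> where "h \<in> \<A> \<eta>" "h \<noteq> 0"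
proof -
  obtain c where c: "\<And>\<beta>. c \<beta> \<in> \<A> \<beta>" "1 = (\<Sum>\<beta> | c \<beta> \<noteq> 0. c \<beta>)"
    by (rule graded_domain_decomposition[OF assms, where r = 1]) blast
  have "{\<beta>. c \<beta> \<noteq> 0} \<noteq> {}"
  proof
    assume "{\<beta>. c \<beta> \<noteq> 0} = {}"
    then have "(1::'b) = 0" using c(2) by (simp only: sum.empty)
    then show False by simp
  qed
  then show ?thesis using that c(1) by blast
qed

lemma quotient_componentE:
  assumes "x \<in> quotient_component \<A> \<alpha>" "x \<noteq> 0"
  obtains f g \<beta> \<gamma> where "f \<in> \<A> \<beta>" "f \<noteq> 0" "g \<in> \<A> \<gamma>" "g \<noteq> 0"
    "to_diff_group \<beta> - to_diff_group \<gamma> = \<alpha>" "x = Fract f g"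
  using assms unfolding quotient_component_def by blast

lemma quotient_componentI:
  assumes "f \<in> \<A> \<beta>" "g \<in> \<A> \<gamma>" "g \<noteq> 0" "to_diff_group \<beta> - to_diff_group \<gamma> = \<alpha>"
  shows "Fract f g \<in> quotient_component \<A> \<alpha>"
proof (cases "f = 0")
  case True
  then show ?thesis using assms by (simp add: quotient_component_def eq_fract Zero_fract_def)
next
  case False
  then show ?thesis using assms unfolding quotient_component_def by blast
qed

text \<open>Expanding by a nonzero homogeneous \<open>h\<close> displays the element as a quotient of homogeneous elements.\<close>

lemma to_fract_component:
  assumes gr: "graded_integral_domain \<A>" and a: "a \<in> \<A> \<beta>"
  shows "to_fract a \<in> quotient_component \<A> (to_diff_group \<beta>)"
proof -
  obtain h \<eta> where h: "h \<in> \<A> \<eta>" "h \<noteq> 0" using graded_domain_nonzero_homogeneous[OF gr] .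
  have "Fract (a * h) h \<in> quotient_component \<A> (to_diff_group \<beta>)"
    by (rule quotient_componentI[OF graded_domain_components(4)[OF gr a h(1)] h])
      (simp add: to_diff_group_add)
  moreover have "Fract (a * h) h = to_fract a" using h(2) by (simp add: to_fract_def eq_fract)
  ultimately show ?thesis by simp
qed

text \<open>This reduces the independence of the homogeneous parts of the graded quotient field to that of the homogeneous
parts of \<open>R\<close>.\<close>

lemma quotient_component_common_denominator:
  assumes gr: "graded_integral_domain \<A>" and B: "finite B"
    and c: "\<And>\<alpha>. \<alpha> \<in> B \<Longrightarrow> c \<alpha> \<in> quotient_component \<A> \<alpha> \<and> c \<alpha> \<noteq> 0"
  shows "\<exists>h \<eta>. h \<in> \<A> \<eta> \<and> h \<noteq> 0 \<and> (\<forall>\<alpha>\<in>B. \<exists>f \<gamma>. f \<in> \<A> \<gamma> \<and>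
    to_diff_group \<gamma> - to_diff_group \<eta> = \<alpha> \<and> c \<alpha> * to_fract h = to_fract f)"
  using B c
proof (induction B)
  case empty
  then show ?case using graded_domain_nonzero_homogeneous[OF gr] by (metis empty_iff)
next
  case (insert \<alpha> B)
  then obtain h \<eta> where h: "h \<in> \<A> \<eta>" "h \<noteq> 0" and IH: "\<And>\<alpha>. \<alpha> \<in> B \<Longrightarrow> \<exists>f \<gamma>. f \<in> \<A> \<gamma> \<and>
    to_diff_group \<gamma> - to_diff_group \<eta> = \<alpha> \<and> c \<alpha> * to_fract h = to_fract f" by auto
  have "c \<alpha> \<in> quotient_component \<A> \<alpha>" "c \<alpha> \<noteq> 0" using insert by auto
  then obtain f g \<beta> \<gamma> where fg: "f \<in> \<A> \<beta>" "g \<in> \<A> \<gamma>" "g \<noteq> 0"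
    "to_diff_group \<beta> - to_diff_group \<gamma> = \<alpha>" "c \<alpha> = Fract f g"
    by (rule quotient_componentE)
  note mult = graded_domain_components(4)[OF gr]
  have new: "f * h \<in> \<A> (\<beta> + \<eta>)" "to_diff_group (\<beta> + \<eta>) - to_diff_group (\<eta> + \<gamma>) = \<alpha>"
    "c \<alpha> * to_fract (h * g) = to_fract (f * h)"
    using mult[OF fg(1) h(1)] fg(3,4,5) by (simp_all add: to_diff_group_add to_fract_def eq_fract)
  have old: "\<exists>f \<delta>. f \<in> \<A> \<delta> \<and> to_diff_group \<delta> - to_diff_group (\<eta> + \<gamma>) = \<alpha>' \<and>
    c \<alpha>' * to_fract (h * g) = to_fract f" if \<alpha>': "\<alpha>' \<in> B" for \<alpha>'
  proof -
    obtain f' \<delta> where f': "f' \<in> \<A> \<delta>" "to_diff_group \<delta> - to_diff_group \<eta> = \<alpha>'"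
      "c \<alpha>' * to_fract h = to_fract f'" using IH[OF \<alpha>'] by blast
    have "c \<alpha>' * to_fract (h * g) = to_fract (f' * g)"
      by (simp only: to_fract_mult f'(3)[symmetric] mult.assoc)
    moreover have "to_diff_group (\<delta> + \<gamma>) - to_diff_group (\<eta> + \<gamma>) = \<alpha>'"
      using f'(2) by (simp add: to_diff_group_add)
    ultimately show ?thesis using mult[OF f'(1) fg(2)] by blast
  qed
  have "h * g \<in> \<A> (\<eta> + \<gamma>)" "h * g \<noteq> 0" using mult[OF h(1) fg(2)] h fg by simp_all
  moreover have "\<forall>\<alpha>'\<in>insert \<alpha> B. \<exists>f \<delta>. f \<in> \<A> \<delta> \<and> to_diff_group \<delta> - to_diff_group (\<eta> + \<gamma>) = \<alpha>' \<and>
    c \<alpha>' * to_fract (h * g) = to_fract f"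
    using new old by blast
  ultimately show ?case by blast
qed

lemma graded_in_field_quotient:
  fixes \<A> :: "'g::torsionless_grading_monoid \<Rightarrow> 'a::idom set"
  assumes gr: "graded_integral_domain \<A>"
  shows "graded_in_field (quotient_component \<A>) (range to_fract)"
proof -
  note A = graded_domain_components[OF gr]
  obtain h0 \<eta>0 where h0: "h0 \<in> \<A> \<eta>0" "h0 \<noteq> 0" using graded_domain_nonzero_homogeneous[OF gr] .
  have zero: "0 \<in> quotient_component \<A> \<alpha>" for \<alpha> by (simp add: quotient_component_def)
  show ?thesis
  proof
    show "0 \<in> quotient_component \<A> \<alpha>" for \<alpha> by (rule zero)
  next
    fix x y \<alpha> assume x: "x \<in> quotient_component \<A> \<alpha>" and y: "y \<in> quotient_component \<A> \<alpha>"
    show "x + y \<in> quotient_component \<A> \<alpha>"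
    proof (cases "x = 0 \<or> y = 0")
      case True
      then show ?thesis using x y by auto
    next
      case False
      then have "x \<noteq> 0" "y \<noteq> 0" by auto
      obtain f g \<beta> \<gamma> where fg: "f \<in> \<A> \<beta>" "g \<in> \<A> \<gamma>" "g \<noteq> 0"
        "to_diff_group \<beta> - to_diff_group \<gamma> = \<alpha>" "x = Fract f g"
        using x \<open>x \<noteq> 0\<close> by (rule quotient_componentE)
      obtain f' g' \<beta>' \<gamma>' where fg': "f' \<in> \<A> \<beta>'" "g' \<in> \<A> \<gamma>'" "g' \<noteq> 0"
        "to_diff_group \<beta>' - to_diff_group \<gamma>' = \<alpha>" "y = Fract f' g'"
        using y \<open>y \<noteq> 0\<close> by (rule quotient_componentE)
      have "to_diff_group (\<beta>' + \<gamma>) = to_diff_group (\<beta> + \<gamma>')"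
        using fg(4) fg'(4) by (simp add: to_diff_group_add algebra_simps)
      then have "\<beta>' + \<gamma> = \<beta> + \<gamma>'" by (simp only: to_diff_group_eq_iff)
      then have "f * g' + f' * g \<in> \<A> (\<beta> + \<gamma>')"
        using A(2)[OF A(4)[OF fg(1) fg'(2)]] A(4)[OF fg'(1) fg(2)] by simp
      moreover have "to_diff_group (\<beta> + \<gamma>') - to_diff_group (\<gamma> + \<gamma>') = \<alpha>"
        using fg(4) by (simp add: to_diff_group_add)
      ultimately have "Fract (f * g' + f' * g) (g * g') \<in> quotient_component \<A> \<alpha>"
        using A(4)[OF fg(2) fg'(2)] fg(3) fg'(3) by (intro quotient_componentI) auto
      then show ?thesis using fg fg' by simp
    qed
  next
    fix x \<alpha> assume x: "x \<in> quotient_component \<A> \<alpha>"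
    have "- x \<in> quotient_component \<A> \<alpha> \<and> inverse x \<in> quotient_component \<A> (- \<alpha>) \<and>
      (\<exists>f\<in>range to_fract. \<exists>g\<in>range to_fract. \<exists>\<beta>. g \<in> quotient_component \<A> \<beta> \<and> g \<noteq> 0 \<and> x = f / g)"
    proof (cases "x = 0")
      case True
      have "to_fract h0 \<in> quotient_component \<A> (to_diff_group \<eta>0)" "to_fract h0 \<noteq> 0" "x = to_fract 0 / to_fract h0"
        using to_fract_component[OF gr h0(1)] h0(2) True by simp_all
      then show ?thesis using zero True by auto
    next
      case False
      obtain f g \<beta> \<gamma> where fg: "f \<in> \<A> \<beta>" "f \<noteq> 0" "g \<in> \<A> \<gamma>" "g \<noteq> 0"
        "to_diff_group \<beta> - to_diff_group \<gamma> = \<alpha>" "x = Fract f g"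
        using x False by (rule quotient_componentE)
      have "Fract (- f) g \<in> quotient_component \<A> \<alpha>" using fg A(3) by (intro quotient_componentI)
      moreover have "Fract g f \<in> quotient_component \<A> (- \<alpha>)" using fg by (intro quotient_componentI) auto
      moreover have "- x = Fract (- f) g" "inverse x = Fract g f" using fg by simp_all
      moreover have "x = to_fract f / to_fract g" "to_fract g \<noteq> 0"
        using fg by (simp_all add: Fract_conv_to_fract)
      ultimately show ?thesis using to_fract_component[OF gr fg(3)] by (metis rangeI)
    qed
    then show "- x \<in> quotient_component \<A> \<alpha>" "inverse x \<in> quotient_component \<A> (- \<alpha>)"
      "\<exists>f\<in>range to_fract. \<exists>g\<in>range to_fract. \<exists>\<beta>. g \<in> quotient_component \<A> \<beta> \<and> g \<noteq> 0 \<and> x = f / g"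
      by auto
  next
    have "Fract h0 h0 \<in> quotient_component \<A> 0" using h0 by (intro quotient_componentI) auto
    moreover have "Fract h0 h0 = 1" using h0(2) by (simp add: One_fract_def eq_fract)
    ultimately show "1 \<in> quotient_component \<A> 0" by simp
  next
    fix x y \<alpha> \<beta> assume x: "x \<in> quotient_component \<A> \<alpha>" and y: "y \<in> quotient_component \<A> \<beta>"
    show "x * y \<in> quotient_component \<A> (\<alpha> + \<beta>)"
    proof (cases "x = 0 \<or> y = 0")
      case True
      then show ?thesis using zero by auto
    next
      case False
      then have "x \<noteq> 0" "y \<noteq> 0" by auto
      obtain f g \<gamma> \<delta> where fg: "f \<in> \<A> \<gamma>" "g \<in> \<A> \<delta>" "g \<noteq> 0"
        "to_diff_group \<gamma> - to_diff_group \<delta> = \<alpha>" "x = Fract f g"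
        using x \<open>x \<noteq> 0\<close> by (rule quotient_componentE)
      obtain f' g' \<gamma>' \<delta>' where fg': "f' \<in> \<A> \<gamma>'" "g' \<in> \<A> \<delta>'" "g' \<noteq> 0"
        "to_diff_group \<gamma>' - to_diff_group \<delta>' = \<beta>" "y = Fract f' g'"
        using y \<open>y \<noteq> 0\<close> by (rule quotient_componentE)
      have "to_diff_group (\<gamma> + \<gamma>') - to_diff_group (\<delta> + \<delta>') = \<alpha> + \<beta>"
        using fg(4) fg'(4) by (simp add: to_diff_group_add algebra_simps flip: fg(4) fg'(4))
      then have "Fract (f * f') (g * g') \<in> quotient_component \<A> (\<alpha> + \<beta>)"
        using A(4)[OF fg(1) fg'(1)] A(4)[OF fg(2) fg'(2)] fg(3) fg'(3) by (intro quotient_componentI) auto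
      then show ?thesis using fg fg' by simp
    qed
  next
    fix B and c :: "'g diff_group \<Rightarrow> 'a fract" and \<alpha>
    assume B: "finite B" and c: "\<And>\<alpha>. \<alpha> \<in> B \<Longrightarrow> c \<alpha> \<in> quotient_component \<A> \<alpha>"
      and sum: "(\<Sum>\<alpha>\<in>B. c \<alpha>) = 0" and \<alpha>: "\<alpha> \<in> B"
    show "c \<alpha> = 0"
    proof (rule ccontr)
      assume c\<alpha>: "c \<alpha> \<noteq> 0"
      define B0 where "B0 = {\<alpha>\<in>B. c \<alpha> \<noteq> 0}"
      have B0: "finite B0" using B by (simp add: B0_def)
      obtain h \<eta> where h: "h \<in> \<A> \<eta>" "h \<noteq> 0" and num: "\<forall>\<alpha>\<in>B0. \<exists>f \<gamma>. f \<in> \<A> \<gamma> \<and>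
        to_diff_group \<gamma> - to_diff_group \<eta> = \<alpha> \<and> c \<alpha> * to_fract h = to_fract f"
        using quotient_component_common_denominator[OF gr B0, of c] c by (auto simp: B0_def)
      obtain f where "\<forall>\<alpha>\<in>B0. \<exists>\<gamma>. f \<alpha> \<in> \<A> \<gamma> \<and>
        to_diff_group \<gamma> - to_diff_group \<eta> = \<alpha> \<and> c \<alpha> * to_fract h = to_fract (f \<alpha>)"
        using bchoice[OF num] ..
      from bchoice[OF this] obtain e where fe: "\<forall>\<alpha>\<in>B0. f \<alpha> \<in> \<A> (e \<alpha>) \<and>
        to_diff_group (e \<alpha>) - to_diff_group \<eta> = \<alpha> \<and> c \<alpha> * to_fract h = to_fract (f \<alpha>)" ..
      then have inj: "inj_on e B0" by (intro inj_onI) metis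
      have "to_fract (\<Sum>\<alpha>\<in>B0. f \<alpha>) = (\<Sum>\<alpha>\<in>B0. c \<alpha> * to_fract h)"
        using B0 fe by (simp add: to_fract_sum)
      also have "\<dots> = (\<Sum>\<alpha>\<in>B0. c \<alpha>) * to_fract h" by (rule sum_distrib_right[symmetric])
      also have "(\<Sum>\<alpha>\<in>B0. c \<alpha>) = (\<Sum>\<alpha>\<in>B. c \<alpha>)"
        by (rule sum.mono_neutral_left[OF B]) (auto simp: B0_def)
      finally have "to_fract (\<Sum>\<alpha>\<in>B0. f \<alpha>) = (\<Sum>\<alpha>\<in>B. c \<alpha>) * to_fract h" .
      then have "to_fract (\<Sum>\<alpha>\<in>B0. f \<alpha>) = 0" by (simp only: sum mult_zero_left)
      then have "(\<Sum>\<alpha>\<in>B0. f \<alpha>) = 0" by (simp only: to_fract_eq_0_iff)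
      then have "(\<Sum>\<gamma>\<in>e ` B0. f (inv_into B0 e \<gamma>)) = 0"
        using inj by (simp add: sum.reindex)
      moreover have "f (inv_into B0 e \<gamma>) \<in> \<A> \<gamma>" if "\<gamma> \<in> e ` B0" for \<gamma>
        using that fe inj by auto
      moreover have "\<alpha> \<in> B0" using \<alpha> c\<alpha> by (simp add: B0_def)
      ultimately have "f (inv_into B0 e (e \<alpha>)) = 0"
        using graded_domain_independent[OF gr, of "e ` B0" "\<lambda>\<gamma>. f (inv_into B0 e \<gamma>)" "e \<alpha>"] B0 by blast
      then have "f \<alpha> = 0" using inj \<open>\<alpha> \<in> B0\<close> by simp
      then have "c \<alpha> * to_fract h = 0" using fe \<open>\<alpha> \<in> B0\<close> by simp
      then show False using c\<alpha> h(2) by simp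
    qed
  next
    show "subring_closed (range (to_fract :: 'a \<Rightarrow> 'a fract))"
      unfolding subring_closed_def by (auto simp flip: to_fract_1 to_fract_diff to_fract_mult)
  next
    fix r :: "'a fract" assume "r \<in> range to_fract"
    then obtain s where s: "r = to_fract s" by blast
    obtain c where c: "\<And>\<beta>. c \<beta> \<in> \<A> \<beta>" "finite {\<beta>. c \<beta> \<noteq> 0}" "s = (\<Sum>\<beta> | c \<beta> \<noteq> 0. c \<beta>)"
      by (rule graded_domain_decomposition[OF gr, where r = s]) blast
    have inj: "inj (to_diff_group :: 'g \<Rightarrow> 'g diff_group)"
      by (rule injI) (simp add: to_diff_group_eq_iff)
    define B where "B = to_diff_group ` {\<beta>. c \<beta> \<noteq> 0}"
    define d where "d \<alpha> = to_fract (c (inv_into UNIV to_diff_group \<alpha>))" for \<alpha>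
    have "r = (\<Sum>\<beta> | c \<beta> \<noteq> 0. to_fract (c \<beta>))" by (simp add: s c(3) to_fract_sum)
    also have "\<dots> = (\<Sum>\<alpha>\<in>B. d \<alpha>)"
      unfolding B_def d_def using inj by (subst sum.reindex) (auto intro: inj_on_subset)
    finally have "r = (\<Sum>\<alpha>\<in>B. d \<alpha>)" .
    moreover have "finite B" using c(2) by (simp add: B_def)
    moreover have "\<forall>\<alpha>\<in>B. d \<alpha> \<in> quotient_component \<A> \<alpha> \<inter> range to_fract"
      using to_fract_component[OF gr c(1)] inj by (auto simp: B_def d_def)
    ultimately show "\<exists>B d. finite B \<and> (\<forall>\<alpha>\<in>B. d \<alpha> \<in> quotient_component \<A> \<alpha> \<inter> range to_fract) \<and>
      r = (\<Sum>\<alpha>\<in>B. d \<alpha>)" by blast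
  next
    fix z :: "'a fract"
    obtain a b where "z = Fract a b" "b \<noteq> 0" by (cases z) auto
    then have "z = to_fract a / to_fract b" "to_fract b \<noteq> 0" by (simp_all add: Fract_conv_to_fract)
    then show "\<exists>f\<in>range to_fract. \<exists>g\<in>range to_fract. g \<noteq> 0 \<and> z = f / g" by blast
  qed
qed

theorem proposition4p1:
  fixes \<A> :: "'g::torsionless_grading_monoid \<Rightarrow> 'a::idom set"
    and R' :: "'a fract set"
  assumes "graded_integral_domain \<A>"
    and "R' = integral_closure_in_field (range to_fract)"
  shows "gr_i_domain \<A> \<longleftrightarrow>
    gr_i_extension (range to_fract) (overring_grading \<A> R') R' \<and>
    gr_Prufer_domain (overring_grading \<A> R') R'"
proof -
  interpret graded_in_field "quotient_component \<A>" "range to_fract"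
    by (rule graded_in_field_quotient[OF assms(1)])
  have grading: "overring_grading \<A> T = (\<lambda>\<alpha>. T \<inter> quotient_component \<A> \<alpha>)" for T
    by (rule ext) (simp add: overring_grading_def)
  have "D \<subseteq> graded_quotient_field \<A>"
  proof
    fix x assume "x \<in> D"
    then obtain f g \<beta> where fg: "f \<in> range to_fract" "g \<in> quotient_component \<A> \<beta>" "g \<noteq> 0" "x = f / g"
      by (rule D_fraction)
    obtain r where r: "f = to_fract r" using fg(1) by blast
    obtain p q \<gamma> \<delta> where pq: "p \<in> \<A> \<gamma>" "p \<noteq> 0" "q \<noteq> 0" "g = Fract p q"
      using fg(2,3) by (rule quotient_componentE)
    have "x = Fract (r * q) p" using pq by (simp add: fg(4) r to_fract_def)
    moreover have "p \<in> homogeneous_elements \<A>" using pq by (auto simp: homogeneous_elements_def)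
    ultimately show "x \<in> graded_quotient_field \<A>" unfolding graded_quotient_field_def by blast
  qed
  then have overring: "graded_overring \<A> T \<longleftrightarrow> subring_closed T \<and> graded_set T \<and> range to_fract \<subseteq> T" for T
    unfolding graded_overring_def subring_iff grading using internal_direct_sum_iff[of T] 
    by (auto simp: graded_set_def)
  show ?thesis
    unfolding gr_i_domain_def overring grading assms(2) by (rule gr_injective_iff)
qed

end
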